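(* Let $I$ be a homogeneous ideal of $S$, let $i\ge 0$, let $H^i_I(S)$ be the $i$-th local cohomology module of $S$ with respect to $I$, and let $J_i=\sqrt{\operatorname{ann}_S H^i_I(S)}$. Assume $J_i\neq 0$ and $\dim S/J_i=d-g$. Then $\mathbf d_{d,0},\ldots,\mathbf d_{d,g-1}\in J_i$ (that is, $\mathbf d_{d,j}\in J_i$ for every integer $j$ with $0\le j\le d-1$ and $j\le g-1$).
   Context: Let $q=p^s$ be a power of a prime $p$, $\mathbb F_q$ the field with $q$ elements, $V$ a $d$-dimensional $\mathbb F_q$-vector space, and $G$ a subgroup of $GL(V)$. Let $R=\mathbb F_q[V]=\operatorname{Sym}_{\mathbb F_q}(V^* )$, graded with $V^*$ in degree $1$, with the natural action of $G$, and let $S=R^G$. Then $S$ contains the Dickson algebra $D^*(d)=R^{GL(V)}$, which is the polynomial ring $\mathbb F_q[\mathbf d_{d,0},\ldots,\mathbf d_{d,d-1}]$, where $\mathbf d_{d,i}$ ($0\le i\le d-1$) is the Dickson polynomial of degree $q^d-q^i$, given by $\prod_{v\in V^*}(X+v)=X^{q^d}+\sum_{i=0}^{d-1}(-1)^{d-i}\mathbf d_{d,i}X^{q^i}$. The zero module has dimension $-1$ by convention. *)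

theory Defs
  imports
    "HOL-Library.Poly_Mapping"
    "HOL-Library.Extended_Real"
    "HOL-Library.Cardinality"
    "HOL-Algebra.QuotRing"
    "HOL-Algebra.Ideal_Product"
    "HOL-Computational_Algebra.Polynomial"
    "Jordan_Normal_Form.Matrix"
begin

section \<open>Polynomials, linear substitutions, invariants\<close>

text \<open>
  The field with \<open>q\<close> elements is a type \<open>'k\<close> of classes \<open>finite\<close> and \<open>field\<close>, with \<open>q = CARD('k)\<close>.
  The vector space \<open>V\<close> is the space of column vectors of length \<open>d\<close> over \<open>'k\<close>; the coordinate
  functions \<open>x_i\<close> with \<open>i < d\<close> are the basis of \<open>V*\<close> dual to the standard basis, so
  that \<open>Sym V*\<close> is the polynomial ring in \<open>x_0, ..., x_{d-1}\<close>.
\<close>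

type_synonym 'k mpoly = "(nat \<Rightarrow>\<^sub>0 nat) \<Rightarrow>\<^sub>0 'k"

definition mconst :: "'k::comm_ring_1 \<Rightarrow> 'k mpoly" where
  "mconst c = Poly_Mapping.single 0 c"

definition mvar :: "nat \<Rightarrow> 'k::comm_ring_1 mpoly" where
  "mvar i = Poly_Mapping.single (Poly_Mapping.single i 1) 1"

definition mpolys :: "nat \<Rightarrow> 'k::comm_ring_1 mpoly set" where
  "mpolys d = {p. \<forall>m \<in> Poly_Mapping.keys p. Poly_Mapping.keys m \<subseteq> {..<d}}"

definition mdeg :: "(nat \<Rightarrow>\<^sub>0 nat) \<Rightarrow> nat" where
  "mdeg m = (\<Sum>i \<in> Poly_Mapping.keys m. Poly_Mapping.lookup m i)"

definition hom_part :: "nat \<Rightarrow> 'k::comm_ring_1 mpoly \<Rightarrow> 'k mpoly" where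
  "hom_part n p =
     (\<Sum>m \<in> {m \<in> Poly_Mapping.keys p. mdeg m = n}. Poly_Mapping.single m (Poly_Mapping.lookup p m))"

text \<open>\<open>p(v)\<close> becomes \<open>p(A v)\<close>, that is, \<open>x_i\<close> is replaced by \<open>\<Sum>j. A_ij x_j\<close>.\<close>

definition lin_subst :: "nat \<Rightarrow> 'k::comm_ring_1 mat \<Rightarrow> 'k mpoly \<Rightarrow> 'k mpoly" where
  "lin_subst d A p =
     (\<Sum>m \<in> Poly_Mapping.keys p. mconst (Poly_Mapping.lookup p m) *
        (\<Prod>i<d. (\<Sum>j<d. mconst (A $$ (i, j)) * mvar j) ^ Poly_Mapping.lookup m i))"

definition GL :: "nat \<Rightarrow> 'k::field mat monoid" where
  "GL d = units_of (ring_mat TYPE('k) d ())"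

text \<open>The natural left action \<open>(g p)(v) = p(g\<inverse> v)\<close>.\<close>

definition gl_act :: "nat \<Rightarrow> 'k::field mat \<Rightarrow> 'k mpoly \<Rightarrow> 'k mpoly" where
  "gl_act d g p = lin_subst d (inv\<^bsub>GL d\<^esub> g) p"

definition invariant_ring :: "nat \<Rightarrow> 'k::field mat set \<Rightarrow> 'k mpoly ring" where
  "invariant_ring d G =
     \<lparr>carrier = {p \<in> mpolys d. \<forall>g \<in> G. gl_act d g p = p},
      monoid.mult = (*), one = 1, zero = 0, add = (+)\<rparr>"

definition homogeneous_ideal :: "'k::field mpoly set \<Rightarrow> 'k mpoly ring \<Rightarrow> bool" where
  "homogeneous_ideal I S \<longleftrightarrow> ideal I S \<and> (\<forall>p \<in> I. \<forall>n. hom_part n p \<in> I)"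

section \<open>Dickson polynomials\<close>

definition linear_forms :: "nat \<Rightarrow> 'k::comm_ring_1 mpoly set" where
  "linear_forms d = {\<Sum>j<d. mconst (c j) * mvar j | c. True}"

text \<open>
  The defining identity
  \<open>\<Prod>v\<in>V*. (X + v) = X^(q^d) + (\<Sum>i<d. (-1)^(d-i) * dickson d i * X^(q^i))\<close>
  says that the coefficient of \<open>X^(q^i)\<close> on the left is \<open>(-1)^(d-i) * dickson d i\<close>.
\<close>

definition dickson :: "nat \<Rightarrow> nat \<Rightarrow> 'k::{finite,field} mpoly" where
  "dickson d i =
     (- 1) ^ (d - i) * coeff (\<Prod>v \<in> linear_forms d. [:v, 1:]) (CARD('k) ^ i)"

section \<open>Modules and injective resolutions\<close>

definition module_homs ::
    "('a, 'r) ring_scheme \<Rightarrow> ('a, 'b) module \<Rightarrow> ('a, 'c) module \<Rightarrow> ('b \<Rightarrow> 'c) set" where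
  "module_homs R M N =
     {f \<in> carrier M \<rightarrow> carrier N.
        (\<forall>x \<in> carrier M. \<forall>y \<in> carrier M. f (x \<oplus>\<^bsub>M\<^esub> y) = f x \<oplus>\<^bsub>N\<^esub> f y) \<and>
        (\<forall>a \<in> carrier R. \<forall>x \<in> carrier M. f (a \<odot>\<^bsub>M\<^esub> x) = a \<odot>\<^bsub>N\<^esub> f x)}"

definition ring_module :: "('a, 'r) ring_scheme \<Rightarrow> ('a, 'a) module" where
  "ring_module R =
     \<lparr>carrier = carrier R, monoid.mult = monoid.mult R, one = one R, zero = zero R, add = add R,
      smult = monoid.mult R\<rparr>"

definition quotient_module :: "('a, 'b) module \<Rightarrow> 'b set \<Rightarrow> ('a, 'b set) module" where
  "quotient_module M N =
     \<lparr>carrier = a_rcosets\<^bsub>M\<^esub> N, monoid.mult = undefined, one = undefined, zero = N, add = set_add M,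
      smult = (\<lambda>a X. \<Union>x \<in> X. N +>\<^bsub>M\<^esub> (a \<odot>\<^bsub>M\<^esub> x))\<rparr>"

text \<open>
  A definition cannot quantify over types, so the extension property is required here only for
  modules whose elements have the type of the elements of \<open>R\<close>. As \<open>R\<close> is one of these modules,
  this is no restriction: lemma \<open>injective_module_extend\<close> below gives the extension property
  for modules over arbitrary types.
\<close>

definition injective_module :: "('a, 'r) ring_scheme \<Rightarrow> ('a, 'e) module \<Rightarrow> bool" where
  "injective_module R E \<longleftrightarrow>
     Module.module R E \<and>
     (\<forall>(N :: ('a, 'a) module) H. \<forall>f \<in> module_homs R (N\<lparr>carrier := H\<rparr>) E.
        Module.module R N \<and> Module.submodule H R N \<longrightarrow>
        (\<exists>g \<in> module_homs R N E. \<forall>x \<in> H. g x = f x))"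

text \<open>\<open>0 \<rightarrow> M \<rightarrow> E 0 \<rightarrow> E 1 \<rightarrow> \<dots>\<close> is exact, with augmentation \<open>\<epsilon>\<close> and differentials \<open>\<delta> n\<close>.\<close>

definition injective_resolution ::
    "('a, 'r) ring_scheme \<Rightarrow> ('a, 'b) module \<Rightarrow> (nat \<Rightarrow> ('a, 'e) module) \<Rightarrow>
     ('b \<Rightarrow> 'e) \<Rightarrow> (nat \<Rightarrow> 'e \<Rightarrow> 'e) \<Rightarrow> bool" where
  "injective_resolution R M E \<epsilon> \<delta> \<longleftrightarrow>
     Module.module R M \<and>
     (\<forall>n. injective_module R (E n)) \<and>
     \<epsilon> \<in> module_homs R M (E 0) \<and>
     (\<forall>n. \<delta> n \<in> module_homs R (E n) (E (Suc n))) \<and>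
     inj_on \<epsilon> (carrier M) \<and>
     \<epsilon> ` carrier M = {x \<in> carrier (E 0). \<delta> 0 x = \<zero>\<^bsub>E 1\<^esub>} \<and>
     (\<forall>n. \<delta> n ` carrier (E n) = {x \<in> carrier (E (Suc n)). \<delta> (Suc n) x = \<zero>\<^bsub>E (Suc (Suc n))\<^esub>})"

lemma module_homsD:
  assumes "f \<in> module_homs R M N"
  shows "x \<in> carrier M \<Longrightarrow> f x \<in> carrier N"
    and "x \<in> carrier M \<Longrightarrow> y \<in> carrier M \<Longrightarrow> f (x \<oplus>\<^bsub>M\<^esub> y) = f x \<oplus>\<^bsub>N\<^esub> f y"
    and "a \<in> carrier R \<Longrightarrow> x \<in> carrier M \<Longrightarrow> f (a \<odot>\<^bsub>M\<^esub> x) = a \<odot>\<^bsub>N\<^esub> f x"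
  using assms by (auto simp: module_homs_def)

lemma ring_module_module:
  assumes "cring R"
  shows "Module.module R (ring_module R)"
proof -
  interpret R: cring R by fact
  show ?thesis
  proof (rule moduleI)
    show "abelian_group (ring_module R)"
      by (rule abelian_groupI)
        (auto simp: ring_module_def R.a_ac intro: R.add.l_inv_ex)
  qed (auto simp: ring_module_def R.l_distr R.r_distr R.m_assoc assms)
qed

text \<open>The extension of a homomorphism is found as a maximal graph, using Baer's argument.\<close>

definition partial_hom_graph ::
    "('a, 'r) ring_scheme \<Rightarrow> ('a, 'n) module \<Rightarrow> ('a, 'e) module \<Rightarrow> ('n \<times> 'e) set \<Rightarrow> bool" where
  "partial_hom_graph R N E \<Gamma> \<longleftrightarrow>
     \<Gamma> \<subseteq> carrier N \<times> carrier E \<and>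
     (\<forall>x e y e'. (x, e) \<in> \<Gamma> \<and> (y, e') \<in> \<Gamma> \<longrightarrow> (x \<oplus>\<^bsub>N\<^esub> y, e \<oplus>\<^bsub>E\<^esub> e') \<in> \<Gamma>) \<and>
     (\<forall>a \<in> carrier R. \<forall>x e. (x, e) \<in> \<Gamma> \<longrightarrow> (a \<odot>\<^bsub>N\<^esub> x, a \<odot>\<^bsub>E\<^esub> e) \<in> \<Gamma>) \<and>
     (\<forall>e. (\<zero>\<^bsub>N\<^esub>, e) \<in> \<Gamma> \<longrightarrow> e = \<zero>\<^bsub>E\<^esub>)"


lemma partial_hom_graphD:
  assumes "partial_hom_graph R N E \<Gamma>"
  shows "(x, e) \<in> \<Gamma> \<Longrightarrow> x \<in> carrier N"
    and "(x, e) \<in> \<Gamma> \<Longrightarrow> e \<in> carrier E"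
    and "(x, e) \<in> \<Gamma> \<Longrightarrow> (y, e') \<in> \<Gamma> \<Longrightarrow> (x \<oplus>\<^bsub>N\<^esub> y, e \<oplus>\<^bsub>E\<^esub> e') \<in> \<Gamma>"
    and "a \<in> carrier R \<Longrightarrow> (x, e) \<in> \<Gamma> \<Longrightarrow> (a \<odot>\<^bsub>N\<^esub> x, a \<odot>\<^bsub>E\<^esub> e) \<in> \<Gamma>"
    and "(\<zero>\<^bsub>N\<^esub>, e) \<in> \<Gamma> \<Longrightarrow> e = \<zero>\<^bsub>E\<^esub>"
  using assms by (auto simp: partial_hom_graph_def)

lemma injective_module_extend:
  fixes R :: "('a, 'r) ring_scheme" and E :: "('a, 'e) module" and N :: "('a, 'n) module"
  assumes inj: "injective_module R E" and N: "Module.module R N"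
    and H: "Module.submodule H R N" and f: "f \<in> module_homs R (N\<lparr>carrier := H\<rparr>) E"
  shows "\<exists>g \<in> module_homs R N E. \<forall>x \<in> H. g x = f x"
proof -
  have E: "Module.module R E"
    using inj by (simp add: injective_module_def)
  interpret N: Module.module R N by fact
  interpret E: Module.module R E by fact
  have HN: "H \<subseteq> carrier N"
    using N.submoduleE(1)[OF H] .
  have H_zero: "\<zero>\<^bsub>N\<^esub> \<in> H"
    using H by (auto simp: submodule_def dest: subgroup.one_closed)
  note f1 = module_homsD[OF f, simplified]
  define F where "F = (\<lambda>x. (x, f x)) ` H"
  define A where "A = {\<Gamma>. partial_hom_graph R N E \<Gamma> \<and> F \<subseteq> \<Gamma>}"
  have f0: "f \<zero>\<^bsub>N\<^esub> = \<zero>\<^bsub>E\<^esub>"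
    using f1(3)[of "\<zero>\<^bsub>R\<^esub>" "\<zero>\<^bsub>N\<^esub>"] f1(1)[OF H_zero] H_zero by simp
  have F: "partial_hom_graph R N E F"
    unfolding partial_hom_graph_def F_def using HN f0 N.submoduleE(4,5)[OF H]
    by (auto simp: f1 image_iff)
  have "\<exists>M\<in>A. \<forall>X\<in>A. M \<subseteq> X \<longrightarrow> X = M"
  proof (rule subset_Zorn_nonempty)
    show "A \<noteq> {}" using F by (auto simp: A_def)
    fix C assume C: "C \<noteq> {}" "subset.chain A C"
    have CA: "partial_hom_graph R N E \<Gamma>" "F \<subseteq> \<Gamma>" if "\<Gamma> \<in> C" for \<Gamma>
      using C(2) that by (auto simp: subset.chain_def A_def)
    have two: "\<exists>\<Gamma>\<in>C. u \<in> \<Gamma> \<and> v \<in> \<Gamma>" if "u \<in> \<Union>C" "v \<in> \<Union>C" for u v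
      using C(2) that unfolding subset.chain_def by blast
    have "partial_hom_graph R N E (\<Union>C)"
      unfolding partial_hom_graph_def
    proof (intro conjI allI impI ballI)
      show "\<Union>C \<subseteq> carrier N \<times> carrier E"
        using partial_hom_graphD(1,2)[OF CA(1)] by fast
    next
      fix x e y e' assume "(x, e) \<in> \<Union>C \<and> (y, e') \<in> \<Union>C"
      then obtain \<Gamma> where "\<Gamma> \<in> C" "(x, e) \<in> \<Gamma>" "(y, e') \<in> \<Gamma>" using two by blast
      then show "(x \<oplus>\<^bsub>N\<^esub> y, e \<oplus>\<^bsub>E\<^esub> e') \<in> \<Union>C"
        using partial_hom_graphD(3)[OF CA(1)] by (intro UnionI)
    next
      fix a x e assume "a \<in> carrier R" "(x, e) \<in> \<Union>C"
      then show "(a \<odot>\<^bsub>N\<^esub> x, a \<odot>\<^bsub>E\<^esub> e) \<in> \<Union>C"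
        using partial_hom_graphD(4)[OF CA(1)] by (elim UnionE, intro UnionI)
    next
      fix e assume "(\<zero>\<^bsub>N\<^esub>, e) \<in> \<Union>C"
      then show "e = \<zero>\<^bsub>E\<^esub>"
        using partial_hom_graphD(5)[OF CA(1)] by (elim UnionE)
    qed
    then show "\<Union>C \<in> A" using C(1) CA by (auto simp: A_def)
  qed
  then obtain \<Gamma> where \<Gamma>A: "\<Gamma> \<in> A" and max: "\<And>X. X \<in> A \<Longrightarrow> \<Gamma> \<subseteq> X \<Longrightarrow> X = \<Gamma>"
    by blast
  have FG: "F \<subseteq> \<Gamma>" and G: "partial_hom_graph R N E \<Gamma>"
    using \<Gamma>A by (auto simp: A_def)
  note Gc = partial_hom_graphD(1,2)[OF G]
    and Gadd = partial_hom_graphD(3)[OF G]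
    and Gsm = partial_hom_graphD(4)[OF G]
    and G0 = partial_hom_graphD(5)[OF G]
  have Gneg: "(\<ominus>\<^bsub>N\<^esub> x, \<ominus>\<^bsub>E\<^esub> e) \<in> \<Gamma>" if "(x, e) \<in> \<Gamma>" for x e
    using Gsm[of "\<ominus>\<^bsub>R\<^esub> \<one>\<^bsub>R\<^esub>", OF _ that] Gc[OF that]
    by (simp add: N.smult_l_minus E.smult_l_minus)
  have Guniq: "e = e'" if "(x, e) \<in> \<Gamma>" "(x, e') \<in> \<Gamma>" for x e e'
  proof -
    have "(\<zero>\<^bsub>N\<^esub>, e \<oplus>\<^bsub>E\<^esub> \<ominus>\<^bsub>E\<^esub> e') \<in> \<Gamma>"
      using Gadd[OF that(1) Gneg[OF that(2)]] Gc[OF that(1)] by (simp add: N.r_neg)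
    then have "e \<oplus>\<^bsub>E\<^esub> \<ominus>\<^bsub>E\<^esub> e' = \<zero>\<^bsub>E\<^esub>" using G0 by blast
    then show ?thesis
      using Gc(2)[OF that(1)] Gc(2)[OF that(2)]
      by (simp add: E.M.add.inv_solve_right')
  qed
  have total: "\<exists>e. (x, e) \<in> \<Gamma>" if x: "x \<in> carrier N" for x
  proof -
    define K where "K = {a \<in> carrier R. \<exists>e. (a \<odot>\<^bsub>N\<^esub> x, e) \<in> \<Gamma>}"
    define h where "h a = (THE e. (a \<odot>\<^bsub>N\<^esub> x, e) \<in> \<Gamma>)" for a
    have h: "h a = e" if "(a \<odot>\<^bsub>N\<^esub> x, e) \<in> \<Gamma>" for a e
      unfolding h_def using Guniq that by blast
    have RR: "Module.module R (ring_module R)"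
      by (rule ring_module_module) (rule N.R.is_cring)
    interpret RR: Module.module R "ring_module R" by fact
    have zz: "(\<zero>\<^bsub>N\<^esub>, \<zero>\<^bsub>E\<^esub>) \<in> \<Gamma>"
      using FG H_zero f0 by (auto simp: F_def image_iff)
    have Kadd: "a \<oplus>\<^bsub>R\<^esub> b \<in> K \<and> h (a \<oplus>\<^bsub>R\<^esub> b) = h a \<oplus>\<^bsub>E\<^esub> h b" if ab: "a \<in> K" "b \<in> K" for a b
    proof -
      from ab obtain e e' where e: "(a \<odot>\<^bsub>N\<^esub> x, e) \<in> \<Gamma>" "(b \<odot>\<^bsub>N\<^esub> x, e') \<in> \<Gamma>"
        and c: "a \<in> carrier R" "b \<in> carrier R" by (auto simp: K_def)
      have "((a \<oplus>\<^bsub>R\<^esub> b) \<odot>\<^bsub>N\<^esub> x, e \<oplus>\<^bsub>E\<^esub> e') \<in> \<Gamma>"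
        using Gadd[OF e] c x by (simp add: N.smult_l_distr)
      then show ?thesis using h e c by (auto simp: K_def)
    qed
    have Ksm: "a \<otimes>\<^bsub>R\<^esub> b \<in> K \<and> h (a \<otimes>\<^bsub>R\<^esub> b) = a \<odot>\<^bsub>E\<^esub> h b" if ab: "a \<in> carrier R" "b \<in> K" for a b
    proof -
      from ab obtain e where e: "(b \<odot>\<^bsub>N\<^esub> x, e) \<in> \<Gamma>" and c: "b \<in> carrier R"
        by (auto simp: K_def)
      have "((a \<otimes>\<^bsub>R\<^esub> b) \<odot>\<^bsub>N\<^esub> x, a \<odot>\<^bsub>E\<^esub> e) \<in> \<Gamma>"
        using Gsm[OF ab(1) e] c x ab by (simp add: N.smult_assoc1)
      then show ?thesis using h e c ab by (auto simp: K_def)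
    qed
    have K0: "\<zero>\<^bsub>R\<^esub> \<in> K" using x zz by (auto simp: K_def)
    have ainv: "\<ominus>\<^bsub>ring_module R\<^esub> a = \<ominus>\<^bsub>R\<^esub> \<one>\<^bsub>R\<^esub> \<otimes>\<^bsub>R\<^esub> a" if "a \<in> carrier R" for a
    proof -
      have "(\<ominus>\<^bsub>R\<^esub> \<one>\<^bsub>R\<^esub>) \<odot>\<^bsub>ring_module R\<^esub> a = \<ominus>\<^bsub>ring_module R\<^esub> (\<one>\<^bsub>R\<^esub> \<odot>\<^bsub>ring_module R\<^esub> a)"
        by (rule RR.smult_l_minus) (use that in \<open>auto simp: ring_module_def\<close>)
      then show ?thesis using that by (simp add: ring_module_def)
    qed
    have "Module.submodule K R (ring_module R)"
    proof (rule RR.submoduleI)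
      show "K \<subseteq> carrier (ring_module R)" by (auto simp: K_def ring_module_def)
      show "\<zero>\<^bsub>ring_module R\<^esub> \<in> K" using K0 by (simp add: ring_module_def)
    next
      fix a assume "a \<in> K"
      moreover from this have "a \<in> carrier R" by (simp add: K_def)
      ultimately show "\<ominus>\<^bsub>ring_module R\<^esub> a \<in> K" using Ksm ainv by simp
    next
      fix a b assume "a \<in> K" "b \<in> K"
      then show "a \<oplus>\<^bsub>ring_module R\<^esub> b \<in> K" using Kadd by (simp add: ring_module_def)
    next
      fix a b assume "a \<in> carrier R" "b \<in> K"
      then show "a \<odot>\<^bsub>ring_module R\<^esub> b \<in> K" using Ksm by (simp add: ring_module_def)
    qed
    moreover have "h \<in> module_homs R ((ring_module R)\<lparr>carrier := K\<rparr>) E"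
      unfolding module_homs_def
    proof (intro CollectI conjI ballI)
      show "h \<in> carrier ((ring_module R)\<lparr>carrier := K\<rparr>) \<rightarrow> carrier E"
        using h Gc by (fastforce simp: K_def)
    qed (auto simp: ring_module_def Kadd Ksm)
    ultimately obtain g where g: "g \<in> module_homs R (ring_module R) E" and gh: "\<And>a. a \<in> K \<Longrightarrow> g a = h a"
      using inj RR unfolding injective_module_def by blast
    define w where "w = g \<one>\<^bsub>R\<^esub>"
    have w: "w \<in> carrier E"
      unfolding w_def by (rule module_homsD(1)[OF g]) (simp add: ring_module_def)
    have ga: "g a = a \<odot>\<^bsub>E\<^esub> w" if "a \<in> carrier R" for a
      using module_homsD(3)[OF g, of a "\<one>\<^bsub>R\<^esub>"] that by (simp add: ring_module_def w_def)
    define \<Delta> where "\<Delta> = {(y \<oplus>\<^bsub>N\<^esub> a \<odot>\<^bsub>N\<^esub> x, e \<oplus>\<^bsub>E\<^esub> a \<odot>\<^bsub>E\<^esub> w) | y e a. (y, e) \<in> \<Gamma> \<and> a \<in> carrier R}"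
    have DI: "(y \<oplus>\<^bsub>N\<^esub> a \<odot>\<^bsub>N\<^esub> x, e \<oplus>\<^bsub>E\<^esub> a \<odot>\<^bsub>E\<^esub> w) \<in> \<Delta>" if "(y, e) \<in> \<Gamma>" "a \<in> carrier R" for y e a
      using that by (auto simp: \<Delta>_def)
    have GD: "\<Gamma> \<subseteq> \<Delta>"
    proof
      fix u assume u: "u \<in> \<Gamma>"
      obtain y e where ye: "u = (y, e)" by (cases u)
      show "u \<in> \<Delta>"
        using DI[of y e "\<zero>\<^bsub>R\<^esub>"] u Gc[of y e] x w by (simp add: ye)
    qed
    have "partial_hom_graph R N E \<Delta>"
      unfolding partial_hom_graph_def
    proof (intro conjI allI impI ballI)
      show "\<Delta> \<subseteq> carrier N \<times> carrier E"
        using Gc x w by (auto simp: \<Delta>_def)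
    next
      fix u e v e' assume "(u, e) \<in> \<Delta> \<and> (v, e') \<in> \<Delta>"
      then obtain y b a y' b' a' where *: "(y, b) \<in> \<Gamma>" "a \<in> carrier R" "(y', b') \<in> \<Gamma>" "a' \<in> carrier R"
        "u = y \<oplus>\<^bsub>N\<^esub> a \<odot>\<^bsub>N\<^esub> x" "e = b \<oplus>\<^bsub>E\<^esub> a \<odot>\<^bsub>E\<^esub> w"
        "v = y' \<oplus>\<^bsub>N\<^esub> a' \<odot>\<^bsub>N\<^esub> x" "e' = b' \<oplus>\<^bsub>E\<^esub> a' \<odot>\<^bsub>E\<^esub> w"
        by (auto simp: \<Delta>_def)
      have "u \<oplus>\<^bsub>N\<^esub> v = (y \<oplus>\<^bsub>N\<^esub> y') \<oplus>\<^bsub>N\<^esub> (a \<oplus>\<^bsub>R\<^esub> a') \<odot>\<^bsub>N\<^esub> x"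
        using * Gc x by (simp add: N.smult_l_distr N.M.a_ac)
      moreover have "e \<oplus>\<^bsub>E\<^esub> e' = (b \<oplus>\<^bsub>E\<^esub> b') \<oplus>\<^bsub>E\<^esub> (a \<oplus>\<^bsub>R\<^esub> a') \<odot>\<^bsub>E\<^esub> w"
        using * Gc w by (simp add: E.smult_l_distr E.M.a_ac)
      ultimately show "(u \<oplus>\<^bsub>N\<^esub> v, e \<oplus>\<^bsub>E\<^esub> e') \<in> \<Delta>"
        using DI[OF Gadd[OF *(1,3)], of "a \<oplus>\<^bsub>R\<^esub> a'"] * by simp
    next
      fix c u e assume c: "c \<in> carrier R" and "(u, e) \<in> \<Delta>"
      then obtain y b a where *: "(y, b) \<in> \<Gamma>" "a \<in> carrier R"
        "u = y \<oplus>\<^bsub>N\<^esub> a \<odot>\<^bsub>N\<^esub> x" "e = b \<oplus>\<^bsub>E\<^esub> a \<odot>\<^bsub>E\<^esub> w"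
        by (auto simp: \<Delta>_def)
      show "(c \<odot>\<^bsub>N\<^esub> u, c \<odot>\<^bsub>E\<^esub> e) \<in> \<Delta>"
        using DI[OF Gsm[OF c *(1)], of "c \<otimes>\<^bsub>R\<^esub> a"] * Gc x w c
        by (simp add: N.smult_r_distr E.smult_r_distr N.smult_assoc1 E.smult_assoc1)
    next
      fix e assume "(\<zero>\<^bsub>N\<^esub>, e) \<in> \<Delta>"
      then obtain y b a where *: "(y, b) \<in> \<Gamma>" "a \<in> carrier R"
        "\<zero>\<^bsub>N\<^esub> = y \<oplus>\<^bsub>N\<^esub> a \<odot>\<^bsub>N\<^esub> x" "e = b \<oplus>\<^bsub>E\<^esub> a \<odot>\<^bsub>E\<^esub> w"
        by (auto simp: \<Delta>_def)
      note c = Gc[OF *(1)]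
      have "a \<odot>\<^bsub>N\<^esub> x = \<ominus>\<^bsub>N\<^esub> y"
        using *(3) c(1) x *(2) N.M.minus_equality[of "a \<odot>\<^bsub>N\<^esub> x" y] by (simp add: N.M.a_comm)
      then have "(a \<odot>\<^bsub>N\<^esub> x, \<ominus>\<^bsub>E\<^esub> b) \<in> \<Gamma>" using Gneg[OF *(1)] by simp
      then have "a \<in> K" "h a = \<ominus>\<^bsub>E\<^esub> b" using *(2) h by (auto simp: K_def)
      then have "a \<odot>\<^bsub>E\<^esub> w = \<ominus>\<^bsub>E\<^esub> b" using gh ga *(2) by metis
      then show "e = \<zero>\<^bsub>E\<^esub>" using *(4) c by (simp add: E.M.r_neg)
    qed
    then have "\<Delta> = \<Gamma>" using max GD FG by (auto simp: A_def)
    moreover have "(x, w) \<in> \<Delta>"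
      using DI[OF zz, of "\<one>\<^bsub>R\<^esub>"] x w by simp
    ultimately show ?thesis by blast
  qed
  define g where "g x = (THE e. (x, e) \<in> \<Gamma>)" for x
  have g: "g x = e" if "(x, e) \<in> \<Gamma>" for x e
    unfolding g_def using Guniq that by blast
  have gG: "(x, g x) \<in> \<Gamma>" if "x \<in> carrier N" for x
    using total[OF that] g by blast
  have "g \<in> module_homs R N E"
    unfolding module_homs_def
  proof (intro CollectI conjI ballI)
    show "g \<in> carrier N \<rightarrow> carrier E" using Gc(2)[OF gG] by blast
  next
    fix x y assume "x \<in> carrier N" "y \<in> carrier N"
    then show "g (x \<oplus>\<^bsub>N\<^esub> y) = g x \<oplus>\<^bsub>E\<^esub> g y" by (intro g Gadd gG)
  next
    fix a x assume "a \<in> carrier R" "x \<in> carrier N"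
    then show "g (a \<odot>\<^bsub>N\<^esub> x) = a \<odot>\<^bsub>E\<^esub> g x" by (intro g Gsm gG)
  qed
  moreover have "\<forall>x \<in> H. g x = f x"
    using FG g by (auto simp: F_def)
  ultimately show ?thesis by blast
qed

section \<open>Local cohomology\<close>

text \<open>\<open>\<Gamma>_I(M)\<close>; the power \<open>I^n\<close> is taken in the monoid of ideals, so \<open>I^0 = R\<close>.\<close>

definition torsion_part :: "('a, 'r) ring_scheme \<Rightarrow> 'a set \<Rightarrow> ('a, 'b) module \<Rightarrow> 'b set" where
  "torsion_part R I M =
     {x \<in> carrier M. \<exists>n::nat. \<forall>a \<in> I [^]\<^bsub>ideals_set R\<^esub> n. a \<odot>\<^bsub>M\<^esub> x = \<zero>\<^bsub>M\<^esub>}"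

text \<open>
  The \<open>i\<close>-th right derived functor of \<open>\<Gamma>_I\<close>: the cohomology in degree \<open>i\<close> of \<open>\<Gamma>_I(E)\<close>, to be
  used with an injective resolution \<open>(E, \<delta>)\<close> of the module in question. Two injective resolutions
  give isomorphic modules.
\<close>

definition local_cohomology ::
    "('a, 'r) ring_scheme \<Rightarrow> 'a set \<Rightarrow> (nat \<Rightarrow> ('a, 'e) module) \<Rightarrow> (nat \<Rightarrow> 'e \<Rightarrow> 'e) \<Rightarrow> nat \<Rightarrow>
     ('a, 'e set) module" where
  "local_cohomology R I E \<delta> i =
     quotient_module
       ((E i)\<lparr>carrier := {x \<in> torsion_part R I (E i). \<delta> i x = \<zero>\<^bsub>E (Suc i)\<^esub>}\<rparr>)
       (case i of 0 \<Rightarrow> {\<zero>\<^bsub>E 0\<^esub>} | Suc j \<Rightarrow> \<delta> j ` torsion_part R I (E j))"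

section \<open>Annihilators, radicals, Krull dimension\<close>

definition annihilator :: "('a, 'r) ring_scheme \<Rightarrow> ('a, 'b) module \<Rightarrow> 'a set" where
  "annihilator R M = {a \<in> carrier R. \<forall>x \<in> carrier M. a \<odot>\<^bsub>M\<^esub> x = \<zero>\<^bsub>M\<^esub>}"

definition radical :: "('a, 'r) ring_scheme \<Rightarrow> 'a set \<Rightarrow> 'a set" where
  "radical R I = {a \<in> carrier R. \<exists>n::nat. a [^]\<^bsub>R\<^esub> n \<in> I}"

definition prime_chain :: "('a, 'r) ring_scheme \<Rightarrow> nat \<Rightarrow> (nat \<Rightarrow> 'a set) \<Rightarrow> bool" where
  "prime_chain A n P \<longleftrightarrow> (\<forall>k\<le>n. primeideal (P k) A) \<and> (\<forall>k<n. P k \<subset> P (Suc k))"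

text \<open>By convention the zero ring has dimension \<open>-1\<close>.\<close>

definition krull_dim :: "('a, 'r) ring_scheme \<Rightarrow> ereal" where
  "krull_dim A =
     (if carrier A = {\<zero>\<^bsub>A\<^esub>} then -1 else (SUP n \<in> {n. \<exists>P. prime_chain A n P}. ereal (real n)))"

end

theory Submission
  imports Defs
begin

text \<open>
  The Steenrod operations act on local cohomology and permit few prime ideals of \<open>R = Sym V*\<close> to be
  stable; the theorem follows from these two facts. For each \<open>j\<close> the homomorphism \<open>p(x) \<mapsto> p(x + x\<^bsup>q^j\<^esup> \<xi>)\<close>
  from \<open>R\<close> to \<open>R[\<xi>]\<close> commutes with \<open>GL(V)\<close>, because raising to the power \<open>q^j\<close> is linear over
  the field with \<open>q\<close> elements. Its coefficients therefore form a higher derivation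
  \<open>D\<^sub>0 = id, D\<^sub>1, D\<^sub>2, \<dots>\<close> of \<open>R\<close> that restricts to the ring of invariants \<open>S\<close>.

  A higher derivation of \<open>S\<close> lifts to an injective resolution \<open>E\<close> of \<open>S\<close>. The lift is a chain map
  from \<open>E\<close> to \<open>E[\<xi>]/\<xi>\<^sup>n\<close> on which \<open>a\<close> acts as \<open>\<Sum>k. D\<^sub>k(a) \<xi>\<^sup>k\<close>, and it exists because this
  twisted module is an iterated extension of copies of \<open>E\<close>, hence injective. The lifted operators
  respect torsion and satisfy the Leibniz rule, so the annihilator \<open>A\<close> of a local cohomology module
  is stable under all \<open>D\<^sub>n\<close> (\<open>higher_derivation_annihilator\<close>).

  The ideal \<open>J\<close> is the radical of \<open>A\<close>. Suppose that no power of \<open>d\<^bsub>d,j\<^esub>\<close> lies in \<open>A\<close>. Some prime ideal of \<open>S\<close> contains \<open>A\<close> but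
  not \<open>d\<^bsub>d,j\<^esub>\<close>. By \<open>lying_over\<close> it is the trace of a prime ideal of \<open>R\<close>, and the latter contains
  a prime ideal \<open>Q\<close> of \<open>R\<close> that is minimal over \<open>A\<close>. Minimality makes \<open>Q\<close> stable under the Steenrod
  operations (\<open>minimal_prime_stable\<close>), and stable primes are generated by linear forms
  (\<open>kernel_of_projection\<close>). Let \<open>k\<close> be the dimension of \<open>K = Q \<inter> V*\<close>. Modulo \<open>Q\<close>, the product of all
  \<open>X + v\<close> becomes \<open>X\<^bsup>q^k\<^esup>\<close> times a polynomial with nonzero constant term; hence
  \<open>d\<^bsub>d,0\<^esub>, \<dots>, d\<^bsub>d,k-1\<^esub>\<close> lie in \<open>Q\<close> and \<open>d\<^bsub>d,k\<^esub>\<close> does not. In particular \<open>k \<le> j\<close>. Enlarging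
  \<open>K\<close> one dimension at a time gives a chain of \<open>d - k\<close> proper inclusions of primes of \<open>R\<close>, and the
  Dickson polynomials show that it stays strict after intersection with \<open>S\<close>
  (\<open>stable_prime_chain\<close>). So \<open>d - j \<le> d - k \<le> dim S/J = d - g\<close>, that is, \<open>g \<le> j\<close>.
\<close>

section \<open>Higher derivations and twisted modules\<close>

text \<open>
  A Hasse-Schmidt derivation: \<open>a \<mapsto> \<Sum>n. D n a \<xi>\<^sup>n\<close> is a homomorphism from \<open>R\<close> to the power
  series over \<open>R\<close> that reduces to the identity modulo \<open>\<xi>\<close>.
\<close>

definition higher_derivation :: "('a, 'r) ring_scheme \<Rightarrow> (nat \<Rightarrow> 'a \<Rightarrow> 'a) \<Rightarrow> bool" where
  "higher_derivation R D \<longleftrightarrow>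
     (\<forall>n. \<forall>a \<in> carrier R. D n a \<in> carrier R) \<and>
     (\<forall>a \<in> carrier R. D 0 a = a) \<and>
     (\<forall>n>0. D n \<one>\<^bsub>R\<^esub> = \<zero>\<^bsub>R\<^esub>) \<and>
     (\<forall>n. \<forall>a \<in> carrier R. \<forall>b \<in> carrier R. D n (a \<oplus>\<^bsub>R\<^esub> b) = D n a \<oplus>\<^bsub>R\<^esub> D n b) \<and>
     (\<forall>n. \<forall>a \<in> carrier R. \<forall>b \<in> carrier R.
        D n (a \<otimes>\<^bsub>R\<^esub> b) = (\<Oplus>\<^bsub>R\<^esub>j\<in>{..n}. D j a \<otimes>\<^bsub>R\<^esub> D (n - j) b))"

lemma higher_derivationD:
  assumes "higher_derivation R D"
  shows "a \<in> carrier R \<Longrightarrow> D n a \<in> carrier R"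
    and "a \<in> carrier R \<Longrightarrow> D 0 a = a"
    and "n > 0 \<Longrightarrow> D n \<one>\<^bsub>R\<^esub> = \<zero>\<^bsub>R\<^esub>"
    and "a \<in> carrier R \<Longrightarrow> b \<in> carrier R \<Longrightarrow> D n (a \<oplus>\<^bsub>R\<^esub> b) = D n a \<oplus>\<^bsub>R\<^esub> D n b"
    and "a \<in> carrier R \<Longrightarrow> b \<in> carrier R \<Longrightarrow>
      D n (a \<otimes>\<^bsub>R\<^esub> b) = (\<Oplus>\<^bsub>R\<^esub>j\<in>{..n}. D j a \<otimes>\<^bsub>R\<^esub> D (n - j) b)"
  using assms by (auto simp: higher_derivation_def)

text \<open>
  \<open>E[\<xi>]/\<xi>\<^sup>n\<close>, on which \<open>a\<close> acts as multiplication by \<open>\<Sum>k. D k a \<xi>\<^sup>k\<close>. An element is the function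
  of its coefficients, and these are zero from index \<open>n\<close> on.
\<close>

definition twisted_module ::
    "(nat \<Rightarrow> 'a \<Rightarrow> 'a) \<Rightarrow> nat \<Rightarrow> ('a, 'e) module \<Rightarrow> ('a, nat \<Rightarrow> 'e) module" where
  "twisted_module D n E =
     \<lparr>carrier = {x. (\<forall>k<n. x k \<in> carrier E) \<and> (\<forall>k\<ge>n. x k = \<zero>\<^bsub>E\<^esub>)},
      monoid.mult = undefined, one = undefined, zero = (\<lambda>k. \<zero>\<^bsub>E\<^esub>),
      add = (\<lambda>x y k. x k \<oplus>\<^bsub>E\<^esub> y k),
      smult = (\<lambda>a x k. if k < n then (\<Oplus>\<^bsub>E\<^esub>j\<in>{..k}. D j a \<odot>\<^bsub>E\<^esub> x (k - j)) else \<zero>\<^bsub>E\<^esub>)\<rparr>"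

lemma (in abelian_monoid) finsum_triangle:
  assumes "\<And>i j. f i j \<in> carrier G"
  shows "(\<Oplus>m\<in>{..k::nat}. \<Oplus>j\<in>{..m}. f j (m - j)) = (\<Oplus>j\<in>{..k}. \<Oplus>i\<in>{..k - j}. f j i)"
proof (induction k)
  case 0
  show ?case by (simp add: assms)
next
  case (Suc k)
  have "(\<Oplus>j\<in>{..k}. \<Oplus>i\<in>{..Suc k - j}. f j i)
      = (\<Oplus>j\<in>{..k}. f j (Suc k - j) \<oplus> (\<Oplus>i\<in>{..k - j}. f j i))"
    by (rule finsum_cong') (auto simp: assms Suc_diff_le)
  also have "\<dots> = (\<Oplus>j\<in>{..k}. f j (Suc k - j)) \<oplus> (\<Oplus>j\<in>{..k}. \<Oplus>i\<in>{..k - j}. f j i)"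
    by (rule finsum_addf) (auto simp: assms)
  finally show ?case
    by (simp add: assms Suc.IH[symmetric] Pi_def a_ac)
qed

lemma (in module) finsum_smult_rdistr:
  assumes "finite A" "x \<in> carrier M" "f \<in> A \<rightarrow> carrier R"
  shows "(\<Oplus>\<^bsub>R\<^esub>i\<in>A. f i) \<odot>\<^bsub>M\<^esub> x = (\<Oplus>\<^bsub>M\<^esub>i\<in>A. f i \<odot>\<^bsub>M\<^esub> x)"
  using assms
proof (induct set: finite)
  case (insert y F)
  then show ?case by (simp add: Pi_def smult_l_distr)
qed simp

text \<open>
  Associativity of the twisted action is the Leibniz rule for \<open>D\<close>.
\<close>

lemma twisted_module_module:
  fixes R :: "('a, 'r) ring_scheme" and E :: "('a, 'e) module" (structure)
  assumes D: "higher_derivation R D" and E: "Module.module R E"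
  shows "Module.module R (twisted_module D n E)"
proof -
  interpret Module.module R E by fact
  note Dc = higher_derivationD[OF D]
  let ?X = "twisted_module D n E"
  have cc: "x k \<in> carrier E" if "x \<in> carrier ?X" for x k
    using that by (cases "k < n") (auto simp: twisted_module_def)
  have in_X: "x \<in> carrier ?X \<longleftrightarrow> (\<forall>k<n. x k \<in> carrier E) \<and> (\<forall>k\<ge>n. x k = \<zero>)" for x
    by (auto simp: twisted_module_def)
  have zero: "\<zero>\<^bsub>?X\<^esub> = (\<lambda>k. \<zero>)" and add: "x \<oplus>\<^bsub>?X\<^esub> y = (\<lambda>k. x k \<oplus> y k)"
    and sm: "a \<odot>\<^bsub>?X\<^esub> x = (\<lambda>k. if k < n then (\<Oplus>j\<in>{..k}. D j a \<odot> x (k - j)) else \<zero>)"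
    for x y a by (auto simp: twisted_module_def)
  have smc: "a \<odot>\<^bsub>?X\<^esub> x \<in> carrier ?X" if "a \<in> carrier R" "x \<in> carrier ?X" for a x
    unfolding in_X sm using that by (auto simp: cc Dc intro!: M.finsum_closed)
  show ?thesis
  proof (rule moduleI)
    show "cring R" by (rule R.is_cring)
    show "abelian_group ?X"
    proof (rule abelian_groupI)
      show "\<exists>y\<in>carrier ?X. y \<oplus>\<^bsub>?X\<^esub> x = \<zero>\<^bsub>?X\<^esub>" if x: "x \<in> carrier ?X" for x
        by (rule bexI[of _ "\<lambda>k. \<ominus> x k"]) (use x in \<open>auto simp: in_X zero add cc[OF x] M.l_neg\<close>)
      show "x \<oplus>\<^bsub>?X\<^esub> y \<oplus>\<^bsub>?X\<^esub> z = x \<oplus>\<^bsub>?X\<^esub> (y \<oplus>\<^bsub>?X\<^esub> z)"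
        if "x \<in> carrier ?X" "y \<in> carrier ?X" "z \<in> carrier ?X" for x y z
        using that cc unfolding add by (auto simp: M.a_assoc)
      show "x \<oplus>\<^bsub>?X\<^esub> y = y \<oplus>\<^bsub>?X\<^esub> x"
        if "x \<in> carrier ?X" "y \<in> carrier ?X" for x y
        using that cc unfolding add by (auto simp: M.a_comm)
      show "\<zero>\<^bsub>?X\<^esub> \<oplus>\<^bsub>?X\<^esub> x = x" if "x \<in> carrier ?X" for x
        using that cc unfolding add zero by auto
    qed (auto simp: in_X zero add)
  next
    fix a b x assume *: "a \<in> carrier R" "b \<in> carrier R" "x \<in> carrier ?X"
    show "(a \<oplus>\<^bsub>R\<^esub> b) \<odot>\<^bsub>?X\<^esub> x = a \<odot>\<^bsub>?X\<^esub> x \<oplus>\<^bsub>?X\<^esub> b \<odot>\<^bsub>?X\<^esub> x"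
    proof
      fix k
      have "(\<Oplus>j\<in>{..k}. D j (a \<oplus>\<^bsub>R\<^esub> b) \<odot> x (k - j))
          = (\<Oplus>j\<in>{..k}. D j a \<odot> x (k - j) \<oplus> D j b \<odot> x (k - j))"
        using * by (intro M.finsum_cong') (auto simp: Dc smult_l_distr cc)
      also have "\<dots> = (\<Oplus>j\<in>{..k}. D j a \<odot> x (k - j)) \<oplus> (\<Oplus>j\<in>{..k}. D j b \<odot> x (k - j))"
        using * by (intro M.finsum_addf) (auto simp: Dc cc)
      finally show "((a \<oplus>\<^bsub>R\<^esub> b) \<odot>\<^bsub>?X\<^esub> x) k = (a \<odot>\<^bsub>?X\<^esub> x \<oplus>\<^bsub>?X\<^esub> b \<odot>\<^bsub>?X\<^esub> x) k"
        by (simp add: sm add)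
    qed
    show "(a \<otimes>\<^bsub>R\<^esub> b) \<odot>\<^bsub>?X\<^esub> x = a \<odot>\<^bsub>?X\<^esub> (b \<odot>\<^bsub>?X\<^esub> x)"
    proof
      fix k
      have "(\<Oplus>m\<in>{..k}. D m (a \<otimes>\<^bsub>R\<^esub> b) \<odot> x (k - m))
          = (\<Oplus>m\<in>{..k}. \<Oplus>j\<in>{..m}. D j a \<odot> (D (m - j) b \<odot> x (k - j - (m - j))))"
        using * by (intro M.finsum_cong') 
          (auto simp: Dc cc finsum_smult_rdistr smult_assoc1 Pi_def intro!: M.finsum_cong' M.finsum_closed)
      also have "\<dots> = (\<Oplus>j\<in>{..k}. \<Oplus>i\<in>{..k - j}. D j a \<odot> (D i b \<odot> x (k - j - i)))"
        by (rule M.finsum_triangle) (use * in \<open>auto simp: Dc cc\<close>)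
      also have "\<dots> = (\<Oplus>j\<in>{..k}. D j a \<odot> (\<Oplus>i\<in>{..k - j}. D i b \<odot> x (k - j - i)))"
        using * by (intro M.finsum_cong')
          (auto simp: Dc cc finsum_smult_ldistr Pi_def intro!: M.finsum_closed)
      finally show "((a \<otimes>\<^bsub>R\<^esub> b) \<odot>\<^bsub>?X\<^esub> x) k = (a \<odot>\<^bsub>?X\<^esub> (b \<odot>\<^bsub>?X\<^esub> x)) k"
        using * by (auto simp: sm Dc cc intro!: M.finsum_cong' M.finsum_closed)
    qed
  next
    fix a x y assume *: "a \<in> carrier R" "x \<in> carrier ?X" "y \<in> carrier ?X"
    show "a \<odot>\<^bsub>?X\<^esub> (x \<oplus>\<^bsub>?X\<^esub> y) = a \<odot>\<^bsub>?X\<^esub> x \<oplus>\<^bsub>?X\<^esub> a \<odot>\<^bsub>?X\<^esub> y"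
    proof
      fix k
      have "(\<Oplus>j\<in>{..k}. D j a \<odot> (x (k - j) \<oplus> y (k - j)))
          = (\<Oplus>j\<in>{..k}. D j a \<odot> x (k - j) \<oplus> D j a \<odot> y (k - j))"
        using * by (intro M.finsum_cong') (auto simp: Dc smult_r_distr cc)
      also have "\<dots> = (\<Oplus>j\<in>{..k}. D j a \<odot> x (k - j)) \<oplus> (\<Oplus>j\<in>{..k}. D j a \<odot> y (k - j))"
        using * by (intro M.finsum_addf) (auto simp: Dc cc)
      finally show "(a \<odot>\<^bsub>?X\<^esub> (x \<oplus>\<^bsub>?X\<^esub> y)) k = (a \<odot>\<^bsub>?X\<^esub> x \<oplus>\<^bsub>?X\<^esub> a \<odot>\<^bsub>?X\<^esub> y) k"
        by (simp add: sm add)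
    qed
  next
    fix x assume x: "x \<in> carrier ?X"
    have "(\<Oplus>j\<in>{..k}. D j \<one>\<^bsub>R\<^esub> \<odot> x (k - j)) = x k" for k
    proof -
      have "(\<Oplus>j\<in>{..k}. D j \<one>\<^bsub>R\<^esub> \<odot> x (k - j)) = (\<Oplus>j\<in>{..k}. if 0 = j then x (k - j) else \<zero>)"
        by (intro M.finsum_cong') (use x in \<open>auto simp: Dc cc\<close>)
      also have "\<dots> = x k"
        using M.finsum_singleton[of 0 "{..k}" "\<lambda>j. x (k - j)"] x by (simp add: cc)
      finally show ?thesis .
    qed
    then show "\<one>\<^bsub>R\<^esub> \<odot>\<^bsub>?X\<^esub> x = x"
      using x by (auto simp: sm in_X)
  qed (fact smc)
qed


section \<open>Homomorphisms into injective modules\<close>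

lemma (in abelian_group) minus_eq_zero_iff:
  assumes "x \<in> carrier G" "y \<in> carrier G"
  shows "x \<ominus> y = \<zero> \<longleftrightarrow> x = y"
  using assms add.inv_solve_right'[of \<zero> x y] by (auto simp: minus_eq)

lemma module_homsI:
  assumes "\<And>x. x \<in> carrier M \<Longrightarrow> f x \<in> carrier N"
    and "\<And>x y. x \<in> carrier M \<Longrightarrow> y \<in> carrier M \<Longrightarrow> f (x \<oplus>\<^bsub>M\<^esub> y) = f x \<oplus>\<^bsub>N\<^esub> f y"
    and "\<And>a x. a \<in> carrier R \<Longrightarrow> x \<in> carrier M \<Longrightarrow> f (a \<odot>\<^bsub>M\<^esub> x) = a \<odot>\<^bsub>N\<^esub> f x"
  shows "f \<in> module_homs R M N"
  using assms by (auto simp: module_homs_def)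

lemma module_homs_comp:
  assumes "f \<in> module_homs R L M" "g \<in> module_homs R M N"
  shows "(\<lambda>x. g (f x)) \<in> module_homs R L N"
  using assms by (auto simp: module_homs_def Pi_iff)

lemma module_homs_zero:
  assumes "Module.module R M" "Module.module R N" "f \<in> module_homs R M N"
  shows "f \<zero>\<^bsub>M\<^esub> = \<zero>\<^bsub>N\<^esub>"
proof -
  interpret M: Module.module R M by fact
  interpret N: Module.module R N by fact
  show ?thesis
    using module_homsD(3)[OF assms(3), of "\<zero>\<^bsub>R\<^esub>" "\<zero>\<^bsub>M\<^esub>"] module_homsD(1)[OF assms(3)] by simp
qed

lemma module_homs_minus:
  assumes "Module.module R M" "Module.module R N" "f \<in> module_homs R M N"
    and "x \<in> carrier M" "y \<in> carrier M"
  shows "f (x \<ominus>\<^bsub>M\<^esub> y) = f x \<ominus>\<^bsub>N\<^esub> f y"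
proof -
  interpret M: Module.module R M by fact
  interpret N: Module.module R N by fact
  have "f (\<ominus>\<^bsub>M\<^esub> y) = \<ominus>\<^bsub>N\<^esub> f y"
    using module_homsD(3)[OF assms(3), of "\<ominus>\<^bsub>R\<^esub> \<one>\<^bsub>R\<^esub>" y] module_homsD(1)[OF assms(3,5)] assms(5)
    by (simp add: M.smult_l_minus N.smult_l_minus)
  then show ?thesis
    using module_homsD(2)[OF assms(3), of x "\<ominus>\<^bsub>M\<^esub> y"] assms(4,5)
    by (simp add: M.M.minus_eq N.M.minus_eq)
qed

lemma module_homs_difference:
  assumes M: "Module.module R M" and N: "Module.module R N"
    and f: "f \<in> module_homs R M N" and g: "g \<in> module_homs R M N"
  shows "(\<lambda>x. f x \<ominus>\<^bsub>N\<^esub> g x) \<in> module_homs R M N"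
proof -
  interpret M: Module.module R M by fact
  interpret N: Module.module R N by fact
  note fg = module_homsD[OF f] module_homsD[OF g]
  show ?thesis
    by (rule module_homsI)
      (auto simp: fg N.M.minus_eq N.M.minus_add N.M.a_ac N.smult_r_distr N.smult_r_minus)
qed

lemma module_homs_image_submodule:
  assumes M: "Module.module R M" and N: "Module.module R N"
    and f: "f \<in> module_homs R M N" and H: "Module.submodule H R M"
  shows "Module.submodule (f ` H) R N"
proof -
  interpret M: Module.module R M by fact
  interpret N: Module.module R N by fact
  note fD = module_homsD[OF f] and sH = M.submoduleE[OF H]
  have HM: "x \<in> carrier M" if "x \<in> H" for x using sH(1) that by blast
  have smc: "a \<odot>\<^bsub>N\<^esub> y \<in> f ` H" if ay: "a \<in> carrier R" "y \<in> f ` H" for a y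
  proof -
    from ay obtain x where "x \<in> H" "y = f x" by auto
    then show ?thesis using fD(3)[OF ay(1) HM] sH(4)[OF ay(1)] by (metis imageI)
  qed
  show ?thesis
  proof (rule N.submoduleI)
    show "\<zero>\<^bsub>N\<^esub> \<in> f ` H"
      using module_homs_zero[OF M N f] H by (metis imageI submodule_def subgroup.one_closed monoid.simps(2))
    show "y \<oplus>\<^bsub>N\<^esub> z \<in> f ` H" if yz: "y \<in> f ` H" "z \<in> f ` H" for y z
    proof -
      from yz obtain u v where "u \<in> H" "v \<in> H" "y = f u" "z = f v" by auto
      then show ?thesis using fD(2)[OF HM HM] sH(5) by (metis imageI)
    qed
    show "\<ominus>\<^bsub>N\<^esub> y \<in> f ` H" if "y \<in> f ` H" for y
      using smc[of "\<ominus>\<^bsub>R\<^esub> \<one>\<^bsub>R\<^esub>" y] that fD(1) HM by (auto simp: N.smult_l_minus)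
  qed (use fD(1) HM smc in auto)
qed

text \<open>
  This is how every map into an injective module is built below: if \<open>A \<rightarrow> B \<rightarrow> C\<close> is exact, a map
  on \<open>B\<close> that vanishes on the image of \<open>A\<close> factors through the image of \<open>B\<close> in \<open>C\<close>, and
  injectivity extends the factor from that image to all of \<open>C\<close>.
\<close>

lemma injective_module_factor:
  fixes R :: "('a, 'r) ring_scheme" and F :: "('a, 'f) module"
    and B :: "('a, 'b) module" and C :: "('a, 'c) module"
  assumes F: "injective_module R F" and B: "Module.module R B" and C: "Module.module R C"
    and v: "v \<in> module_homs R B C" and w: "w \<in> module_homs R B F"
    and ker: "\<And>x. x \<in> carrier B \<Longrightarrow> v x = \<zero>\<^bsub>C\<^esub> \<Longrightarrow> w x = \<zero>\<^bsub>F\<^esub>"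
  obtains w' where "w' \<in> module_homs R C F" "\<And>x. x \<in> carrier B \<Longrightarrow> w' (v x) = w x"
proof -
  have F': "Module.module R F"
    using F by (simp add: injective_module_def)
  interpret B: Module.module R B by fact
  interpret C: Module.module R C by fact
  interpret F: Module.module R F by fact
  note vD = module_homsD[OF v] and wD = module_homsD[OF w]
  define H where "H = v ` carrier B"
  define f where "f y = w (inv_into (carrier B) v y)" for y
  have f: "f (v x) = w x" if x: "x \<in> carrier B" for x
  proof -
    define x' where "x' = inv_into (carrier B) v (v x)"
    have x': "x' \<in> carrier B" "v x' = v x"
      using x unfolding x'_def by (auto intro: inv_into_into f_inv_into_f)
    then have "v (x' \<ominus>\<^bsub>B\<^esub> x) = \<zero>\<^bsub>C\<^esub>"
      using x vD(1)[OF x] by (simp add: module_homs_minus[OF B C v] C.M.minus_eq_zero_iff)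
    then have "w (x' \<ominus>\<^bsub>B\<^esub> x) = \<zero>\<^bsub>F\<^esub>"
      using x x' by (intro ker) auto
    then have "w x' = w x"
      using x x' wD(1) by (simp add: module_homs_minus[OF B F' w] F.M.minus_eq_zero_iff)
    then show ?thesis by (simp add: f_def x'_def)
  qed
  have "Module.submodule H R C"
    unfolding H_def by (rule module_homs_image_submodule[OF B C v B.carrier_is_submodule])
  moreover have "f \<in> module_homs R (C\<lparr>carrier := H\<rparr>) F"
    by (rule module_homsI) (auto simp: H_def f wD vD(2,3)[symmetric])
  ultimately obtain g where "g \<in> module_homs R C F" "\<forall>x\<in>H. g x = f x"
    using injective_module_extend[OF F C] by blast
  then show ?thesis
    using f by (intro that[of g]) (auto simp: H_def)
qed

text \<open>
  The retraction \<open>\<rho>\<close> of \<open>\<iota>\<close> and the map \<open>\<pi>\<close> together identify \<open>B\<close> with the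
  product of \<open>A\<close> and \<open>C\<close>, so that a map into \<open>B\<close> is extended in each factor separately.
\<close>

lemma injective_module_extension:
  fixes R :: "('a, 'r) ring_scheme" and A :: "('a, 'b) module"
    and B :: "('a, 'c) module" and C :: "('a, 'd) module"
  assumes A: "injective_module R A" and B: "Module.module R B" and C: "injective_module R C"
    and \<iota>: "\<iota> \<in> module_homs R A B" and \<pi>: "\<pi> \<in> module_homs R B C"
    and inj: "\<And>x. x \<in> carrier A \<Longrightarrow> \<iota> x = \<zero>\<^bsub>B\<^esub> \<Longrightarrow> x = \<zero>\<^bsub>A\<^esub>"
    and exact: "\<And>x. x \<in> carrier B \<Longrightarrow> \<pi> x = \<zero>\<^bsub>C\<^esub> \<longleftrightarrow> x \<in> \<iota> ` carrier A"
    and surj: "carrier C \<subseteq> \<pi> ` carrier B"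
  shows "injective_module R B"
proof -
  have A': "Module.module R A" and C': "Module.module R C"
    using A C by (auto simp: injective_module_def)
  interpret A: Module.module R A by fact
  interpret B: Module.module R B by fact
  interpret C: Module.module R C by fact
  note \<iota>D = module_homsD[OF \<iota>] and \<pi>D = module_homsD[OF \<pi>]
  have "(\<lambda>x. x) \<in> module_homs R A A" by (rule module_homsI) auto
  from injective_module_factor[OF A A' B \<iota> this inj] obtain \<rho>
    where \<rho>: "\<rho> \<in> module_homs R B A" and \<rho>\<iota>: "\<And>x. x \<in> carrier A \<Longrightarrow> \<rho> (\<iota> x) = x"
    by blast
  note \<rho>D = module_homsD[OF \<rho>]
  have uniq: "b = b'" if b: "b \<in> carrier B" "b' \<in> carrier B" "\<pi> b = \<pi> b'" "\<rho> b = \<rho> b'" for b b'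
  proof -
    have "\<pi> (b \<ominus>\<^bsub>B\<^esub> b') = \<zero>\<^bsub>C\<^esub>"
      using b by (simp add: module_homs_minus[OF B C' \<pi>] \<pi>D C.M.minus_eq_zero_iff)
    then obtain a where a: "a \<in> carrier A" "b \<ominus>\<^bsub>B\<^esub> b' = \<iota> a"
      using exact[of "b \<ominus>\<^bsub>B\<^esub> b'"] b by auto
    have "a = \<rho> (b \<ominus>\<^bsub>B\<^esub> b')" using a \<rho>\<iota> by simp
    also have "\<dots> = \<zero>\<^bsub>A\<^esub>" using b by (simp add: module_homs_minus[OF B A' \<rho>] \<rho>D A.M.minus_eq_zero_iff)
    finally show ?thesis
      using a(2) b module_homs_zero[OF A' B \<iota>] by (simp add: B.M.minus_eq_zero_iff)
  qed
  have ex: "\<exists>b\<in>carrier B. \<pi> b = c \<and> \<rho> b = a" if ac: "a \<in> carrier A" "c \<in> carrier C" for a c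
  proof -
    from surj ac obtain b0 where b0: "b0 \<in> carrier B" "\<pi> b0 = c" by blast
    define t where "t = a \<ominus>\<^bsub>A\<^esub> \<rho> b0"
    have t: "t \<in> carrier A" using ac b0 \<rho>D by (simp add: t_def)
    then have "\<pi> (\<iota> t) = \<zero>\<^bsub>C\<^esub>" using exact \<iota>D by blast
    moreover have "\<rho> b0 \<oplus>\<^bsub>A\<^esub> t = a"
      using \<rho>D(1)[OF b0(1)] ac by (simp add: t_def A.M.minus_eq A.M.a_lcomm[of "\<rho> b0" a] A.M.r_neg)
    ultimately show ?thesis
      using b0 ac t \<iota>D(1)[OF t]
      by (intro bexI[of _ "b0 \<oplus>\<^bsub>B\<^esub> \<iota> t"]) (auto simp: \<pi>D \<rho>D \<rho>\<iota>)
  qed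
  show ?thesis
    unfolding injective_module_def
  proof (intro conjI allI ballI impI)
    fix N :: "('a, 'a) module" and H f
    assume f: "f \<in> module_homs R (N\<lparr>carrier := H\<rparr>) B"
      and NH: "Module.module R N \<and> Module.submodule H R N"
    interpret N: Module.module R N using NH by blast
    have HN: "H \<subseteq> carrier N" using N.submoduleE(1) NH by blast
    obtain r where r: "r \<in> module_homs R N A" "\<forall>x\<in>H. r x = \<rho> (f x)"
      using injective_module_extend[OF A _ _ module_homs_comp[OF f \<rho>]] NH by auto
    obtain c where c: "c \<in> module_homs R N C" "\<forall>x\<in>H. c x = \<pi> (f x)"
      using injective_module_extend[OF C _ _ module_homs_comp[OF f \<pi>]] NH by auto
    note rD = module_homsD[OF r(1)] and cD = module_homsD[OF c(1)]
    define h where "h y = (SOME b. b \<in> carrier B \<and> \<pi> b = c y \<and> \<rho> b = r y)" for y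
    have h: "h y \<in> carrier B" "\<pi> (h y) = c y" "\<rho> (h y) = r y" if "y \<in> carrier N" for y
      using someI_ex[of "\<lambda>b. b \<in> carrier B \<and> \<pi> b = c y \<and> \<rho> b = r y"] ex[of "r y" "c y"] that
      by (auto simp: rD cD h_def)
    have "h \<in> module_homs R N B"
    proof (rule module_homsI)
      show "h (x \<oplus>\<^bsub>N\<^esub> y) = h x \<oplus>\<^bsub>B\<^esub> h y" if "x \<in> carrier N" "y \<in> carrier N" for x y
        by (rule uniq) (use that in \<open>auto simp: h \<pi>D \<rho>D rD cD\<close>)
      show "h (a \<odot>\<^bsub>N\<^esub> x) = a \<odot>\<^bsub>B\<^esub> h x" if "a \<in> carrier R" "x \<in> carrier N" for a x
        by (rule uniq) (use that in \<open>auto simp: h \<pi>D \<rho>D rD cD\<close>)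
    qed (rule h)
    moreover have "\<forall>x\<in>H. h x = f x"
      using HN r(2) c(2) module_homsD(1)[OF f] by (auto intro!: uniq simp: h)
    ultimately show "\<exists>g\<in>module_homs R N B. \<forall>x\<in>H. g x = f x" by blast
  qed (rule B)
qed

text \<open>
  The powers of \<open>\<xi>\<close> filter the twisted module, and as \<open>D 0\<close> is the identity each graded piece is
  \<open>E\<close> with its given action. So it is an iterated extension of injective modules.
\<close>

lemma injective_twisted_module:
  fixes R :: "('a, 'r) ring_scheme" and E :: "('a, 'e) module" (structure)
  assumes D: "higher_derivation R D" and E: "injective_module R E"
  shows "injective_module R (twisted_module D n E)"
proof (induction n)
  case 0
  have E': "Module.module R E" using E by (simp add: injective_module_def)
  let ?X = "twisted_module D 0 E"
  have X: "Module.module R ?X" by (rule twisted_module_module[OF D E'])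
  have "(\<lambda>_. \<zero>\<^bsub>?X\<^esub>) \<in> module_homs R N ?X" for N :: "('a, 'a) module"
    by (rule module_homsI) (use E' in \<open>auto simp: twisted_module_def module_def abelian_group_def abelian_monoid.l_zero abelian_monoid.zero_closed\<close>)
  moreover have "\<forall>x\<in>H. \<zero>\<^bsub>?X\<^esub> = f x" 
    if "f \<in> module_homs R (N\<lparr>carrier := H\<rparr>) ?X" for f H and N :: "('a, 'a) module"
    using module_homsD(1)[OF that] by (fastforce simp: twisted_module_def)
  ultimately show ?case
    unfolding injective_module_def using X by (meson bexI)
next
  case (Suc n)
  have E': "Module.module R E" using E by (simp add: injective_module_def)
  interpret Module.module R E by fact
  note Dc = higher_derivationD[OF D]
  let ?B = "twisted_module D (Suc n) E" and ?C = "twisted_module D n E"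
  let ?\<iota> = "\<lambda>e k. if k = n then e else \<zero>"
  let ?\<pi> = "\<lambda>x k. if k < n then x k else \<zero>"
  show ?case
  proof (rule injective_module_extension[OF E twisted_module_module[OF D E'] Suc.IH])
    show "?\<iota> \<in> module_homs R E ?B"
    proof (rule module_homsI)
      fix a x assume ax: "a \<in> carrier R" "x \<in> carrier E"
      have "(\<Oplus>j\<in>{..k}. D j a \<odot> ?\<iota> x (k - j)) = ?\<iota> (a \<odot> x) k" if "k \<le> n" for k
      proof -
        have "(\<Oplus>j\<in>{..k}. D j a \<odot> ?\<iota> x (k - j))
            = (\<Oplus>j\<in>{..k}. if 0 = j then ?\<iota> (a \<odot> x) k else \<zero>)"
          by (intro M.finsum_cong') (use ax that in \<open>auto simp: Dc\<close>)
        also have "\<dots> = ?\<iota> (a \<odot> x) k"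
          using M.finsum_singleton[of 0 "{..k}" "\<lambda>_. ?\<iota> (a \<odot> x) k"] ax by simp
        finally show ?thesis .
      qed
      then show "?\<iota> (a \<odot> x) = a \<odot>\<^bsub>?B\<^esub> ?\<iota> x"
        by (auto simp: twisted_module_def fun_eq_iff)
    qed (auto simp: twisted_module_def)
    show "?\<pi> \<in> module_homs R ?B ?C"
    proof (rule module_homsI)
      fix a x assume ax: "a \<in> carrier R" "x \<in> carrier ?B"
      then show "?\<pi> (a \<odot>\<^bsub>?B\<^esub> x) = a \<odot>\<^bsub>?C\<^esub> ?\<pi> x"
        by (auto simp: twisted_module_def fun_eq_iff Dc intro!: M.finsum_cong')
    qed (auto simp: twisted_module_def)
    fix x assume x: "x \<in> carrier ?B"
    show "?\<pi> x = \<zero>\<^bsub>?C\<^esub> \<longleftrightarrow> x \<in> ?\<iota> ` carrier E"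
    proof
      assume "?\<pi> x = \<zero>\<^bsub>?C\<^esub>"
      then have "x k = \<zero>" if "k < n" for k
        using that by (auto simp: twisted_module_def fun_eq_iff split: if_splits)
      then have "x = ?\<iota> (x n)"
        using x by (auto simp: twisted_module_def fun_eq_iff Suc_le_eq) (metis linorder_neqE_nat)
      then show "x \<in> ?\<iota> ` carrier E" using x by (auto simp: twisted_module_def)
    qed (auto simp: twisted_module_def)
  next
    show "carrier ?C \<subseteq> ?\<pi> ` carrier ?B"
    proof
      fix x assume "x \<in> carrier ?C"
      then show "x \<in> ?\<pi> ` carrier ?B"
        by (intro image_eqI[of _ _ x]) (auto simp: twisted_module_def less_Suc_eq)
    qed
  qed (auto simp: twisted_module_def fun_eq_iff split: if_splits)
qed

section \<open>Comparison of complexes of injective modules\<close>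

lemma injective_resolutionD:
  assumes "injective_resolution R M E \<epsilon> \<delta>"
  shows "Module.module R M" "injective_module R (E n)" "Module.module R (E n)"
    and "\<epsilon> \<in> module_homs R M (E 0)" "\<delta> n \<in> module_homs R (E n) (E (Suc n))"
    and "inj_on \<epsilon> (carrier M)"
    and "x \<in> carrier (E 0) \<Longrightarrow> \<delta> 0 x = \<zero>\<^bsub>E (Suc 0)\<^esub> \<longleftrightarrow> x \<in> \<epsilon> ` carrier M"
    and "x \<in> carrier (E (Suc n)) \<Longrightarrow> \<delta> (Suc n) x = \<zero>\<^bsub>E (Suc (Suc n))\<^esub> \<longleftrightarrow> x \<in> \<delta> n ` carrier (E n)"
  using assms unfolding injective_resolution_def injective_module_def
  by auto

text \<open>
  In each degree the next map is prescribed on the image of \<open>\<delta> n\<close>. It is well defined there because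
  the resolution is exact and the previous map sends cocycles to cocycles.
\<close>

lemma comparison_map:
  fixes R :: "('a, 'r) ring_scheme" and F :: "nat \<Rightarrow> ('a, 'f) module"
  assumes res: "injective_resolution R M E \<epsilon> \<delta>"
    and F: "\<And>n. injective_module R (F n)"
    and d: "\<And>n. d n \<in> module_homs R (F n) (F (Suc n))"
    and dd: "\<And>n x. x \<in> carrier (F n) \<Longrightarrow> d (Suc n) (d n x) = \<zero>\<^bsub>F (Suc (Suc n))\<^esub>"
    and f: "f \<in> module_homs R M (F 0)"
    and df: "\<And>x. x \<in> carrier M \<Longrightarrow> d 0 (f x) = \<zero>\<^bsub>F (Suc 0)\<^esub>"
  obtains \<phi> where "\<And>n. \<phi> n \<in> module_homs R (E n) (F n)"
    and "\<And>x. x \<in> carrier M \<Longrightarrow> \<phi> 0 (\<epsilon> x) = f x"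
    and "\<And>n x. x \<in> carrier (E n) \<Longrightarrow> \<phi> (Suc n) (\<delta> n x) = d n (\<phi> n x)"
proof -
  note r = injective_resolutionD[OF res]
  have F': "Module.module R (F n)" for n using F by (simp add: injective_module_def)
  have \<epsilon>0: "f x = \<zero>\<^bsub>F 0\<^esub>" if "x \<in> carrier M" "\<epsilon> x = \<zero>\<^bsub>E 0\<^esub>" for x
  proof -
    interpret M: Module.module R M by (rule r(1))
    have "x = \<zero>\<^bsub>M\<^esub>"
      using inj_onD[OF r(6), of x "\<zero>\<^bsub>M\<^esub>"] that module_homs_zero[OF r(1) r(3) r(4)] by simp
    then show ?thesis using module_homs_zero[OF r(1) F' f] by simp
  qed
  define P where "P n \<phi> \<longleftrightarrow> \<phi> \<in> module_homs R (E n) (F n) \<and>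
      (\<forall>x\<in>carrier (E n). \<delta> n x = \<zero>\<^bsub>E (Suc n)\<^esub> \<longrightarrow> d n (\<phi> x) = \<zero>\<^bsub>F (Suc n)\<^esub>) \<and>
      (n = 0 \<longrightarrow> (\<forall>x\<in>carrier M. \<phi> (\<epsilon> x) = f x))" for n \<phi>
  have "\<exists>\<phi>. \<forall>n. P n (\<phi> n) \<and> (\<forall>x\<in>carrier (E n). \<phi> (Suc n) (\<delta> n x) = d n (\<phi> n x))"
  proof (rule dependent_nat_choice)
    obtain \<phi> where "\<phi> \<in> module_homs R (E 0) (F 0)" "\<And>x. x \<in> carrier M \<Longrightarrow> \<phi> (\<epsilon> x) = f x"
      using injective_module_factor[OF F r(1) r(3) r(4) f \<epsilon>0] by blast
    then show "\<exists>\<phi>. P 0 \<phi>" using r(7) df by (auto simp: P_def)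
  next
    fix \<phi> n assume P: "P n \<phi>"
    then have \<phi>: "\<phi> \<in> module_homs R (E n) (F n)" by (simp add: P_def)
    obtain \<phi>' where \<phi>': "\<phi>' \<in> module_homs R (E (Suc n)) (F (Suc n))"
      "\<And>x. x \<in> carrier (E n) \<Longrightarrow> \<phi>' (\<delta> n x) = d n (\<phi> x)"
      using injective_module_factor[OF F r(3) r(3) r(5) module_homs_comp[OF \<phi> d]] P
      by (auto simp: P_def)
    then have "P (Suc n) \<phi>'"
      using r(8) dd module_homsD(1)[OF \<phi>] by (auto simp: P_def)
    with \<phi>' show "\<exists>\<phi>'. P (Suc n) \<phi>' \<and> (\<forall>x\<in>carrier (E n). \<phi>' (\<delta> n x) = d n (\<phi> x))"
      by blast
  qed
  then obtain \<phi> where *: "\<And>n. P n (\<phi> n)"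
    "\<And>n x. x \<in> carrier (E n) \<Longrightarrow> \<phi> (Suc n) (\<delta> n x) = d n (\<phi> n x)" by blast
  show ?thesis
    by (rule that[of \<phi>]) (use * in \<open>auto simp: P_def\<close>)
qed

text \<open>
  The difference \<open>\<theta> (Suc n) - d n \<circ> h n\<close> vanishes on the image of \<open>\<delta> n\<close>, and so factors through
  \<open>\<delta> (Suc n)\<close>.
\<close>

lemma null_homotopy:
  fixes R :: "('a, 'r) ring_scheme" and F :: "nat \<Rightarrow> ('a, 'f) module"
  assumes res: "injective_resolution R M E \<epsilon> \<delta>"
    and F: "\<And>n. injective_module R (F n)"
    and d: "\<And>n. d n \<in> module_homs R (F n) (F (Suc n))"
    and dd: "\<And>n x. x \<in> carrier (F n) \<Longrightarrow> d (Suc n) (d n x) = \<zero>\<^bsub>F (Suc (Suc n))\<^esub>"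
    and \<theta>: "\<And>n. \<theta> n \<in> module_homs R (E n) (F n)"
    and \<theta>\<epsilon>: "\<And>x. x \<in> carrier M \<Longrightarrow> \<theta> 0 (\<epsilon> x) = \<zero>\<^bsub>F 0\<^esub>"
    and \<theta>\<delta>: "\<And>n x. x \<in> carrier (E n) \<Longrightarrow> \<theta> (Suc n) (\<delta> n x) = d n (\<theta> n x)"
  obtains h where "\<And>n. h n \<in> module_homs R (E (Suc n)) (F n)"
    and "\<And>x. x \<in> carrier (E 0) \<Longrightarrow> \<theta> 0 x = h 0 (\<delta> 0 x)"
    and "\<And>n x. x \<in> carrier (E (Suc n)) \<Longrightarrow>
      \<theta> (Suc n) x \<ominus>\<^bsub>F (Suc n)\<^esub> d n (h n x) = h (Suc n) (\<delta> (Suc n) x)"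
proof -
  note r = injective_resolutionD[OF res]
  have F': "Module.module R (F n)" for n using F by (simp add: injective_module_def)
  define P where "P n h \<longleftrightarrow> h \<in> module_homs R (E (Suc n)) (F n) \<and>
      (\<forall>x\<in>carrier (E n). d n (h (\<delta> n x)) = \<theta> (Suc n) (\<delta> n x)) \<and>
      (n = 0 \<longrightarrow> (\<forall>x\<in>carrier (E 0). \<theta> 0 x = h (\<delta> 0 x)))" for n h
  have "\<exists>h. \<forall>n. P n (h n) \<and> (\<forall>x\<in>carrier (E (Suc n)).
      \<theta> (Suc n) x \<ominus>\<^bsub>F (Suc n)\<^esub> d n (h n x) = h (Suc n) (\<delta> (Suc n) x))"
  proof (rule dependent_nat_choice)
    have "\<theta> 0 x = \<zero>\<^bsub>F 0\<^esub>" if "x \<in> carrier (E 0)" "\<delta> 0 x = \<zero>\<^bsub>E (Suc 0)\<^esub>" for x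
      using that r(7) \<theta>\<epsilon> by auto
    then obtain h where "h \<in> module_homs R (E (Suc 0)) (F 0)"
      "\<And>x. x \<in> carrier (E 0) \<Longrightarrow> h (\<delta> 0 x) = \<theta> 0 x"
      using injective_module_factor[OF F r(3) r(3) r(5) \<theta>] by blast
    then show "\<exists>h. P 0 h" using \<theta>\<delta> by (auto simp: P_def)
  next
    fix h n assume P: "P n h"
    then have h: "h \<in> module_homs R (E (Suc n)) (F n)" by (simp add: P_def)
    interpret FS: Module.module R "F (Suc n)" by (rule F')
    let ?w = "\<lambda>x. \<theta> (Suc n) x \<ominus>\<^bsub>F (Suc n)\<^esub> d n (h x)"
    have w: "?w \<in> module_homs R (E (Suc n)) (F (Suc n))"
      by (rule module_homs_difference[OF r(3) F' \<theta> module_homs_comp[OF h d]])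
    have "?w x = \<zero>\<^bsub>F (Suc n)\<^esub>"
      if x: "x \<in> carrier (E (Suc n))" "\<delta> (Suc n) x = \<zero>\<^bsub>E (Suc (Suc n))\<^esub>" for x
    proof -
      from that r(8) obtain y where y: "y \<in> carrier (E n)" "x = \<delta> n y" by blast
      then have "d n (h x) = \<theta> (Suc n) x" using P by (simp add: P_def)
      then show ?thesis using module_homsD(1)[OF \<theta> x(1)] by (simp add: FS.M.minus_eq_zero_iff)
    qed
    then obtain h' where h': "h' \<in> module_homs R (E (Suc (Suc n))) (F (Suc n))"
      "\<And>x. x \<in> carrier (E (Suc n)) \<Longrightarrow> h' (\<delta> (Suc n) x) = ?w x"
      using injective_module_factor[OF F r(3) r(3) r(5) w] by blast
    have "d (Suc n) (?w x) = \<theta> (Suc (Suc n)) (\<delta> (Suc n) x)" if x: "x \<in> carrier (E (Suc n))" for x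
    proof -
      interpret FSS: Module.module R "F (Suc (Suc n))" by (rule F')
      have "d (Suc n) (?w x) = d (Suc n) (\<theta> (Suc n) x) \<ominus>\<^bsub>F (Suc (Suc n))\<^esub> d (Suc n) (d n (h x))"
        by (rule module_homs_minus[OF F' F' d])
          (use module_homsD(1)[OF \<theta>] module_homsD(1)[OF module_homs_comp[OF h d]] x in auto)
      then show ?thesis
        using x \<theta>\<delta> module_homsD(1)[OF h] module_homsD(1)[OF d] module_homsD(1)[OF \<theta>]
        by (simp add: dd FSS.M.minus_eq)
    qed
    then have "P (Suc n) h'" using h' by (auto simp: P_def)
    with h'(2) show "\<exists>h'. P (Suc n) h' \<and> (\<forall>x\<in>carrier (E (Suc n)). ?w x = h' (\<delta> (Suc n) x))"
      by (intro exI[of _ h']) auto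
  qed
  then obtain h where *: "\<And>n. P n (h n)" "\<And>n x. x \<in> carrier (E (Suc n)) \<Longrightarrow>
      \<theta> (Suc n) x \<ominus>\<^bsub>F (Suc n)\<^esub> d n (h n x) = h (Suc n) (\<delta> (Suc n) x)" by blast
  show ?thesis
    by (rule that[of h]) (use * in \<open>auto simp: P_def\<close>)
qed

section \<open>The torsion functor\<close>

text \<open>
  The elements that are killed by \<open>I\<^sup>n\<close>. The recursion makes inductions over \<open>n\<close> deal with single
  elements of \<open>I\<close> instead of the sums of products that make up the powers of \<open>I\<close>.
\<close>

primrec torsion_layer :: "('a, 'r) ring_scheme \<Rightarrow> 'a set \<Rightarrow> ('a, 'b) module \<Rightarrow> nat \<Rightarrow> 'b set" where
  "torsion_layer R I M 0 = {\<zero>\<^bsub>M\<^esub>}"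
| "torsion_layer R I M (Suc n) = {x \<in> carrier M. \<forall>a\<in>I. a \<odot>\<^bsub>M\<^esub> x \<in> torsion_layer R I M n}"

lemma torsion_layer_conv:
  fixes M (structure)
  assumes M: "Module.module R M" and I: "ideal I R"
  shows "ideal (I [^]\<^bsub>ideals_set R\<^esub> n) R \<and>
    torsion_layer R I M n = {x \<in> carrier M. \<forall>a \<in> I [^]\<^bsub>ideals_set R\<^esub> (n::nat). a \<odot> x = \<zero>}"
proof (induction n)
  interpret Module.module R M by fact
  interpret I: ideal I R by fact
  case 0
  have "x = \<zero>" if "x \<in> carrier M" "\<forall>a\<in>carrier R. a \<odot> x = \<zero>" for x
    using that smult_one R.one_closed by metis
  then show ?case
    by (auto simp: ideals_set_def nat_pow_def intro: R.oneideal)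
next
  interpret Module.module R M by fact
  interpret I: ideal I R by fact
  case (Suc n)
  let ?K = "I [^]\<^bsub>ideals_set R\<^esub> n"
  have K: "ideal ?K R" using Suc by blast
  have pow: "I [^]\<^bsub>ideals_set R\<^esub> (Suc n) = ideal_prod R ?K I"
    by (simp add: ideals_set_def nat_pow_def)
  have "(\<forall>b \<in> ideal_prod R ?K I. b \<odot> x = \<zero>) \<longleftrightarrow> (\<forall>a\<in>I. \<forall>c\<in>?K. c \<odot> (a \<odot> x) = \<zero>)"
    (is "?L \<longleftrightarrow> ?R") if x: "x \<in> carrier M" for x
  proof
    assume ?L
    then show ?R
      using ideal.Icarr[OF K] I.Icarr x by (auto simp: smult_assoc1[symmetric] intro: ideal_prod.prod)
  next
    assume R: ?R
    show ?L
    proof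
      fix b assume "b \<in> ideal_prod R ?K I"
      then have "b \<in> carrier R \<and> b \<odot> x = \<zero>"
        by induction (use R ideal.Icarr[OF K] I.Icarr x in \<open>auto simp: smult_assoc1 smult_l_distr\<close>)
      then show "b \<odot> x = \<zero>" by blast
    qed
  qed
  then show ?case
    using Suc R.ideal_prod_is_ideal[OF K I] I.Icarr unfolding pow by auto
qed

lemma torsion_part_eq:
  assumes "Module.module R M" and "ideal I R"
  shows "torsion_part R I M = (\<Union>n. torsion_layer R I M n)"
  using torsion_layer_conv[OF assms] by (auto simp: torsion_part_def)

lemma torsion_layer_submodule:
  fixes M (structure)
  assumes M: "Module.module R M" and I: "ideal I R"
  shows "Module.submodule (torsion_layer R I M n) R M"
proof (induction n)
  interpret Module.module R M by fact
  case 0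
  show ?case by (rule submoduleI) auto
next
  interpret Module.module R M by fact
  interpret I: ideal I R by fact
  case (Suc n)
  note s = submoduleE[OF Suc]
  have "a \<odot> (b \<odot> x) \<in> torsion_layer R I M n"
    if "\<forall>a\<in>I. a \<odot> x \<in> torsion_layer R I M n" "a \<in> I" "b \<in> carrier R" "x \<in> carrier M" for a b x
    using that I.I_r_closed[of a b] I.Icarr by (simp add: smult_assoc1[symmetric])
  moreover have "\<zero> \<in> torsion_layer R I M n"
    using Suc by (simp add: submodule_def subgroup_def)
  ultimately show ?case
    by (intro submoduleI) (auto simp: smult_r_minus smult_r_distr I.Icarr s)
qed

lemma torsion_layer_Suc:
  assumes M: "Module.module R M" and I: "ideal I R"
  shows "torsion_layer R I M n \<subseteq> torsion_layer R I M (Suc n)"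
  using module.submoduleE(1,4)[OF M torsion_layer_submodule[OF M I]] ideal.Icarr[OF I]
  by auto

lemma torsion_layer_mono:
  assumes "Module.module R M" and "ideal I R" and "m \<le> n"
  shows "torsion_layer R I M m \<subseteq> torsion_layer R I M n"
  using lift_Suc_mono_le[of "torsion_layer R I M"] torsion_layer_Suc[OF assms(1,2)] assms(3)
  by blast

lemma torsion_part_submodule:
  fixes M (structure)
  assumes M: "Module.module R M" and I: "ideal I R"
  shows "Module.submodule (torsion_part R I M) R M"
proof -
  interpret Module.module R M by fact
  note s = submoduleE[OF torsion_layer_submodule[OF M I]]
  show ?thesis
    unfolding torsion_part_eq[OF M I]
  proof (rule submoduleI)
    fix a b assume "a \<in> (\<Union>n. torsion_layer R I M n)" "b \<in> (\<Union>n. torsion_layer R I M n)"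
    then obtain m n where "a \<in> torsion_layer R I M m" "b \<in> torsion_layer R I M n" by blast
    then have "a \<in> torsion_layer R I M (max m n)" "b \<in> torsion_layer R I M (max m n)"
      using torsion_layer_mono[OF M I] by (meson max.cobounded1 max.cobounded2 subsetD)+
    then show "a \<oplus> b \<in> (\<Union>n. torsion_layer R I M n)" using s(5) by blast
  next
    show "\<zero> \<in> (\<Union>n. torsion_layer R I M n)"
      by (rule UN_I[of 0]) auto
    show "(\<Union>n. torsion_layer R I M n) \<subseteq> carrier M" using s(1) by (rule UN_least)
    show "\<ominus> a \<in> (\<Union>n. torsion_layer R I M n)" if "a \<in> (\<Union>n. torsion_layer R I M n)" for a
      using that s(3) by blast
    show "a \<odot> x \<in> (\<Union>n. torsion_layer R I M n)"
      if "a \<in> carrier R" "x \<in> (\<Union>n. torsion_layer R I M n)" for a x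
      using that s(4) by blast
  qed
qed

lemma torsion_part_hom:
  assumes M: "Module.module R M" and N: "Module.module R N" and I: "ideal I R"
    and f: "f \<in> module_homs R M N" and x: "x \<in> torsion_part R I M"
  shows "f x \<in> torsion_part R I N"
proof -
  interpret I: ideal I R by fact
  have "f x \<in> torsion_layer R I N n" if "x \<in> torsion_layer R I M n" for n x
    using that
  proof (induction n arbitrary: x)
    case (Suc n)
    then show ?case using module_homsD[OF f] I.Icarr by (auto simp: module_homsD(3)[OF f, symmetric])
  qed (use module_homs_zero[OF M N f] in auto)
  then show ?thesis using x unfolding torsion_part_eq[OF M I] torsion_part_eq[OF N I] by blast
qed

text \<open>
  This isolates one term of a Leibniz sum when all other terms are known to lie in \<open>L\<close>.
\<close>

lemma submodule_finsum_term:
  fixes M (structure)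
  assumes M: "Module.module R M" and L: "Module.submodule L R M"
    and A: "finite A" "i \<in> A" and t: "t \<in> A \<rightarrow> carrier M"
    and sum: "(\<Oplus>j\<in>A. t j) \<in> L" and others: "\<And>j. j \<in> A - {i} \<Longrightarrow> t j \<in> L"
  shows "t i \<in> L"
proof -
  interpret Module.module R M by fact
  note s = submoduleE[OF L]
  have L0: "\<zero> \<in> L" using L by (simp add: submodule_def subgroup_def)
  have *: "(\<Oplus>j\<in>B. t j) \<in> L" if "finite B" "t \<in> B \<rightarrow> L" for B
    using that
  proof (induction rule: finite_induct)
    case (insert x F)
    moreover have "t \<in> F \<rightarrow> carrier M" using insert s(1) by auto
    ultimately show ?case using s by (auto simp: Pi_iff subset_iff)
  qed (use L0 in auto)
  let ?r = "\<Oplus>j\<in>A - {i}. t j"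
  have r: "?r \<in> L" using A others by (intro *) auto
  have "(\<Oplus>j\<in>A. t j) = (\<Oplus>j\<in>insert i (A - {i}). t j)"
    using A by (simp add: insert_absorb)
  also have "\<dots> = t i \<oplus> ?r"
    using A t by (subst M.finsum_insert) auto
  finally have "t i = (\<Oplus>j\<in>A. t j) \<oplus> \<ominus> ?r"
    using r s(1) t A by (simp add: subset_iff M.a_assoc M.r_neg Pi_iff)
  then show ?thesis using sum r s by simp
qed

lemma annihilator_quotient_module:
  fixes M (structure)
  assumes M: "Module.module R M" and N: "Module.submodule N R M"
  shows "annihilator R (quotient_module M N) = {a \<in> carrier R. \<forall>x\<in>carrier M. a \<odot> x \<in> N}"
proof -
  interpret Module.module R M by fact
  note s = submoduleE[OF N]
  have N0: "\<zero> \<in> N" using N by (simp add: submodule_def subgroup_def)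
  have N': "N +> x = N" if "x \<in> N" for x
    using that N s(1) by (intro M.a_coset_join2) (auto simp: submodule_def)
  have self: "x \<in> N +> x" if "x \<in> carrier M" for x
    using that N0 by (auto simp: a_r_coset_def r_coset_def intro!: bexI[of _ "\<zero>"])
  have car: "carrier (quotient_module M N) = (\<lambda>x. N +> x) ` carrier M"
    by (auto simp: quotient_module_def A_RCOSETS_def RCOSETS_def a_r_coset_def)
  have eq: "(\<Union>y \<in> N +> x. N +> (a \<odot> y)) = N \<longleftrightarrow> a \<odot> x \<in> N"
    if ax: "a \<in> carrier R" "x \<in> carrier M" for a x
  proof
    assume "(\<Union>y \<in> N +> x. N +> (a \<odot> y)) = N"
    then show "a \<odot> x \<in> N" using self[OF ax(2)] self[OF smult_closed[OF ax]] by blast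
  next
    assume *: "a \<odot> x \<in> N"
    have "a \<odot> y \<in> N" if "y \<in> N +> x" for y
      using that * ax s(1) by (auto simp: a_r_coset_def r_coset_def smult_r_distr s subset_iff)
    then show "(\<Union>y \<in> N +> x. N +> (a \<odot> y)) = N"
      using N' self[OF ax(2)] by blast
  qed
  have ann: "annihilator R (quotient_module M N) =
      {a \<in> carrier R. \<forall>x\<in>carrier M. (\<Union>y \<in> N +> x. N +> (a \<odot> y)) = N}"
    unfolding annihilator_def car by (simp add: quotient_module_def)
  show ?thesis
    unfolding ann by (intro Collect_cong conj_cong ball_cong refl eq)
qed

section \<open>Higher derivations act on local cohomology\<close>

lemma finsum_ring_module:
  assumes "cring R" "finite A" "f \<in> A \<rightarrow> carrier R"
  shows "finsum (ring_module R) f A = finsum R f A"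
proof -
  interpret cring R by fact
  interpret M: Module.module R "ring_module R" by (rule ring_module_module) fact
  have c: "carrier (ring_module R) = carrier R" "\<zero>\<^bsub>ring_module R\<^esub> = \<zero>\<^bsub>R\<^esub>"
    "x \<oplus>\<^bsub>ring_module R\<^esub> y = x \<oplus>\<^bsub>R\<^esub> y" for x y
    by (auto simp: ring_module_def)
  show ?thesis
    using assms(2,3)
  proof (induction rule: finite_induct)
    case (insert x F)
    then show ?case by (simp add: c Pi_iff)
  qed (simp add: c)
qed

lemma module_homs_finsum:
  assumes M: "Module.module R M" and N: "Module.module R N" and f: "f \<in> module_homs R M N"
    and "finite A" and g: "g \<in> A \<rightarrow> carrier M"
  shows "f (\<Oplus>\<^bsub>M\<^esub>i\<in>A. g i) = (\<Oplus>\<^bsub>N\<^esub>i\<in>A. f (g i))"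
proof -
  interpret M: Module.module R M by fact
  interpret N: Module.module R N by fact
  show ?thesis
    using assms(4) g
  proof (induction rule: finite_induct)
    case (insert x F)
    then show ?case using module_homsD[OF f] by (simp add: Pi_iff)
  qed (use module_homs_zero[OF M N f] in simp)
qed

text \<open>
  The map \<open>a \<mapsto> (D k a)\<^sub>k\<close> is linear from \<open>R\<close> to the twisted module, again by the Leibniz rule, and
  the comparison of resolutions extends it. The component \<open>\<lambda>x. \<phi> m x k\<close> is a lift of \<open>D k\<close> to \<open>E m\<close>.
\<close>

lemma higher_derivation_chain_map:
  fixes R :: "('a, 'r) ring_scheme" and E :: "nat \<Rightarrow> ('a, 'e) module"
  assumes D: "higher_derivation R D" and R: "cring R"
    and res: "injective_resolution R (ring_module R) E \<epsilon> \<delta>"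
  obtains \<phi> where
    "\<And>m. \<phi> m \<in> module_homs R (E m) (twisted_module D (Suc n) (E m))"
    "\<And>a k. a \<in> carrier R \<Longrightarrow> k \<le> n \<Longrightarrow> \<phi> 0 (\<epsilon> a) k = \<epsilon> (D k a)"
    "\<And>m x k. x \<in> carrier (E m) \<Longrightarrow> \<phi> (Suc m) (\<delta> m x) k = \<delta> m (\<phi> m x k)"
proof -
  interpret R: cring R by fact
  note Dc = higher_derivationD[OF D] and r = injective_resolutionD[OF res]
  note \<epsilon>D = module_homsD[OF r(4)] and \<delta>D = module_homsD[OF r(5)]
  let ?X = "\<lambda>m. twisted_module D (Suc n) (E m)"
  let ?f = "\<lambda>a k. if k \<le> n then \<epsilon> (D k a) else \<zero>\<^bsub>E 0\<^esub>"
  let ?d = "\<lambda>m x k. \<delta> m (x k)"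
  have rm: "carrier (ring_module R) = carrier R" "x \<oplus>\<^bsub>ring_module R\<^esub> y = x \<oplus>\<^bsub>R\<^esub> y"
    "x \<odot>\<^bsub>ring_module R\<^esub> y = x \<otimes>\<^bsub>R\<^esub> y" for x y
    by (auto simp: ring_module_def)
  have \<delta>0: "\<delta> m \<zero>\<^bsub>E m\<^esub> = \<zero>\<^bsub>E (Suc m)\<^esub>" for m by (rule module_homs_zero[OF r(3,3,5)])
  have \<delta>\<delta>: "\<delta> (Suc m) (\<delta> m x) = \<zero>\<^bsub>E (Suc (Suc m))\<^esub>" if "x \<in> carrier (E m)" for m x
    using r(8)[of "\<delta> m x" m] \<delta>D(1)[OF that] that by blast
  have cX: "x k \<in> carrier (E m)" if "x \<in> carrier (?X m)" for x k m
  proof -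
    interpret E: Module.module R "E m" by (rule r(3))
    show ?thesis using that by (cases "k \<le> n") (auto simp: twisted_module_def)
  qed
  have f: "?f \<in> module_homs R (ring_module R) (?X 0)"
  proof (rule module_homsI)
    interpret E: Module.module R "E 0" by (rule r(3))
    fix a b assume ab: "a \<in> carrier R" "b \<in> carrier (ring_module R)"
    have "\<epsilon> (D k (a \<otimes>\<^bsub>R\<^esub> b)) = (\<Oplus>\<^bsub>E 0\<^esub>j\<in>{..k}. D j a \<odot>\<^bsub>E 0\<^esub> \<epsilon> (D (k - j) b))" for k
    proof -
      have "\<epsilon> (D k (a \<otimes>\<^bsub>R\<^esub> b)) = (\<Oplus>\<^bsub>E 0\<^esub>j\<in>{..k}. \<epsilon> (D j a \<otimes>\<^bsub>R\<^esub> D (k - j) b))"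
        using module_homs_finsum[OF r(1) r(3) r(4), of "{..k}" "\<lambda>j. D j a \<otimes>\<^bsub>R\<^esub> D (k - j) b"] ab
        by (simp add: finsum_ring_module R rm Dc)
      also have "\<dots> = (\<Oplus>\<^bsub>E 0\<^esub>j\<in>{..k}. D j a \<odot>\<^bsub>E 0\<^esub> \<epsilon> (D (k - j) b))"
        using ab \<epsilon>D(3) \<epsilon>D(1) by (intro E.M.finsum_cong') (auto simp: rm Dc)
      finally show ?thesis .
    qed
    then show "?f (a \<odot>\<^bsub>ring_module R\<^esub> b) = a \<odot>\<^bsub>?X 0\<^esub> ?f b"
      using ab \<epsilon>D(1)
      by (auto simp: rm fun_eq_iff twisted_module_def less_Suc_eq_le Dc intro!: E.M.finsum_cong')
  next
    interpret E: Module.module R "E 0" by (rule r(3))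
    show "?f (x \<oplus>\<^bsub>ring_module R\<^esub> y) = ?f x \<oplus>\<^bsub>?X 0\<^esub> ?f y"
      if "x \<in> carrier (ring_module R)" "y \<in> carrier (ring_module R)" for x y
      using that \<epsilon>D(2) by (auto simp: rm fun_eq_iff twisted_module_def Dc)
  qed (use \<epsilon>D(1) in \<open>auto simp: rm twisted_module_def less_Suc_eq_le Dc\<close>)
  have d: "?d m \<in> module_homs R (?X m) (?X (Suc m))" for m
  proof (rule module_homsI)
    interpret E: Module.module R "E m" by (rule r(3))
    interpret E': Module.module R "E (Suc m)" by (rule r(3))
    fix a x assume ax: "a \<in> carrier R" "x \<in> carrier (?X m)"
    have "\<delta> m (\<Oplus>\<^bsub>E m\<^esub>j\<in>{..k}. D j a \<odot>\<^bsub>E m\<^esub> x (k - j))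
      = (\<Oplus>\<^bsub>E (Suc m)\<^esub>j\<in>{..k}. D j a \<odot>\<^bsub>E (Suc m)\<^esub> \<delta> m (x (k - j)))" for k
      using ax cX[OF ax(2)] module_homs_finsum[OF r(3,3,5), of "{..k}" "\<lambda>j. D j a \<odot>\<^bsub>E m\<^esub> x (k - j)"]
      by (simp add: \<delta>D Dc cong: E'.M.finsum_cong)
    then show "?d m (a \<odot>\<^bsub>?X m\<^esub> x) = a \<odot>\<^bsub>?X (Suc m)\<^esub> ?d m x"
      by (auto simp: twisted_module_def fun_eq_iff \<delta>0)
  next
    fix x y assume "x \<in> carrier (?X m)" "y \<in> carrier (?X m)"
    then show "?d m (x \<oplus>\<^bsub>?X m\<^esub> y) = ?d m x \<oplus>\<^bsub>?X (Suc m)\<^esub> ?d m y"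
      using cX[of x m] cX[of y m] \<delta>D(2) by (simp add: twisted_module_def)
  qed (auto simp: twisted_module_def \<delta>0 \<delta>D)
  obtain \<phi> where \<phi>: "\<And>m. \<phi> m \<in> module_homs R (E m) (?X m)"
    "\<And>x. x \<in> carrier (ring_module R) \<Longrightarrow> \<phi> 0 (\<epsilon> x) = ?f x"
    "\<And>m x. x \<in> carrier (E m) \<Longrightarrow> \<phi> (Suc m) (\<delta> m x) = ?d m (\<phi> m x)"
  proof (rule comparison_map[where F = ?X and d = ?d and f = ?f, OF res injective_twisted_module[OF D r(2)] d _ f])
    show "?d (Suc m) (?d m x) = \<zero>\<^bsub>?X (Suc (Suc m))\<^esub>" if "x \<in> carrier (?X m)" for m x
      using \<delta>\<delta> cX[OF that] by (simp add: twisted_module_def)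
    show "?d 0 (?f x) = \<zero>\<^bsub>?X (Suc 0)\<^esub>" if "x \<in> carrier (ring_module R)" for x
    proof -
      have "\<delta> 0 (\<epsilon> (D k x)) = \<zero>\<^bsub>E (Suc 0)\<^esub>" for k
        using r(7)[of "\<epsilon> (D k x)"] \<epsilon>D(1)[of "D k x"] Dc(1)[of x k] that by (auto simp: rm)
      then show ?thesis by (auto simp: twisted_module_def fun_eq_iff \<delta>0)
    qed
  qed blast
  show ?thesis
    by (rule that[of \<phi>]) (use \<phi> in \<open>auto simp: rm\<close>)
qed

text \<open>
  The operator \<open>\<lambda>x. \<phi> x k\<close> has differential order at most \<open>k\<close>: its commutator with \<open>a\<close> only
  involves the operators with smaller index. So it costs at most \<open>k\<close> powers of \<open>I\<close>.
\<close>

lemma twisted_hom_torsion_layer: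
  fixes R :: "('a, 'r) ring_scheme" and E F :: "('a, 'e) module"
  assumes D: "higher_derivation R D" and I: "ideal I R"
    and E: "Module.module R E" and F: "Module.module R F"
    and \<phi>: "\<phi> \<in> module_homs R E (twisted_module D (Suc n) F)"
    and x: "x \<in> torsion_layer R I E p" and k: "k \<le> n"
  shows "\<phi> x k \<in> torsion_layer R I F (p + k)"
  using x k
proof (induction "p + k" arbitrary: p k x rule: less_induct)
  case less
  interpret E: Module.module R E by fact
  interpret F: Module.module R F by fact
  interpret I: ideal I R by fact
  note Dc = higher_derivationD[OF D]
  note sF = F.submoduleE[OF torsion_layer_submodule[OF F I]]
  have xE: "x \<in> carrier E"
    using less.prems(1) E.submoduleE(1)[OF torsion_layer_submodule[OF E I]] by blast
  have \<phi>F: "\<phi> x j \<in> carrier F" if "x \<in> carrier E" for x j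
    using module_homsD(1)[OF \<phi> that] by (cases "j \<le> n") (auto simp: twisted_module_def)
  show ?case
  proof (cases p)
    case 0
    then have "\<phi> x = \<zero>\<^bsub>twisted_module D (Suc n) F\<^esub>"
      using module_homs_zero[OF E twisted_module_module[OF D F] \<phi>] less.prems by simp
    then have "\<phi> x k = \<zero>\<^bsub>F\<^esub>" by (simp add: twisted_module_def)
    then show ?thesis
      using torsion_layer_submodule[OF F I, of "p + k"] by (simp add: submodule_def subgroup_def)
  next
    case (Suc p')
    have "a \<odot>\<^bsub>F\<^esub> \<phi> x k \<in> torsion_layer R I F (p' + k)" if a: "a \<in> I" for a
    proof -
      have aR: "a \<in> carrier R" using a by (rule I.Icarr)
      let ?t = "\<lambda>j. D j a \<odot>\<^bsub>F\<^esub> \<phi> x (k - j)"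
      have "?t 0 \<in> torsion_layer R I F (p' + k)"
      proof (rule submodule_finsum_term[OF F torsion_layer_submodule[OF F I],
            where A = "{..k}" and i = 0 and t = ?t])
        have "\<phi> (a \<odot>\<^bsub>E\<^esub> x) k \<in> torsion_layer R I F (p' + k)"
          using less.prems a by (intro less.hyps) (auto simp: Suc)
        then show "(\<Oplus>\<^bsub>F\<^esub>j\<in>{..k}. ?t j) \<in> torsion_layer R I F (p' + k)"
          using module_homsD(3)[OF \<phi> aR xE] less.prems(2) by (simp add: twisted_module_def)
        show "?t j \<in> torsion_layer R I F (p' + k)" if "j \<in> {..k} - {0}" for j
        proof -
          have "\<phi> x (k - j) \<in> torsion_layer R I F (p + (k - j))"
            using less.prems that by (intro less.hyps) auto
          moreover have "p + (k - j) \<le> p' + k" using that Suc by auto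
          ultimately have "\<phi> x (k - j) \<in> torsion_layer R I F (p' + k)"
            using torsion_layer_mono[OF F I] by blast
          then show ?thesis using sF(4) Dc(1)[OF aR] by blast
        qed
      qed (auto simp: Dc aR \<phi>F[OF xE])
      then show ?thesis by (simp add: Dc aR)
    qed
    then show ?thesis using Suc \<phi>F[OF xE] by simp
  qed
qed

definition torsion_cocycles ::
    "('a, 'r) ring_scheme \<Rightarrow> 'a set \<Rightarrow> (nat \<Rightarrow> ('a, 'e) module) \<Rightarrow> (nat \<Rightarrow> 'e \<Rightarrow> 'e) \<Rightarrow> nat \<Rightarrow> 'e set" where
  "torsion_cocycles R I E \<delta> i = {x \<in> torsion_part R I (E i). \<delta> i x = \<zero>\<^bsub>E (Suc i)\<^esub>}"

definition torsion_coboundaries ::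
    "('a, 'r) ring_scheme \<Rightarrow> 'a set \<Rightarrow> (nat \<Rightarrow> ('a, 'e) module) \<Rightarrow> (nat \<Rightarrow> 'e \<Rightarrow> 'e) \<Rightarrow> nat \<Rightarrow> 'e set" where
  "torsion_coboundaries R I E \<delta> i =
     (case i of 0 \<Rightarrow> {\<zero>\<^bsub>E 0\<^esub>} | Suc j \<Rightarrow> \<delta> j ` torsion_part R I (E j))"

text \<open>
  The quotient by the coboundaries \<open>B\<close> is eliminated here: \<open>a\<close> annihilates the cohomology exactly if it
  maps the cocycles \<open>Z\<close> into \<open>B\<close>.
\<close>

lemma annihilator_local_cohomology:
  fixes i :: nat
  assumes res: "injective_resolution R M E \<epsilon> \<delta>" and I: "ideal I R"
  defines "Z \<equiv> torsion_cocycles R I E \<delta> i" and "B \<equiv> torsion_coboundaries R I E \<delta> i"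
  shows "Module.submodule B R (E i)" "Module.submodule Z R (E i)" "B \<subseteq> Z"
    and "annihilator R (local_cohomology R I E \<delta> i) = {a \<in> carrier R. \<forall>z\<in>Z. a \<odot>\<^bsub>E i\<^esub> z \<in> B}"
proof -
  note r = injective_resolutionD[OF res]
  note \<delta>D = module_homsD[OF r(5)]
  interpret E: Module.module R "E i" by (rule r(3))
  interpret E': Module.module R "E (Suc i)" by (rule r(3))
  note sT = module.submoduleE[OF r(3) torsion_part_submodule[OF r(3) I]]
  have T0: "\<zero>\<^bsub>E j\<^esub> \<in> torsion_part R I (E j)" for j
    using torsion_part_submodule[OF r(3) I, of j] by (simp add: submodule_def subgroup_def)
  have \<delta>0: "\<delta> m \<zero>\<^bsub>E m\<^esub> = \<zero>\<^bsub>E (Suc m)\<^esub>" for m by (rule module_homs_zero[OF r(3,3,5)])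
  have sm_minus: "\<ominus>\<^bsub>E i\<^esub> x = (\<ominus>\<^bsub>R\<^esub> \<one>\<^bsub>R\<^esub>) \<odot>\<^bsub>E i\<^esub> x" if "x \<in> carrier (E i)" for x
    using that by (simp add: E.smult_l_minus)
  show Z: "Module.submodule Z R (E i)"
  proof (rule E.submoduleI)
    show smc: "a \<odot>\<^bsub>E i\<^esub> x \<in> Z" if "a \<in> carrier R" "x \<in> Z" for a x
      using that sT(1)[of i] sT(4)[of a x i] \<delta>D(3)[of a x i] by (auto simp: Z_def torsion_cocycles_def)
    show "\<ominus>\<^bsub>E i\<^esub> x \<in> Z" if "x \<in> Z" for x
      using smc[of "\<ominus>\<^bsub>R\<^esub> \<one>\<^bsub>R\<^esub>" x] that sT(1)[of i] by (simp add: sm_minus Z_def torsion_cocycles_def subset_iff)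
    show "x \<oplus>\<^bsub>E i\<^esub> y \<in> Z" if "x \<in> Z" "y \<in> Z" for x y
      using that sT(1)[of i] sT(5)[of x i y] \<delta>D(2)[of x i y] by (auto simp: Z_def torsion_cocycles_def)
  qed (use sT(1)[of i] T0 \<delta>0 in \<open>auto simp: Z_def torsion_cocycles_def\<close>)
  show B: "Module.submodule B R (E i)"
  proof (cases i)
    case 0
    interpret E0: Module.module R "E 0" by (rule r(3))
    show ?thesis unfolding 0 B_def torsion_coboundaries_def by (intro E0.submoduleI) auto
  next
    case (Suc j)
    show ?thesis
      using module_homs_image_submodule[OF r(3,3,5) torsion_part_submodule[OF r(3) I], of j]
      by (simp add: B_def torsion_coboundaries_def Suc)
  qed
  show BZ: "B \<subseteq> Z"
  proof (cases i)
    case 0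
    then show ?thesis using T0[of 0] \<delta>0[of 0] by (auto simp: B_def torsion_coboundaries_def Z_def torsion_cocycles_def)
  next
    case (Suc j)
    have "\<delta> j x \<in> Z" if x: "x \<in> torsion_part R I (E j)" for x
    proof -
      have "x \<in> carrier (E j)" using x sT(1) by blast
      then show ?thesis
        using r(8)[of "\<delta> j x" j] torsion_part_hom[OF r(3,3) I r(5) x] \<delta>D(1)[of x j] Suc
        by (auto simp: Z_def torsion_cocycles_def)
    qed
    then show ?thesis by (auto simp: B_def torsion_coboundaries_def Suc)
  qed
  have EZ: "Module.module R (E i\<lparr>carrier := Z\<rparr>)"
    by (rule submodule.submodule_is_module[OF Z r(3)])
  interpret EZ: Module.module R "E i\<lparr>carrier := Z\<rparr>" by fact
  note sB = E.submoduleE[OF B]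
  have "Module.submodule B R (E i\<lparr>carrier := Z\<rparr>)"
  proof (rule EZ.module_incl_imp_submodule)
    show "Module.module R (E i\<lparr>carrier := Z, carrier := B\<rparr>)"
      using submodule.submodule_is_module[OF B r(3)] by simp
  qed (use BZ in simp)
  from annihilator_quotient_module[OF EZ this]
  show "annihilator R (local_cohomology R I E \<delta> i) = {a \<in> carrier R. \<forall>z\<in>Z. a \<odot>\<^bsub>E i\<^esub> z \<in> B}"
    by (simp add: local_cohomology_def Z_def B_def torsion_cocycles_def torsion_coboundaries_def)
qed

lemma annihilator_local_cohomology_ideal:
  fixes i :: nat
  assumes R: "cring R" and res: "injective_resolution R M E \<epsilon> \<delta>" and I: "ideal I R"
  shows "ideal (annihilator R (local_cohomology R I E \<delta> i)) R"
proof -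
  interpret R: cring R by fact
  note ann = annihilator_local_cohomology[OF res I, of i]
  interpret E: Module.module R "E i" by (rule injective_resolutionD(3)[OF res])
  define Z where "Z = torsion_cocycles R I E \<delta> i"
  define B where "B = torsion_coboundaries R I E \<delta> i"
  note ann = ann[folded Z_def B_def]
  note sB = E.submoduleE[OF ann(1)] and sZ = E.submoduleE[OF ann(2)]
  have B0: "\<zero>\<^bsub>E i\<^esub> \<in> B" using ann(1) by (simp add: submodule_def subgroup_def)
  have ZE: "z \<in> carrier (E i)" if "z \<in> Z" for z using that sZ(1) by blast
  let ?A = "{a \<in> carrier R. \<forall>z\<in>Z. a \<odot>\<^bsub>E i\<^esub> z \<in> B}"
  have mult: "x \<otimes>\<^bsub>R\<^esub> a \<in> ?A" if "a \<in> ?A" "x \<in> carrier R" for a x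
    using that ZE sB(4) by (auto simp: E.smult_assoc1)
  have "ideal ?A R"
  proof (rule idealI[OF R.ring_axioms])
    show "subgroup ?A (add_monoid R)"
    proof (rule subgroup.intro)
      show "inv\<^bsub>add_monoid R\<^esub> a \<in> ?A" if "a \<in> ?A" for a
        unfolding a_inv_def[symmetric] using that ZE sB(3) by (auto simp: E.smult_l_minus)
    qed (use ZE B0 sB(5) in \<open>auto simp: E.smult_l_distr\<close>)
    show "x \<otimes>\<^bsub>R\<^esub> a \<in> ?A" if "a \<in> ?A" "x \<in> carrier R" for a x using mult[OF that] .
    then show "a \<otimes>\<^bsub>R\<^esub> x \<in> ?A" if "a \<in> ?A" "x \<in> carrier R" for a x
      using that R.m_comm[of a x] by simp
  qed
  then show ?thesis by (simp add: ann(4))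
qed

text \<open>
  For a cocycle \<open>z\<close>, the left-hand side of \<open>\<phi>(a z)\<^sub>n = \<Sum>j. D\<^sub>j(a) \<phi>(z)\<^bsub>n-j\<^esub>\<close> is a coboundary
  because \<open>a z\<close> is one, and the terms with \<open>j < n\<close> are coboundaries by induction. Hence so is
  \<open>D\<^sub>n(a) \<phi>(z)\<^sub>0\<close>, and \<open>z\<close> differs from \<open>\<phi>(z)\<^sub>0\<close> by a coboundary since the component of index \<open>0\<close> is
  homotopic to the identity.
\<close>

lemma higher_derivation_annihilator:
  fixes R :: "('a, 'r) ring_scheme" and E :: "nat \<Rightarrow> ('a, 'e) module"
  assumes D: "higher_derivation R D" and R: "cring R"
    and res: "injective_resolution R (ring_module R) E \<epsilon> \<delta>" and I: "ideal I R"
    and a: "a \<in> annihilator R (local_cohomology R I E \<delta> i)"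
  shows "D n a \<in> annihilator R (local_cohomology R I E \<delta> i)"
proof (induction n rule: less_induct)
  case (less n)
  interpret R: cring R by fact
  note Dc = higher_derivationD[OF D] and r = injective_resolutionD[OF res]
  note \<delta>D = module_homsD[OF r(5)]
  note ann = annihilator_local_cohomology[OF res I, of i]
  define Z where "Z = torsion_cocycles R I E \<delta> i"
  define B where "B = torsion_coboundaries R I E \<delta> i"
  note ann = ann[folded Z_def B_def]
  interpret E: Module.module R "E i" by (rule r(3))
  note sB = E.submoduleE[OF ann(1)] and sZ = E.submoduleE[OF ann(2)]
  have \<delta>0: "\<delta> m \<zero>\<^bsub>E m\<^esub> = \<zero>\<^bsub>E (Suc m)\<^esub>" for m by (rule module_homs_zero[OF r(3,3,5)])
  have \<delta>\<delta>: "\<delta> (Suc m) (\<delta> m x) = \<zero>\<^bsub>E (Suc (Suc m))\<^esub>" if "x \<in> carrier (E m)" for m x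
    using r(8)[of "\<delta> m x" m] \<delta>D(1)[OF that] that by blast
  have aR: "a \<in> carrier R" using a by (simp add: annihilator_def)
  obtain \<phi> where \<phi>: "\<And>m. \<phi> m \<in> module_homs R (E m) (twisted_module D (Suc n) (E m))"
    and \<phi>\<epsilon>: "\<And>a k. a \<in> carrier R \<Longrightarrow> k \<le> n \<Longrightarrow> \<phi> 0 (\<epsilon> a) k = \<epsilon> (D k a)"
    and \<phi>\<delta>: "\<And>m x k. x \<in> carrier (E m) \<Longrightarrow> \<phi> (Suc m) (\<delta> m x) k = \<delta> m (\<phi> m x k)"
    using higher_derivation_chain_map[OF D R res] by metis
  have \<phi>c: "\<phi> m x k \<in> carrier (E m)" if "x \<in> carrier (E m)" for m x k
  proof -
    interpret Em: Module.module R "E m" by (rule r(3))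
    show ?thesis using module_homsD(1)[OF \<phi> that]
      by (cases "k \<le> n") (auto simp: twisted_module_def)
  qed
  have \<phi>0: "\<phi> m \<zero>\<^bsub>E m\<^esub> k = \<zero>\<^bsub>E m\<^esub>" for m k
    using module_homs_zero[OF r(3) twisted_module_module[OF D r(3)] \<phi>]
    by (simp add: twisted_module_def)
  have \<phi>T: "\<phi> m x k \<in> torsion_part R I (E m)" if "x \<in> torsion_part R I (E m)" "k \<le> n" for m x k
    using that twisted_hom_torsion_layer[OF D I r(3,3) \<phi>]
    unfolding torsion_part_eq[OF r(3) I] by blast
  have \<phi>Z: "\<phi> i z k \<in> Z" if z: "z \<in> Z" and k: "k \<le> n" for z k
  proof -
    have "\<delta> i (\<phi> i z k) = \<phi> (Suc i) (\<delta> i z) k" using \<phi>\<delta> z sZ(1) by auto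
    also have "\<dots> = \<zero>\<^bsub>E (Suc i)\<^esub>" using z \<phi>0 by (simp add: Z_def torsion_cocycles_def)
    finally show ?thesis using \<phi>T z k by (simp add: Z_def torsion_cocycles_def)
  qed
  have \<phi>B: "\<phi> i b k \<in> B" if b: "b \<in> B" and k: "k \<le> n" for b k
  proof (cases i)
    case 0
    then show ?thesis using b \<phi>0 by (simp add: B_def torsion_coboundaries_def)
  next
    case (Suc j)
    with b obtain w where w: "w \<in> torsion_part R I (E j)" "b = \<delta> j w" by (auto simp: B_def torsion_coboundaries_def)
    then have "w \<in> carrier (E j)" by (simp add: torsion_part_def)
    then show ?thesis using \<phi>\<delta>[of w j k] w \<phi>T[OF w(1) k] by (auto simp: B_def torsion_coboundaries_def Suc)
  qed
  define \<theta> where "\<theta> m x = x \<ominus>\<^bsub>E m\<^esub> \<phi> m x 0" for m x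
  have \<theta>: "\<theta> m \<in> module_homs R (E m) (E m)" for m
    unfolding \<theta>_def
  proof (rule module_homs_difference[OF r(3,3)])
    interpret Em: Module.module R "E m" by (rule r(3))
    show "(\<lambda>x. \<phi> m x 0) \<in> module_homs R (E m) (E m)"
    proof (rule module_homsI)
      show "\<phi> m (c \<odot>\<^bsub>E m\<^esub> x) 0 = c \<odot>\<^bsub>E m\<^esub> \<phi> m x 0" if "c \<in> carrier R" "x \<in> carrier (E m)" for c x
        using module_homsD(3)[OF \<phi> that] \<phi>c[OF that(2)] that by (simp add: twisted_module_def Dc)
      show "\<phi> m (x \<oplus>\<^bsub>E m\<^esub> y) 0 = \<phi> m x 0 \<oplus>\<^bsub>E m\<^esub> \<phi> m y 0"
        if "x \<in> carrier (E m)" "y \<in> carrier (E m)" for x y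
        using module_homsD(2)[OF \<phi> that] by (simp add: twisted_module_def)
    qed (rule \<phi>c)
  qed (rule module_homsI, auto)
  have \<theta>\<epsilon>: "\<theta> 0 (\<epsilon> x) = \<zero>\<^bsub>E 0\<^esub>" if "x \<in> carrier (ring_module R)" for x
  proof -
    interpret E0: Module.module R "E 0" by (rule r(3))
    have "x \<in> carrier R" using that by (simp add: ring_module_def)
    then show ?thesis
      using \<phi>\<epsilon>[of x 0] module_homsD(1)[OF r(4) that] by (simp add: \<theta>_def Dc E0.M.minus_eq_zero_iff)
  qed
  have \<theta>\<delta>: "\<theta> (Suc m) (\<delta> m x) = \<delta> m (\<theta> m x)" if "x \<in> carrier (E m)" for m x
    unfolding \<theta>_def module_homs_minus[OF r(3,3,5) that \<phi>c[OF that]] using \<phi>\<delta>[OF that] by simp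
  obtain h where h: "\<And>m. h m \<in> module_homs R (E (Suc m)) (E m)"
    and h0: "\<And>x. x \<in> carrier (E 0) \<Longrightarrow> \<theta> 0 x = h 0 (\<delta> 0 x)"
    and hS: "\<And>m x. x \<in> carrier (E (Suc m)) \<Longrightarrow>
      \<theta> (Suc m) x \<ominus>\<^bsub>E (Suc m)\<^esub> \<delta> m (h m x) = h (Suc m) (\<delta> (Suc m) x)"
    by (rule null_homotopy[where \<theta> = \<theta>, OF res r(2) r(5) \<delta>\<delta> \<theta> \<theta>\<epsilon> \<theta>\<delta>])
      (assumption | rule that)+
  have \<theta>Z: "\<theta> i z \<in> B" if z: "z \<in> Z" for z
  proof -
    have zE: "z \<in> carrier (E i)" and \<delta>z: "\<delta> i z = \<zero>\<^bsub>E (Suc i)\<^esub>" and zT: "z \<in> torsion_part R I (E i)"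
      using z sZ(1) by (auto simp: Z_def torsion_cocycles_def)
    have hz: "h m \<zero>\<^bsub>E (Suc m)\<^esub> = \<zero>\<^bsub>E m\<^esub>" for m by (rule module_homs_zero[OF r(3,3) h])
    show ?thesis
    proof (cases i)
      case 0
      then show ?thesis using h0[of z] zE \<delta>z hz by (simp add: B_def torsion_coboundaries_def)
    next
      case (Suc j)
      interpret ES: Module.module R "E (Suc j)" by (rule r(3))
      have "\<theta> (Suc j) z \<ominus>\<^bsub>E (Suc j)\<^esub> \<delta> j (h j z) = \<zero>\<^bsub>E (Suc j)\<^esub>"
        using hS[of z j] zE \<delta>z hz Suc by simp
      then have "\<theta> (Suc j) z = \<delta> j (h j z)"
        using zE Suc module_homsD(1)[OF \<theta>] module_homsD(1)[OF h] \<delta>D(1)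
        by (subst (asm) ES.M.minus_eq_zero_iff) auto
      then show ?thesis
        using torsion_part_hom[OF r(3,3) I h] zT Suc by (auto simp: B_def torsion_coboundaries_def)
    qed
  qed
  have "D n a \<odot>\<^bsub>E i\<^esub> z \<in> B" if z: "z \<in> Z" for z
  proof -
    have zE: "z \<in> carrier (E i)" using z sZ(1) by blast
    let ?t = "\<lambda>j. D j a \<odot>\<^bsub>E i\<^esub> \<phi> i z (n - j)"
    have "?t n \<in> B"
    proof (rule submodule_finsum_term[OF r(3) ann(1), where A = "{..n}" and i = n and t = ?t])
      have "\<phi> i (a \<odot>\<^bsub>E i\<^esub> z) n \<in> B"
        using a z by (intro \<phi>B) (auto simp: ann(4))
      then show "(\<Oplus>\<^bsub>E i\<^esub>j\<in>{..n}. ?t j) \<in> B"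
        using module_homsD(3)[OF \<phi> aR zE] by (simp add: twisted_module_def)
      show "?t j \<in> B" if "j \<in> {..n} - {n}" for j
        using less.IH[of j] \<phi>Z[OF z] that by (auto simp: ann(4))
    qed (auto simp: Dc aR \<phi>c[OF zE])
    then have 1: "D n a \<odot>\<^bsub>E i\<^esub> \<phi> i z 0 \<in> B" by simp
    have 2: "D n a \<odot>\<^bsub>E i\<^esub> \<theta> i z \<in> B"
      using sB(4) Dc(1)[OF aR] \<theta>Z[OF z] by blast
    have "z = \<theta> i z \<oplus>\<^bsub>E i\<^esub> \<phi> i z 0"
      using zE \<phi>c[OF zE] by (simp add: \<theta>_def E.M.minus_eq E.M.a_assoc E.M.l_neg)
    then have "D n a \<odot>\<^bsub>E i\<^esub> z = D n a \<odot>\<^bsub>E i\<^esub> \<theta> i z \<oplus>\<^bsub>E i\<^esub> D n a \<odot>\<^bsub>E i\<^esub> \<phi> i z 0"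
      using E.smult_r_distr[OF Dc(1)[OF aR] module_homsD(1)[OF \<theta> zE] \<phi>c[OF zE]] by metis
    then show ?thesis using 1 2 sB(5) by simp
  qed
  then show ?case using Dc(1)[OF aR] by (simp add: ann(4))
qed

section \<open>Prime ideals\<close>

text \<open>
  The ideal \<open>P\<close> is maximal among those disjoint from \<open>M\<close>. The last conclusion spells this out for the
  ideal generated by \<open>P\<close> and \<open>a\<close>, which is the form used in \<open>lying_over\<close>.
\<close>

lemma (in cring) prime_ideal_avoiding:
  assumes M: "M \<subseteq> carrier R" "\<one> \<in> M" "\<And>a b. a \<in> M \<Longrightarrow> b \<in> M \<Longrightarrow> a \<otimes> b \<in> M"
    and T: "ideal T R" "T \<inter> M = {}"
  obtains P where "primeideal P R" "T \<subseteq> P" "P \<inter> M = {}"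
    "\<And>a. a \<in> carrier R \<Longrightarrow> a \<notin> P \<Longrightarrow> \<exists>p\<in>P. \<exists>r\<in>carrier R. p \<oplus> r \<otimes> a \<in> M"
proof -
  define A where "A = {Q. ideal Q R \<and> T \<subseteq> Q \<and> Q \<inter> M = {}}"
  have "\<exists>P\<in>A. \<forall>Q\<in>A. P \<subseteq> Q \<longrightarrow> Q = P"
  proof (rule subset_Zorn_nonempty)
    show "A \<noteq> {}" using T by (auto simp: A_def)
    fix C assume C: "C \<noteq> {}" "subset.chain A C"
    have CA: "ideal X R" "T \<subseteq> X" "X \<inter> M = {}" if "X \<in> C" for X
      using C(2) that by (auto simp: subset.chain_def A_def)
    have "ideal (\<Union>C) R"
    proof (rule idealI[OF ring_axioms])
      show "subgroup (\<Union>C) (add_monoid R)"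
      proof (rule subgroup.intro)
        show "\<Union>C \<subseteq> carrier (add_monoid R)"
          using ideal.Icarr[OF CA(1)] by auto
        fix a b assume "a \<in> \<Union>C" "b \<in> \<Union>C"
        then obtain X where X: "X \<in> C" "a \<in> X" "b \<in> X"
          using C(2) unfolding subset.chain_def by blast
        then show "a \<otimes>\<^bsub>add_monoid R\<^esub> b \<in> \<Union>C"
          using additive_subgroup.a_closed[OF ideal.axioms(1)[OF CA(1)[OF X(1)]] X(2,3)] by auto
      next
        obtain X where X: "X \<in> C" using C(1) by blast
        show "\<one>\<^bsub>add_monoid R\<^esub> \<in> \<Union>C"
          using additive_subgroup.zero_closed[OF ideal.axioms(1)[OF CA(1)[OF X]]] X by auto
      next
        fix a assume "a \<in> \<Union>C"
        then obtain X where X: "X \<in> C" "a \<in> X" by blast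
        have "subgroup X (add_monoid R)"
          by (rule additive_subgroup.a_subgroup[OF ideal.axioms(1)[OF CA(1)[OF X(1)]]])
        then show "inv\<^bsub>add_monoid R\<^esub> a \<in> \<Union>C" using subgroup.m_inv_closed[OF _ X(2)] X(1) by auto
      qed
    next
      fix a x assume a: "a \<in> \<Union>C" and x: "x \<in> carrier R"
      then obtain X where X: "X \<in> C" "a \<in> X" by blast
      show "x \<otimes> a \<in> \<Union>C" "a \<otimes> x \<in> \<Union>C"
        using ideal.I_l_closed[OF CA(1)[OF X(1)] X(2) x] ideal.I_r_closed[OF CA(1)[OF X(1)] X(2) x] X(1)
        by auto
    qed
    then show "\<Union>C \<in> A" using C(1) CA(2,3) by (auto simp: A_def)
  qed
  then obtain P where P: "P \<in> A" and max: "\<And>Q. Q \<in> A \<Longrightarrow> P \<subseteq> Q \<Longrightarrow> Q = P" by blast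
  from P interpret P: ideal P R by (simp add: A_def)
  have PM: "P \<inter> M = {}" and TP: "T \<subseteq> P" using P by (auto simp: A_def)
  have max': "Q = P" if "ideal Q R" "P \<subseteq> Q" "Q \<inter> M = {}" for Q
    using max[of Q] that TP by (auto simp: A_def)
  have meet: "\<exists>p\<in>P. \<exists>r\<in>carrier R. p \<oplus> r \<otimes> a \<in> M" if a: "a \<in> carrier R" "a \<notin> P" for a
  proof (rule ccontr)
    assume *: "\<not> ?thesis"
    have car: "p \<in> carrier R" if "p \<in> P" for p using that by (rule P.Icarr)
    have sub: "set_add R P (PIdl a) = {p \<oplus> r \<otimes> a | p r. p \<in> P \<and> r \<in> carrier R}"
      by (auto simp: set_add_def set_mult_def cgenideal_def)
    have id: "ideal (set_add R P (PIdl a)) R"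
      by (rule add_ideals[OF P.is_ideal cgenideal_ideal[OF a(1)]])
    have "p \<in> set_add R P (PIdl a)" if "p \<in> P" for p
      unfolding sub using that a car by (intro CollectI exI[of _ p] exI[of _ \<zero>]) auto
    then have "set_add R P (PIdl a) = P"
      using * by (intro max'[OF id]) (auto simp: sub)
    moreover have "a \<in> set_add R P (PIdl a)"
      unfolding sub using a P.zero_closed by (intro CollectI exI[of _ \<zero>] exI[of _ \<one>]) auto
    ultimately show False using a by simp
  qed
  have "primeideal P R"
  proof (rule primeidealI)
    show "ideal P R" by (rule P.is_ideal)
    show "cring R" by (rule is_cring)
    show "carrier R \<noteq> P" using M PM by auto
    fix a b assume ab: "a \<in> carrier R" "b \<in> carrier R" "a \<otimes> b \<in> P"
    show "a \<in> P \<or> b \<in> P"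
    proof (rule ccontr)
      assume "\<not> (a \<in> P \<or> b \<in> P)"
      with meet ab obtain p r q s where pr: "p \<in> P" "r \<in> carrier R" "p \<oplus> r \<otimes> a \<in> M"
        and qs: "q \<in> P" "s \<in> carrier R" "q \<oplus> s \<otimes> b \<in> M" by meson
      have car: "p \<in> carrier R" "q \<in> carrier R" using pr qs P.Icarr by auto
      have "(p \<oplus> r \<otimes> a) \<otimes> (q \<oplus> s \<otimes> b) = p \<otimes> (q \<oplus> s \<otimes> b) \<oplus> ((r \<otimes> a) \<otimes> q \<oplus> (r \<otimes> s) \<otimes> (a \<otimes> b))"
        using pr qs car ab by (simp add: l_distr r_distr m_ac a_ac)
      also have "\<dots> \<in> P"
        using P.I_r_closed[OF pr(1), of "q \<oplus> s \<otimes> b"] P.I_l_closed[OF qs(1), of "r \<otimes> a"]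
          P.I_l_closed[OF ab(3), of "r \<otimes> s"] pr qs car ab by (intro P.a_closed) auto
      finally show False using M(3)[OF pr(3) qs(3)] PM by blast
    qed
  qed
  with TP PM meet show ?thesis by (intro that[of P]) auto
qed

lemma primeideal_subset:
  assumes "primeideal P R"
  shows "P \<subseteq> carrier R"
proof -
  interpret primeideal P R by fact
  show ?thesis by (rule a_subset)
qed

text \<open>
  Zorn's lemma is applied to complements, as the intersection of a chain of prime ideals is prime.
\<close>

lemma (in cring) minimal_prime_ideal:
  assumes Q0: "primeideal Q0 R" and T: "T \<subseteq> Q0"
  obtains Q where "primeideal Q R" "T \<subseteq> Q" "Q \<subseteq> Q0"
    "\<And>Q'. primeideal Q' R \<Longrightarrow> T \<subseteq> Q' \<Longrightarrow> Q' \<subseteq> Q \<Longrightarrow> Q' = Q"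
proof -
  define A where "A = {carrier R - Q | Q. primeideal Q R \<and> T \<subseteq> Q \<and> Q \<subseteq> Q0}"
  have "\<exists>M\<in>A. \<forall>X\<in>A. M \<subseteq> X \<longrightarrow> X = M"
  proof (rule subset_Zorn_nonempty)
    show "A \<noteq> {}" using Q0 T by (auto simp: A_def)
    fix C assume C: "C \<noteq> {}" "subset.chain A C"
    define Q where "Q = carrier R - \<Union>C"
    have CA: "primeideal (carrier R - X) R" "X \<subseteq> carrier R" "T \<subseteq> carrier R - X" "carrier R - X \<subseteq> Q0"
      if X: "X \<in> C" for X
    proof -
      have "X \<in> A" using C(2) X by (auto simp: subset.chain_def)
      then obtain Q' where Q': "X = carrier R - Q'" "primeideal Q' R" "T \<subseteq> Q'" "Q' \<subseteq> Q0"
        by (auto simp: A_def)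
      moreover have "Q' \<subseteq> carrier R"
        using Q'(2) by (rule primeideal_subset)
      ultimately have "carrier R - X = Q'" by auto
      with Q' show "primeideal (carrier R - X) R" "X \<subseteq> carrier R" "T \<subseteq> carrier R - X" "carrier R - X \<subseteq> Q0"
        by auto
    qed
    have Qin: "x \<in> Q \<longleftrightarrow> (\<forall>X\<in>C. x \<in> carrier R - X)" for x
      using C(1) by (auto simp: Q_def)
    have "primeideal Q R"
    proof (rule primeidealI)
      have id: "ideal (carrier R - X) R" if "X \<in> C" for X
        using CA(1)[OF that] primeideal.axioms(1) by blast
      have "ideal (\<Inter> ((\<lambda>X. carrier R - X) ` C)) R"
        using C(1) id by (intro i_Intersect) auto
      moreover have "\<Inter> ((\<lambda>X. carrier R - X) ` C) = Q" using Qin by auto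
      ultimately show "ideal Q R" by simp
      show "cring R" by (rule is_cring)
      obtain X where X: "X \<in> C" using C(1) by blast
      then have "carrier R - X \<noteq> carrier R" using primeideal.I_notcarr[OF CA(1)] by metis
      then show "carrier R \<noteq> Q" using Qin X by blast
      fix a b assume ab: "a \<in> carrier R" "b \<in> carrier R" "a \<otimes> b \<in> Q"
      show "a \<in> Q \<or> b \<in> Q"
      proof (rule ccontr)
        assume "\<not> (a \<in> Q \<or> b \<in> Q)"
        then obtain X Y where XY: "X \<in> C" "Y \<in> C" "a \<in> X" "b \<in> Y"
          using ab unfolding Qin by blast
        then obtain Z where Z: "Z \<in> C" "a \<in> Z" "b \<in> Z"
          using C(2) unfolding subset.chain_def by blast
        then have "a \<otimes> b \<in> carrier R - Z" using ab(3) Qin by blast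
        then show False using primeideal.I_prime[OF CA(1)[OF Z(1)] ab(1,2)] Z by blast
      qed
    qed
    moreover have "T \<subseteq> Q" "Q \<subseteq> Q0" using CA(3,4) C(1) Qin by blast+
    moreover have "\<Union>C = carrier R - Q" using CA(2) by (auto simp: Q_def)
    ultimately show "\<Union>C \<in> A" by (auto simp: A_def)
  qed
  then obtain Q where Q: "primeideal Q R" "T \<subseteq> Q" "Q \<subseteq> Q0"
    and max: "\<And>X. X \<in> A \<Longrightarrow> carrier R - Q \<subseteq> X \<Longrightarrow> X = carrier R - Q"
    by (auto simp: A_def)
  show ?thesis
  proof (rule that[OF Q])
    fix Q' assume Q': "primeideal Q' R" "T \<subseteq> Q'" "Q' \<subseteq> Q"
    then have "carrier R - Q' \<in> A" unfolding A_def using Q(3) by auto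
    then have "carrier R - Q' = carrier R - Q" using Q'(3) by (intro max Diff_mono subset_refl)
    moreover have "Q' \<subseteq> carrier R" "Q \<subseteq> carrier R"
      using Q(1) Q'(1) by (auto dest: primeideal_subset)
    ultimately show "Q' = Q" by blast
  qed
qed

lemma ideal_submodule:
  assumes "cring R" and I: "ideal I R"
  shows "Module.submodule I R (ring_module R)"
proof -
  interpret cring R by fact
  interpret M: Module.module R "ring_module R" by (rule ring_module_module) fact
  interpret I: ideal I R by fact
  have [simp]: "\<zero>\<^bsub>ring_module R\<^esub> = \<zero>\<^bsub>R\<^esub>" "x \<oplus>\<^bsub>ring_module R\<^esub> y = x \<oplus>\<^bsub>R\<^esub> y"
    "x \<odot>\<^bsub>ring_module R\<^esub> y = x \<otimes>\<^bsub>R\<^esub> y"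
    "carrier (ring_module R) = carrier R" for x y by (auto simp: ring_module_def)
  have "\<ominus>\<^bsub>ring_module R\<^esub> x \<in> I" if "x \<in> I" for x
    using M.smult_l_minus[of "\<one>\<^bsub>R\<^esub>" x] that I.Icarr[OF that] I.a_inv_closed[OF that] I.I_l_closed[of x "\<ominus>\<^bsub>R\<^esub> \<one>\<^bsub>R\<^esub>"] by simp
  then show ?thesis
    by (intro M.submoduleI) (auto intro: I.Icarr I.I_l_closed)
qed

lemma ideal_finsum_term:
  assumes R: "cring R" and I: "ideal I R"
    and A: "finite A" "i \<in> A" and t: "t \<in> A \<rightarrow> carrier R"
    and others: "\<And>j. j \<in> A - {i} \<Longrightarrow> t j \<in> I"
  shows "(\<Oplus>\<^bsub>R\<^esub>j\<in>A. t j) \<in> I \<longleftrightarrow> t i \<in> I"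
proof
  have c: "carrier (ring_module R) = carrier R" by (simp add: ring_module_def)
  show "(\<Oplus>\<^bsub>R\<^esub>j\<in>A. t j) \<in> I \<Longrightarrow> t i \<in> I"
    using submodule_finsum_term[OF ring_module_module[OF R] ideal_submodule[OF R I] A, of t] t others
    by (auto simp: finsum_ring_module[OF R A(1) t] c)
next
  interpret cring R by fact
  interpret I: ideal I R by fact
  have *: "(\<Oplus>\<^bsub>R\<^esub>j\<in>B. t j) \<in> I" if "finite B" "\<forall>j\<in>B. t j \<in> I" for B
    using that
  proof (induction rule: finite_induct)
    case (insert x F)
    then show ?case using I.Icarr by (subst finsum_insert) auto
  qed (simp add: I.zero_closed)
  show "t i \<in> I \<Longrightarrow> (\<Oplus>\<^bsub>R\<^esub>j\<in>A. t j) \<in> I"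
    using A others by (intro *) blast+
qed

text \<open>
  \<open>D\<close> amounts to a ring homomorphism \<open>a \<mapsto> \<Sum>n. D n a \<xi>^n\<close> into power series, and this is the
  preimage of the prime ideal of power series with coefficients in \<open>Q\<close>.
\<close>

lemma higher_derivation_prime_core:
  fixes R (structure)
  assumes D: "higher_derivation R D" and R: "cring R" and Q: "primeideal Q R"
  shows "primeideal {a \<in> carrier R. \<forall>n. D n a \<in> Q} R"
proof -
  interpret cring R by fact
  interpret Q: primeideal Q R by fact
  note Dc = higher_derivationD[OF D]
  let ?P = "{a \<in> carrier R. \<forall>n. D n a \<in> Q}"
  have D0: "D n \<zero> = \<zero>" for n
    using Dc(4)[of \<zero> \<zero> n] Dc(1)[of \<zero> n] by simp
  have mult: "r \<otimes> a \<in> ?P" if ra: "r \<in> carrier R" "a \<in> ?P" for r a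
  proof -
    have "D 0 a \<in> Q" using ra by blast
    then have aQ: "a \<in> Q" using ra Dc(2)[of a] by simp
    have "(\<Oplus>j\<in>{..n}. D j r \<otimes> D (n - j) a) \<in> Q" for n
      using Q.I_l_closed[OF aQ] ideal_finsum_term[OF R Q.is_ideal, of "{..n}" n "\<lambda>j. D j r \<otimes> D (n - j) a"] ra
      by (auto simp: Dc Q.I_l_closed)
    then show ?thesis using ra by (simp add: Dc)
  qed
  have minus: "\<ominus> a \<in> ?P" if a: "a \<in> ?P" for a
    using mult[of "\<ominus> \<one>" a] a by (simp add: l_minus)
  show ?thesis
  proof (rule primeidealI)
    show "ideal ?P R"
    proof (rule idealI)
      show "subgroup ?P (add_monoid R)"
        using minus by (intro subgroup.intro) (auto simp: a_inv_def D0 Dc Q.zero_closed Q.a_closed)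
      show "x \<otimes> a \<in> ?P" if "a \<in> ?P" "x \<in> carrier R" for a x using mult that by blast
      then show "a \<otimes> x \<in> ?P" if "a \<in> ?P" "x \<in> carrier R" for a x
        using that m_comm[of a x] by simp
    qed (rule ring_axioms)
    show "cring R" by fact
    have "\<one> \<notin> Q" using Q.one_imp_carrier Q.I_notcarr by metis
    then have "D 0 \<one> \<notin> Q" by (simp add: Dc)
    then have "\<one> \<notin> ?P" by blast
    then show "carrier R \<noteq> ?P" using one_closed by blast
    fix a b assume ab: "a \<in> carrier R" "b \<in> carrier R" "a \<otimes> b \<in> ?P"
    show "a \<in> ?P \<or> b \<in> ?P"
    proof (rule ccontr)
      assume *: "\<not> (a \<in> ?P \<or> b \<in> ?P)"
      define m where "m = (LEAST n. D n a \<notin> Q)"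
      define k where "k = (LEAST n. D n b \<notin> Q)"
      have m: "D m a \<notin> Q" "\<And>j. j < m \<Longrightarrow> D j a \<in> Q"
        using * ab LeastI_ex[of "\<lambda>n. D n a \<notin> Q"] not_less_Least[of _ "\<lambda>n. D n a \<notin> Q"]
        unfolding m_def by blast+
      have k: "D k b \<notin> Q" "\<And>j. j < k \<Longrightarrow> D j b \<in> Q"
        using * ab LeastI_ex[of "\<lambda>n. D n b \<notin> Q"] not_less_Least[of _ "\<lambda>n. D n b \<notin> Q"]
        unfolding k_def by blast+
      have "(\<Oplus>j\<in>{..m + k}. D j a \<otimes> D (m + k - j) b) \<in> Q"
        using ab(3) Dc(5)[OF ab(1,2), of "m + k", symmetric] by simp
      moreover have "D j a \<otimes> D (m + k - j) b \<in> Q" if "j \<in> {..m + k} - {m}" for j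
      proof (cases "j < m")
        case False
        then have "m + k - j < k" using that by auto
        then show ?thesis using k(2) Dc(1) ab by (auto intro: Q.I_l_closed)
      qed (use m(2) Dc(1) ab in \<open>auto intro: Q.I_r_closed\<close>)
      ultimately have "D m a \<otimes> D (m + k - m) b \<in> Q"
        by (subst (asm) ideal_finsum_term[OF R Q.is_ideal, of _ m]) (auto simp: Dc ab)
      then show False using Q.I_prime[OF Dc(1) Dc(1)] ab m k by auto
    qed
  qed
qed

text \<open>
  The core of \<open>Q\<close> is a prime ideal between \<open>T\<close> and \<open>Q\<close>.
\<close>

lemma minimal_prime_stable:
  assumes D: "higher_derivation R D" and R: "cring R" and Q: "primeideal Q R" "T \<subseteq> Q"
    and min: "\<And>Q'. primeideal Q' R \<Longrightarrow> T \<subseteq> Q' \<Longrightarrow> Q' \<subseteq> Q \<Longrightarrow> Q' = Q"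
    and T: "\<And>a n. a \<in> T \<Longrightarrow> D n a \<in> T" and a: "a \<in> Q"
  shows "D n a \<in> Q"
proof -
  let ?P = "{a \<in> carrier R. \<forall>n. D n a \<in> Q}"
  have "T \<subseteq> ?P"
    using T Q(2) primeideal_subset[OF Q(1)] by (intro subsetI CollectI conjI allI) (metis subsetD)+
  moreover have "?P \<subseteq> Q"
  proof
    fix x assume "x \<in> ?P"
    then have "x \<in> carrier R" "D 0 x \<in> Q" by auto
    then show "x \<in> Q" using higher_derivationD(2)[OF D] by simp
  qed
  ultimately have "?P = Q" using higher_derivation_prime_core[OF D R Q(1)] by (intro min)
  then show ?thesis using a by blast
qed

section \<open>Radicals and quotients\<close>

lemma (in cring) radical_ideal:
  assumes I: "ideal I R"
  shows "ideal (radical R I) R"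
proof -
  interpret I: ideal I R by fact
  have pw: "a [^] n \<in> I" if a: "a \<in> carrier R" "a [^] m \<in> I" "m \<le> n" for a and m n :: nat
  proof -
    have "a [^] n = a [^] (n - m) \<otimes> a [^] m" using a by (simp add: nat_pow_mult)
    then show ?thesis using a I.I_l_closed by simp
  qed
  have mult: "x \<otimes> a \<in> radical R I" if "x \<in> carrier R" "a \<in> radical R I" for x a
  proof -
    from that obtain n :: nat where "a \<in> carrier R" "a [^] n \<in> I" by (auto simp: radical_def)
    then have "(x \<otimes> a) [^] n \<in> I" using that(1) by (simp add: nat_pow_distrib I.I_l_closed)
    then show ?thesis using that by (auto simp: radical_def)
  qed
  show ?thesis
  proof (rule idealI[OF ring_axioms])
    show "subgroup (radical R I) (add_monoid R)"
    proof (rule subgroup.intro)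
      fix a b assume ab: "a \<in> radical R I" "b \<in> radical R I"
      then obtain m n :: nat where *: "a \<in> carrier R" "b \<in> carrier R" "a [^] m \<in> I" "b [^] n \<in> I"
        by (auto simp: radical_def)
      \<comment> \<open>Every term of the expanded power has \<open>m\<close> factors \<open>a\<close> or \<open>n\<close> factors \<open>b\<close>.\<close>
      have "x \<otimes> (a \<oplus> b) [^] k \<in> I"
        if "x = a [^] i \<otimes> b [^] j" "i + j + k = m + n" for x and i j k :: nat
        using that
      proof (induction k arbitrary: x i j)
        case 0
        then have "m \<le> i \<or> n \<le> j" by auto
        then have "a [^] i \<otimes> b [^] j \<in> I"
          using pw * I.I_l_closed I.I_r_closed by (metis nat_pow_closed)
        then show ?case using 0 * by (simp add: I.Icarr)
      next
        case (Suc k)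
        have x: "x \<in> carrier R" using Suc.prems * by simp
        have e: "x \<otimes> (a \<oplus> b) [^] Suc k = (a \<otimes> x) \<otimes> (a \<oplus> b) [^] k \<oplus> (b \<otimes> x) \<otimes> (a \<oplus> b) [^] k"
          using * x by (simp add: l_distr r_distr m_ac)
        have "(a \<otimes> x) \<otimes> (a \<oplus> b) [^] k \<in> I"
          by (rule Suc.IH[of _ "Suc i" j]) (use Suc.prems * in \<open>auto simp: m_ac\<close>)
        moreover have "(b \<otimes> x) \<otimes> (a \<oplus> b) [^] k \<in> I"
          by (rule Suc.IH[of _ i "Suc j"]) (use Suc.prems * in \<open>auto simp: m_ac\<close>)
        ultimately show ?case using e I.a_closed by simp
      qed
      from this[of \<one> 0 0 "m + n"] show "a \<otimes>\<^bsub>add_monoid R\<^esub> b \<in> radical R I"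
        using * by (auto simp: radical_def)
    next
      show "\<one>\<^bsub>add_monoid R\<^esub> \<in> radical R I"
        using I.zero_closed by (auto simp: radical_def intro!: exI[of _ 1])
      show "inv\<^bsub>add_monoid R\<^esub> a \<in> radical R I" if "a \<in> radical R I" for a
      proof -
        have "a \<in> carrier R" using that by (simp add: radical_def)
        then show ?thesis
          unfolding a_inv_def[symmetric] using mult[of "\<ominus> \<one>" a] that by (simp add: l_minus)
      qed
    qed (auto simp: radical_def)
    show "x \<otimes> a \<in> radical R I" if "a \<in> radical R I" "x \<in> carrier R" for a x
      using mult that by blast
    then show "a \<otimes> x \<in> radical R I" if "a \<in> radical R I" "x \<in> carrier R" for a x
      using that m_comm[of a x] by (simp add: radical_def)
  qed
qed

lemma (in cring) prime_ideal_quotient: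
  assumes J: "ideal J R" and P: "primeideal P R" and JP: "J \<subseteq> P"
  shows "primeideal ((+>) J ` P) (R Quot J)"
    and "x \<in> carrier R \<Longrightarrow> J +> x \<in> (+>) J ` P \<longleftrightarrow> x \<in> P"
proof -
  interpret J: ideal J R by fact
  interpret P: primeideal P R by fact
  interpret h: ring_hom_ring R "R Quot J" "(+>) J" by (rule J.rcos_ring_hom_ring)
  have iff: "J +> x \<in> (+>) J ` P \<longleftrightarrow> x \<in> P" if x: "x \<in> carrier R" for x
  proof
    assume "J +> x \<in> (+>) J ` P"
    then obtain p where p: "p \<in> P" "J +> x = J +> p" by auto
    have "x \<in> J +> p" using p(2) x J.a_rcos_self by metis
    then obtain y where "y \<in> J" "x = y \<oplus> p" by (auto simp: a_r_coset_def r_coset_def)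
    then show "x \<in> P" using JP p by auto
  qed auto
  have car: "carrier (R Quot J) = (+>) J ` carrier R"
    by (auto simp: FactRing_def A_RCOSETS_def RCOSETS_def a_r_coset_def)
  show "primeideal ((+>) J ` P) (R Quot J)"
  proof (rule primeidealI)
    show "ideal ((+>) J ` P) (R Quot J)"
      by (rule ring_ideal_imp_quot_ideal[OF J P.is_ideal])
    show "cring (R Quot J)" by (rule J.quotient_is_cring[OF is_cring])
    have "J +> \<one> \<notin> (+>) J ` P"
      using iff[OF one_closed] P.one_imp_carrier P.I_notcarr by auto
    then show "carrier (R Quot J) \<noteq> (+>) J ` P" unfolding car using one_closed by blast
    fix a b assume ab: "a \<in> carrier (R Quot J)" "b \<in> carrier (R Quot J)"
      and "a \<otimes>\<^bsub>R Quot J\<^esub> b \<in> (+>) J ` P"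
    moreover from ab obtain x y where xy: "x \<in> carrier R" "y \<in> carrier R" "a = J +> x" "b = J +> y"
      unfolding car by auto
    ultimately have "J +> (x \<otimes> y) \<in> (+>) J ` P" by simp
    then have "x \<in> P \<or> y \<in> P" using iff[of "x \<otimes> y"] P.I_prime[of x y] xy by auto
    then show "a \<in> (+>) J ` P \<or> b \<in> (+>) J ` P" using xy by auto
  qed
  show "x \<in> carrier R \<Longrightarrow> J +> x \<in> (+>) J ` P \<longleftrightarrow> x \<in> P" by (rule iff)
qed

lemma krull_dim_quotient_ge:
  fixes R (structure)
  assumes R: "cring R" and J: "ideal J R" and P: "prime_chain R n P" and JP: "J \<subseteq> P 0"
  shows "ereal (real n) \<le> krull_dim (R Quot J)"
proof -
  interpret cring R by fact
  interpret J: ideal J R by fact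
  have prime: "primeideal (P k) R" if "k \<le> n" for k using P that by (simp add: prime_chain_def)
  have step: "P k \<subset> P (Suc k)" if "k < n" for k using P that by (simp add: prime_chain_def)
  have sub: "J \<subseteq> P k" if "k \<le> n" for k
    using that
  proof (induction k)
    case (Suc k)
    then show ?case using step[of k] by auto
  qed (rule JP)
  note q = prime_ideal_quotient[OF J prime sub]
  let ?h = "(+>) J"
  have "prime_chain (R Quot J) n (\<lambda>k. ?h ` P k)"
    unfolding prime_chain_def
  proof (intro conjI allI impI)
    fix k assume k: "k < n"
    then obtain x where x: "x \<in> P (Suc k)" "x \<notin> P k" using step by blast
    then have "x \<in> carrier R" using prime[of "Suc k"] k primeideal_subset by fastforce
    then have "?h x \<in> ?h ` P (Suc k)" "?h x \<notin> ?h ` P k"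
      using x q(2)[of k x] q(2)[of "Suc k" x] k by auto
    then show "?h ` P k \<subset> ?h ` P (Suc k)" using step[OF k] by blast
  qed (use q(1) in auto)
  moreover have "carrier (R Quot J) \<noteq> {\<zero>\<^bsub>R Quot J\<^esub>}"
    using primeideal.I_notcarr[OF q(1)[of 0]] ideal.Icarr[OF primeideal.axioms(1)[OF q(1)[of 0]]]
      additive_subgroup.zero_closed[OF ideal.axioms(1)[OF primeideal.axioms(1)[OF q(1)[of 0]]]]
    by auto
  ultimately show ?thesis
    unfolding krull_dim_def by (auto intro!: SUP_upper)
qed

section \<open>Substitution homomorphisms\<close>

text \<open>
  Polynomials in the variables with index in \<open>B\<close>. Besides \<open>B = {..<d}\<close>, subsets of these
  variables occur as coordinates on quotients of \<open>V*\<close>.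
\<close>

definition mpolys_on :: "nat set \<Rightarrow> 'k::comm_ring_1 mpoly set" where
  "mpolys_on B = {p. \<forall>m \<in> Poly_Mapping.keys p. Poly_Mapping.keys m \<subseteq> B}"

lemma mpolys_eq: "mpolys d = mpolys_on {..<d}"
  by (simp add: mpolys_def mpolys_on_def)

lemma mconst_hom: "comm_ring_hom (mconst :: 'k::comm_ring_1 \<Rightarrow> 'k mpoly)"
  by unfold_locales (auto simp: mconst_def single_add mult_single single_one)

interpretation mconst: comm_ring_hom mconst by (rule mconst_hom)

lemma comm_ring_hom_id: "comm_ring_hom (\<lambda>x. x)"
  by unfold_locales auto

lemma comm_ring_hom_comp:
  assumes "comm_ring_hom f" and "comm_ring_hom g"
  shows "comm_ring_hom (\<lambda>x. g (f x))"
proof -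
  interpret f: comm_ring_hom f by fact
  interpret g: comm_ring_hom g by fact
  show ?thesis
    by unfold_locales (simp_all add: f.hom_add f.hom_mult f.hom_one g.hom_add g.hom_mult g.hom_one)
qed

definition monomial_value :: "(nat \<Rightarrow> 'r::comm_ring_1) \<Rightarrow> (nat \<Rightarrow>\<^sub>0 nat) \<Rightarrow> 'r" where
  "monomial_value y m = (\<Prod>i\<in>Poly_Mapping.keys m. y i ^ Poly_Mapping.lookup m i)"

lemma monomial_value_superset:
  "finite A \<Longrightarrow> Poly_Mapping.keys m \<subseteq> A \<Longrightarrow> monomial_value y m = (\<Prod>i\<in>A. y i ^ Poly_Mapping.lookup m i)"
  unfolding monomial_value_def by (intro prod.mono_neutral_left) (auto simp: in_keys_iff)

lemma monomial_value_0 [simp]: "monomial_value y 0 = 1"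
  by (simp add: monomial_value_def)

lemma monomial_value_single [simp]: "monomial_value y (Poly_Mapping.single i n) = y i ^ n"
  by (cases "n = 0") (auto simp: monomial_value_def)

lemma monomial_value_add: "monomial_value y (m + n) = monomial_value y m * monomial_value y n"
proof -
  let ?A = "Poly_Mapping.keys m \<union> Poly_Mapping.keys n"
  have "monomial_value y (m + n) = (\<Prod>i\<in>?A. y i ^ Poly_Mapping.lookup (m + n) i)"
    by (rule monomial_value_superset) (auto dest: subsetD[OF Poly_Mapping.keys_add])
  also have "\<dots> = (\<Prod>i\<in>?A. y i ^ Poly_Mapping.lookup m i) * (\<Prod>i\<in>?A. y i ^ Poly_Mapping.lookup n i)"
    by (simp add: lookup_add power_add prod.distrib)
  also have "\<dots> = monomial_value y m * monomial_value y n"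
    using monomial_value_superset[of ?A m y] monomial_value_superset[of ?A n y] by simp
  finally show ?thesis .
qed

definition mpoly_eval :: "('k::comm_ring_1 \<Rightarrow> 'r::comm_ring_1) \<Rightarrow> (nat \<Rightarrow> 'r) \<Rightarrow> 'k mpoly \<Rightarrow> 'r" where
  "mpoly_eval h y p = (\<Sum>m\<in>Poly_Mapping.keys p. h (Poly_Mapping.lookup p m) * monomial_value y m)"

lemma mpoly_sum_singles:
  "p = (\<Sum>m\<in>Poly_Mapping.keys p. Poly_Mapping.single m (Poly_Mapping.lookup p m))"
  by (rule poly_mapping_eqI) (auto simp: lookup_sum lookup_single when_def in_keys_iff)

lemma mpoly_induct [case_names single add]:
  assumes "\<And>m c. P (Poly_Mapping.single m c)" and "\<And>p q. P p \<Longrightarrow> P q \<Longrightarrow> P (p + q)"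
  shows "P (p :: 'k::comm_ring_1 mpoly)"
proof -
  have "P (\<Sum>m\<in>A. Poly_Mapping.single m (f m))" if "finite A" for A and f :: "_ \<Rightarrow> 'k"
    using that
  proof (induction rule: finite_induct)
    case empty
    then show ?case using assms(1)[of 0 0] by simp
  qed (use assms in auto)
  then show ?thesis by (subst mpoly_sum_singles) simp
qed

context
  fixes h :: "'k::comm_ring_1 \<Rightarrow> 'r::comm_ring_1" and y :: "nat \<Rightarrow> 'r"
  assumes h: "comm_ring_hom h"
begin

interpretation h: comm_ring_hom h by (rule h)

lemma mpoly_eval_superset:
  "finite A \<Longrightarrow> Poly_Mapping.keys p \<subseteq> A \<Longrightarrow> mpoly_eval h y p = (\<Sum>m\<in>A. h (Poly_Mapping.lookup p m) * monomial_value y m)"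
  unfolding mpoly_eval_def by (intro sum.mono_neutral_left) (auto simp: in_keys_iff)

lemma mpoly_eval_single [simp]: "mpoly_eval h y (Poly_Mapping.single m c) = h c * monomial_value y m"
  by (subst mpoly_eval_superset[of "{m}"]) auto

lemma mpoly_eval_add: "mpoly_eval h y (p + q) = mpoly_eval h y p + mpoly_eval h y q"
proof -
  let ?A = "Poly_Mapping.keys p \<union> Poly_Mapping.keys q"
  have "mpoly_eval h y (p + q) = (\<Sum>m\<in>?A. h (Poly_Mapping.lookup (p + q) m) * monomial_value y m)"
    by (rule mpoly_eval_superset) (auto dest: subsetD[OF Poly_Mapping.keys_add])
  also have "\<dots> = mpoly_eval h y p + mpoly_eval h y q"
    by (subst (1 2) mpoly_eval_superset[of ?A]) (auto simp: lookup_add h.hom_add distrib_right sum.distrib)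
  finally show ?thesis .
qed

lemma mpoly_eval_hom: "comm_ring_hom (mpoly_eval h y)"
proof unfold_locales
  show "mpoly_eval h y 0 = 0" by (simp add: mpoly_eval_def)
  show "mpoly_eval h y 1 = 1" using mpoly_eval_single[of 0 1] by (simp add: single_one)
  show "mpoly_eval h y (p + q) = mpoly_eval h y p + mpoly_eval h y q" for p q by (rule mpoly_eval_add)
  show "mpoly_eval h y (p * q) = mpoly_eval h y p * mpoly_eval h y q" for p q
  proof (induction p rule: mpoly_induct)
    case (single m c)
    show ?case
    proof (induction q rule: mpoly_induct)
      case (single n c')
      then show ?case by (simp add: mult_single h.hom_mult monomial_value_add)
    qed (simp add: distrib_left mpoly_eval_add)
  qed (simp add: distrib_right mpoly_eval_add)
qed

lemma mpoly_eval_mconst [simp]: "mpoly_eval h y (mconst c) = h c"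
  by (simp add: mconst_def)

lemma mpoly_eval_mvar [simp]: "mpoly_eval h y (mvar i) = y i"
  by (simp add: mvar_def)

end

lemma monomial_value_mvar: "monomial_value mvar m = Poly_Mapping.single m (1 :: 'k::comm_ring_1)"
proof -
  have pw: "mvar i ^ n = Poly_Mapping.single (Poly_Mapping.single i n) (1 :: 'k)" for i n
    by (induction n) (auto simp: mvar_def mult_single single_one single_add[symmetric])
  have "(\<Prod>i\<in>A. Poly_Mapping.single (f i) 1) = Poly_Mapping.single (\<Sum>i\<in>A. f i) (1 :: 'k)"
    for A and f :: "nat \<Rightarrow> nat \<Rightarrow>\<^sub>0 nat"
    by (induction A rule: infinite_finite_induct) (auto simp: single_one mult_single)
  moreover have "m = (\<Sum>i\<in>Poly_Mapping.keys m. Poly_Mapping.single i (Poly_Mapping.lookup m i))"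
    by (rule poly_mapping_eqI) (auto simp: lookup_sum lookup_single when_def in_keys_iff)
  ultimately show ?thesis by (simp add: monomial_value_def pw)
qed

lemma single_eq: "Poly_Mapping.single m c = mconst c * monomial_value mvar m"
  by (simp add: monomial_value_mvar mconst_def mult_single)

lemma mpoly_decompose:
  "p = (\<Sum>m\<in>Poly_Mapping.keys p. mconst (Poly_Mapping.lookup p m) * monomial_value mvar m)"
  unfolding single_eq[symmetric] by (rule mpoly_sum_singles)

lemma hom_eqI:
  assumes f: "comm_ring_hom f" and g: "comm_ring_hom g"
    and c: "\<And>c. f (mconst c) = g (mconst c)" and v: "\<And>i. i \<in> B \<Longrightarrow> f (mvar i) = g (mvar i)"
    and p: "p \<in> mpolys_on B"
  shows "f p = g p"
proof -
  interpret f: comm_ring_hom f by (rule f)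
  interpret g: comm_ring_hom g by (rule g)
  have "f (monomial_value mvar m) = g (monomial_value mvar m)" if "m \<in> Poly_Mapping.keys p" for m
    using that p v by (auto simp: monomial_value_def f.hom_prod g.hom_prod f.hom_power g.hom_power
        mpolys_on_def subset_iff intro!: prod.cong)
  then show ?thesis
    by (subst (1 2) mpoly_decompose) (simp add: f.hom_sum g.hom_sum f.hom_mult g.hom_mult c)
qed

lemma mpolys_on_UNIV [simp]: "mpolys_on UNIV = UNIV"
  by (auto simp: mpolys_on_def)

definition closed_under_ring_ops :: "'r::comm_ring_1 set \<Rightarrow> bool" where
  "closed_under_ring_ops X \<longleftrightarrow> 0 \<in> X \<and> 1 \<in> X \<and> (\<forall>a\<in>X. \<forall>b\<in>X. a + b \<in> X \<and> a * b \<in> X)"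

lemma closed_under_ring_ops_sum:
  "closed_under_ring_ops X \<Longrightarrow> (\<And>i. i \<in> A \<Longrightarrow> f i \<in> X) \<Longrightarrow> sum f A \<in> X"
  by (induction A rule: infinite_finite_induct) (auto simp: closed_under_ring_ops_def)

lemma closed_under_ring_ops_prod:
  "closed_under_ring_ops X \<Longrightarrow> (\<And>i. i \<in> A \<Longrightarrow> f i \<in> X) \<Longrightarrow> prod f A \<in> X"
  by (induction A rule: infinite_finite_induct) (auto simp: closed_under_ring_ops_def)

lemma closed_under_ring_ops_power:
  "closed_under_ring_ops X \<Longrightarrow> a \<in> X \<Longrightarrow> a ^ n \<in> X"
  by (induction n) (auto simp: closed_under_ring_ops_def)

lemma hom_mpolys_on:
  assumes f: "comm_ring_hom f" and X: "closed_under_ring_ops X"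
    and c: "\<And>c. f (mconst c) \<in> X" and v: "\<And>i. i \<in> B \<Longrightarrow> f (mvar i) \<in> X"
    and p: "p \<in> mpolys_on B"
  shows "f p \<in> X"
proof -
  interpret f: comm_ring_hom f by (rule f)
  have mult: "a * b \<in> X" if "a \<in> X" "b \<in> X" for a b
    using that X by (simp add: closed_under_ring_ops_def)
  have "f (monomial_value mvar m) \<in> X" if "m \<in> Poly_Mapping.keys p" for m
    using that p v by (auto simp: monomial_value_def f.hom_prod f.hom_power mpolys_on_def subset_iff
        intro!: closed_under_ring_ops_prod[OF X] closed_under_ring_ops_power[OF X])
  then show ?thesis
    by (subst mpoly_decompose)
      (auto simp: f.hom_sum f.hom_mult intro!: closed_under_ring_ops_sum[OF X] mult c)
qed

lemma mpolys_on_closed: "closed_under_ring_ops (mpolys_on B)"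
  unfolding closed_under_ring_ops_def
proof (intro conjI ballI)
  fix a b :: "'a mpoly" assume ab: "a \<in> mpolys_on B" "b \<in> mpolys_on B"
  then show "a + b \<in> mpolys_on B"
    using Poly_Mapping.keys_add[of a b] by (auto simp: mpolys_on_def)
  show "a * b \<in> mpolys_on B"
    unfolding mpolys_on_def
  proof (intro CollectI ballI)
    fix m assume "m \<in> Poly_Mapping.keys (a * b)"
    then obtain u v where "u \<in> Poly_Mapping.keys a" "v \<in> Poly_Mapping.keys b" "m = u + v"
      using Poly_Mapping.keys_mult[of a b] by blast
    then show "Poly_Mapping.keys m \<subseteq> B"
      using ab Poly_Mapping.keys_add[of u v] unfolding mpolys_on_def by blast
  qed
qed (auto simp: mpolys_on_def)

lemma mconst_in [simp]: "mconst c \<in> mpolys_on B"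
  by (auto simp: mconst_def mpolys_on_def)

lemma mvar_in [simp]: "i \<in> B \<Longrightarrow> mvar i \<in> mpolys_on B"
  by (auto simp: mvar_def mpolys_on_def split: if_splits)

lemma mpolys_on_ops:
  fixes a b :: "'k::comm_ring_1 mpoly" and f :: "'i \<Rightarrow> 'k mpoly"
  shows "(0 :: 'k mpoly) \<in> mpolys_on B" "(1 :: 'k mpoly) \<in> mpolys_on B"
    and "a \<in> mpolys_on B \<Longrightarrow> b \<in> mpolys_on B \<Longrightarrow> a + b \<in> mpolys_on B"
    and "a \<in> mpolys_on B \<Longrightarrow> b \<in> mpolys_on B \<Longrightarrow> a * b \<in> mpolys_on B"
    and "a \<in> mpolys_on B \<Longrightarrow> b \<in> mpolys_on B \<Longrightarrow> a - b \<in> mpolys_on B"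
    and "a \<in> mpolys_on B \<Longrightarrow> - a \<in> mpolys_on B"
    and "a \<in> mpolys_on B \<Longrightarrow> a ^ n \<in> mpolys_on B"
    and "(\<And>i. i \<in> A \<Longrightarrow> f i \<in> mpolys_on B) \<Longrightarrow> sum f A \<in> mpolys_on B"
    and "(\<And>i. i \<in> A \<Longrightarrow> f i \<in> mpolys_on B) \<Longrightarrow> prod f A \<in> mpolys_on B"
proof -
  have X: "u + v \<in> mpolys_on B" "u * v \<in> mpolys_on B"
    if "u \<in> mpolys_on B" "v \<in> mpolys_on B" for u v :: "'k mpoly"
    using mpolys_on_closed[of B, where 'a = 'k] that by (simp_all add: closed_under_ring_ops_def)
  show "(0 :: 'k mpoly) \<in> mpolys_on B" "(1 :: 'k mpoly) \<in> mpolys_on B"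
    using mpolys_on_closed[of B, where 'a = 'k] by (simp_all add: closed_under_ring_ops_def)
  show "a + b \<in> mpolys_on B" if "a \<in> mpolys_on B" "b \<in> mpolys_on B"
    using X that by simp
  show "a * b \<in> mpolys_on B" if "a \<in> mpolys_on B" "b \<in> mpolys_on B"
    using X that by simp
  have neg: "- u \<in> mpolys_on B" if "u \<in> mpolys_on B" for u :: "'k mpoly"
    using X(2)[OF mconst_in that, of "- 1"] by (simp add: mconst.hom_uminus)
  show "- a \<in> mpolys_on B" if "a \<in> mpolys_on B" by (rule neg[OF that])
  show "a - b \<in> mpolys_on B" if "a \<in> mpolys_on B" "b \<in> mpolys_on B"
    using X(1)[OF that(1) neg[OF that(2)]] by simp
  show "a ^ n \<in> mpolys_on B" if "a \<in> mpolys_on B"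
    using mpolys_on_closed that by (rule closed_under_ring_ops_power)
  show "sum f A \<in> mpolys_on B" if "\<And>i. i \<in> A \<Longrightarrow> f i \<in> mpolys_on B"
    using mpolys_on_closed that by (rule closed_under_ring_ops_sum)
  show "prod f A \<in> mpolys_on B" if "\<And>i. i \<in> A \<Longrightarrow> f i \<in> mpolys_on B"
    using mpolys_on_closed that by (rule closed_under_ring_ops_prod)
qed

lemma coeffs_closed:
  "closed_under_ring_ops {P :: 'k::comm_ring_1 mpoly poly. \<forall>n. coeff P n \<in> mpolys_on B}"
  unfolding closed_under_ring_ops_def
  by (auto simp: coeff_mult mpolys_on_ops one_pCons coeff_pCons split: nat.split
      intro!: mpolys_on_ops(8) mpolys_on_ops(4))

section \<open>Finite fields\<close>

lemma finite_field_power_card: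
  fixes c :: "'k::{finite,field}"
  shows "c ^ CARD('k) = c"
proof (cases "c = 0")
  case False
  have card: "CARD('k) = Suc (card (UNIV - {0 :: 'k}))"
    by (simp add: card_Suc_Diff1)
  have "(\<Prod>x\<in>UNIV - {0}. x) = (\<Prod>x\<in>UNIV - {0}. c * x)"
    by (rule prod.reindex_bij_witness[of _ "\<lambda>x. c * x" "\<lambda>x. x / c"]) (use False in auto)
  also have "\<dots> = c ^ card (UNIV - {0 :: 'k}) * (\<Prod>x\<in>UNIV - {0}. x)"
    by (simp add: prod.distrib)
  finally have "c ^ card (UNIV - {0 :: 'k}) = 1"
    by simp
  then show ?thesis by (simp only: card power_Suc mult_1_right)
qed (simp add: power_0_left)

lemma card_field_gt_1: "CARD('k::{finite,field}) > 1"
proof -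
  have "card {0, 1 :: 'k} \<le> CARD('k)" by (rule card_mono) auto
  then show ?thesis by simp
qed

lemma finite_field_binomial:
  assumes "0 < i" "i < CARD('k::{finite,field})"
  shows "of_nat (CARD('k) choose i) = (0 :: 'k)"
proof -
  let ?q = "CARD('k)"
  \<comment> \<open>\<open>(X + 1)^q - X^q - 1\<close> has degree less than \<open>q\<close> and vanishes on the whole field.\<close>
  define P :: "'k poly" where "P = (\<Sum>j\<in>{0<..<?q}. monom (of_nat (?q choose j)) j)"
  have "poly P x = 0" for x
  proof -
    have "(x + 1) ^ ?q = (\<Sum>j\<le>?q. of_nat (?q choose j) * x ^ j)"
      by (simp add: binomial_ring)
    also have "{..?q} = insert 0 (insert ?q {0<..<?q})" using card_field_gt_1[where 'k = 'k] by auto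
    also have "(\<Sum>j\<in>\<dots>. of_nat (?q choose j) * x ^ j) = 1 + x ^ ?q + poly P x"
      using card_field_gt_1[where 'k = 'k] by (simp add: P_def poly_sum poly_monom add_ac)
    finally show ?thesis by (simp add: finite_field_power_card)
  qed
  moreover have "degree P < ?q"
    unfolding P_def using card_field_gt_1[where 'k = 'k]
    by (intro degree_sum_less) (auto intro: le_less_trans[OF degree_monom_le])
  ultimately have "P = 0"
    using card_poly_roots_bound[of P] by (cases "P = 0") auto
  then have "coeff P i = 0" by simp
  then show ?thesis
    using assms by (simp add: P_def coeff_sum if_distrib cong: if_cong)
qed

lemma mpoly_frobenius_add:
  fixes a b :: "'k::{finite,field} mpoly"
  shows "(a + b) ^ (CARD('k) ^ j) = a ^ (CARD('k) ^ j) + b ^ (CARD('k) ^ j)"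
proof (induction j)
  case (Suc j)
  let ?q = "CARD('k)"
  have "(x + y) ^ ?q = x ^ ?q + y ^ ?q" for x y :: "'k mpoly"
  proof -
    have "(x + y) ^ ?q = (\<Sum>j\<le>?q. of_nat (?q choose j) * x ^ j * y ^ (?q - j))"
      by (simp add: binomial_ring)
    also have "{..?q} = insert 0 (insert ?q {0<..<?q})" using card_field_gt_1[where 'k = 'k] by auto
    also have "(\<Sum>j\<in>\<dots>. of_nat (?q choose j) * x ^ j * y ^ (?q - j)) =
        y ^ ?q + (x ^ ?q + (\<Sum>j\<in>{0<..<?q}. of_nat (?q choose j) * x ^ j * y ^ (?q - j)))"
      using card_field_gt_1[where 'k = 'k] by simp
    also have "(\<Sum>j\<in>{0<..<?q}. of_nat (?q choose j) * x ^ j * y ^ (?q - j)) = 0"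
    proof (intro sum.neutral ballI)
      fix j assume "j \<in> {0<..<?q}"
      then have "of_nat (?q choose j) = (0 :: 'k mpoly)"
        using finite_field_binomial[of j, where 'k = 'k]
        by (metis greaterThanLessThan_iff mconst.hom_of_nat mconst.hom_zero)
      then show "of_nat (?q choose j) * x ^ j * y ^ (?q - j) = 0" by simp
    qed
    finally show ?thesis by (simp add: add_ac)
  qed
  then show ?case by (simp add: Suc power_mult mult.commute[of _ "?q ^ j"])
qed simp

lemma mpoly_frobenius_sum:
  fixes f :: "'b \<Rightarrow> 'k::{finite,field} mpoly"
  shows "(\<Sum>i\<in>A. f i) ^ (CARD('k) ^ j) = (\<Sum>i\<in>A. f i ^ (CARD('k) ^ j))"
  by (induction A rule: infinite_finite_induct) (auto simp: mpoly_frobenius_add power_0_left)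

lemma mpoly_frobenius_diff:
  fixes a b :: "'k::{finite,field} mpoly"
  shows "(a - b) ^ (CARD('k) ^ j) = a ^ (CARD('k) ^ j) - b ^ (CARD('k) ^ j)"
  using mpoly_frobenius_add[of "a - b" b j] by simp

lemma mconst_frobenius:
  fixes c :: "'k::{finite,field}"
  shows "mconst c ^ (CARD('k) ^ j) = mconst c"
proof -
  have "c ^ (CARD('k) ^ j) = c"
    by (induction j) (simp_all add: power_mult finite_field_power_card)
  then show ?thesis by (simp add: mconst.hom_power[symmetric])
qed

text \<open>
  As polynomials in \<open>z\<close> both sides are monic of degree \<open>q\<close>, with the \<open>q\<close> roots \<open>c y\<close>.
\<close>

lemma mpoly_frobenius_factor:
  fixes z y :: "'k::{finite,field} mpoly"
  shows "z ^ CARD('k) - y ^ (CARD('k) - 1) * z = (\<Prod>c\<in>UNIV. z - mconst c * y)"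
proof (cases "y = 0")
  case True
  then show ?thesis using card_field_gt_1[where 'k = 'k] by (simp add: power_0_left)
next
  case False
  let ?q = "CARD('k)"
  define W where "W = (\<Prod>c\<in>UNIV. [:- (mconst (c :: 'k) * y), 1:])"
  define P where "P = monom 1 ?q - monom (y ^ (?q - 1)) 1 - W"
  have W1: "lead_coeff W = 1"
    unfolding W_def lead_coeff_prod by simp
  have W: "degree W = ?q"
    by (simp add: W_def degree_prod_eq_sum_degree)
  have root: "poly P (mconst c * y) = 0" for c
  proof -
    have "poly W (mconst c * y) = 0" by (auto simp: W_def poly_prod)
    moreover have "y ^ ?q = y ^ (?q - 1) * y"
      using card_field_gt_1[where 'k = 'k] by (simp add: power_eq_if)
    ultimately show ?thesis
      using mconst_frobenius[of c 1] by (simp add: P_def poly_monom power_mult_distrib mult_ac)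
  qed
  have "P = 0"
  proof (rule ccontr)
    assume P0: "P \<noteq> 0"
    have "inj (\<lambda>c. mconst (c :: 'k) * y)"
      using False by (auto simp: inj_on_def mconst_def) (metis lookup_single_eq)
    then have "?q = card (range (\<lambda>c. mconst (c :: 'k) * y))"
      by (simp add: card_image)
    also have "\<dots> \<le> card {x. poly P x = 0}"
      using root P0 by (intro card_mono poly_roots_finite) auto
    also have "\<dots> \<le> degree P" by (rule card_poly_roots_bound[OF P0])
    finally have "?q \<le> degree P" .
    moreover have "degree P \<le> ?q"
      unfolding P_def using W card_field_gt_1[where 'k = 'k]
      by (intro degree_diff_le) (auto intro: order_trans[OF degree_monom_le])
    moreover have "coeff P ?q = 0"
      using W W1 card_field_gt_1[where 'k = 'k] by (simp add: P_def)
    ultimately show False using P0 by (metis le_antisym leading_coeff_0_iff)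
  qed
  then have "poly P z = 0" by simp
  then show ?thesis by (simp add: P_def W_def poly_monom poly_prod)
qed

section \<open>Taylor expansion along a vector field\<close>

text \<open>\<open>p(x + y \<xi>)\<close> as a polynomial in \<open>\<xi>\<close>.\<close>

definition taylor :: "(nat \<Rightarrow> 'k::comm_ring_1 mpoly) \<Rightarrow> 'k mpoly \<Rightarrow> 'k mpoly poly" where
  "taylor y = mpoly_eval (\<lambda>c. [:mconst c:]) (\<lambda>i. [:mvar i, y i:])"

lemma const_poly_hom: "comm_ring_hom (\<lambda>c :: 'k::comm_ring_1. [:mconst c:])"
  by unfold_locales (auto simp: mconst.hom_add mconst.hom_mult one_pCons)

lemma taylor_hom: "comm_ring_hom (taylor y)"
  unfolding taylor_def by (rule mpoly_eval_hom[OF const_poly_hom])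

interpretation taylor: comm_ring_hom "taylor y" for y by (rule taylor_hom)

lemma taylor_mconst [simp]: "taylor y (mconst c) = [:mconst c:]"
  and taylor_mvar [simp]: "taylor y (mvar i) = [:mvar i, y i:]"
  unfolding taylor_def using mpoly_eval_mconst[OF const_poly_hom] mpoly_eval_mvar[OF const_poly_hom] by blast+

lemma coeff_taylor_0 [simp]: "coeff (taylor y p) 0 = p"
proof (rule hom_eqI[where f = "\<lambda>p. coeff (taylor y p) 0" and g = "\<lambda>p. p" and B = UNIV])
  show "comm_ring_hom (\<lambda>p. coeff (taylor y p) 0)"
    by unfold_locales (auto simp: taylor.hom_add taylor.hom_mult coeff_mult)
qed (auto intro: comm_ring_hom_id)

lemma coeff_taylor_in:
  assumes y: "\<And>i. i \<in> B \<Longrightarrow> y i \<in> mpolys_on B" and p: "p \<in> mpolys_on B"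
  shows "coeff (taylor y p) n \<in> mpolys_on B"
proof -
  let ?X = "{P :: 'a mpoly poly. \<forall>n. coeff P n \<in> mpolys_on B}"
  have "taylor y p \<in> ?X"
    by (rule hom_mpolys_on[OF taylor_hom coeffs_closed _ _ p])
      (auto simp: coeff_pCons mpolys_on_ops y split: nat.split)
  then show ?thesis by simp
qed

definition partial_deriv :: "nat \<Rightarrow> 'k::comm_ring_1 mpoly \<Rightarrow> 'k mpoly" where
  "partial_deriv b p = coeff (taylor (\<lambda>i. if i = b then 1 else 0) p) 1"

lemma coeff_taylor_1_mult:
  "coeff (taylor y (p * q)) (Suc 0) = p * coeff (taylor y q) (Suc 0) + coeff (taylor y p) (Suc 0) * q"
  by (simp add: taylor.hom_mult coeff_mult)

lemma coeff_taylor_1_mvar_power: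
  "coeff (taylor y (mvar i ^ n)) (Suc 0) = of_nat n * mvar i ^ (n - 1) * y i"
proof (induction n)
  case (Suc n)
  then show ?case
    by (cases n) (simp_all add: coeff_taylor_1_mult algebra_simps)
qed (simp add: taylor.hom_one)

lemma partial_deriv_mult: "partial_deriv b (p * q) = p * partial_deriv b q + partial_deriv b p * q"
  by (simp add: partial_deriv_def coeff_taylor_1_mult)

lemma partial_deriv_mvar_power:
  "partial_deriv b (mvar i ^ n) = of_nat n * mvar i ^ (n - 1) * (if i = b then 1 else 0)"
  by (simp add: partial_deriv_def coeff_taylor_1_mvar_power)

lemma partial_deriv_other: "b \<notin> A \<Longrightarrow> partial_deriv b (\<Prod>i\<in>A. mvar i ^ n i) = 0"
proof (induction A rule: infinite_finite_induct)
  case (insert a A)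
  then show ?case by (auto simp: partial_deriv_mult partial_deriv_mvar_power)
qed (auto simp: partial_deriv_def taylor.hom_one)

lemma coeff_taylor_1_monomial_value:
  "coeff (taylor y (\<Prod>i\<in>A. mvar i ^ n i)) (Suc 0) =
     (\<Sum>b\<in>A. y b * partial_deriv b (\<Prod>i\<in>A. mvar i ^ n i))"
proof (induction A rule: infinite_finite_induct)
  case (insert a A)
  let ?P = "\<Prod>i\<in>A. mvar i ^ n i"
  have 1: "partial_deriv b (mvar a ^ n a * ?P) = mvar a ^ n a * partial_deriv b ?P" if "b \<in> A" for b
    using insert that by (auto simp: partial_deriv_mult partial_deriv_mvar_power)
  have "coeff (taylor y (mvar a ^ n a * ?P)) (Suc 0)
      = mvar a ^ n a * (\<Sum>b\<in>A. y b * partial_deriv b ?P) + of_nat (n a) * mvar a ^ (n a - 1) * y a * ?P"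
    by (simp add: coeff_taylor_1_mult insert.IH coeff_taylor_1_mvar_power)
  also have "mvar a ^ n a * (\<Sum>b\<in>A. y b * partial_deriv b ?P)
      = (\<Sum>b\<in>A. y b * partial_deriv b (mvar a ^ n a * ?P))"
    by (simp add: 1 sum_distrib_left mult.left_commute)
  also have "of_nat (n a) * mvar a ^ (n a - 1) * y a * ?P = y a * partial_deriv a (mvar a ^ n a * ?P)"
    using insert by (simp add: partial_deriv_mult partial_deriv_mvar_power partial_deriv_other mult_ac)
  finally show ?case using insert by (simp add: add.commute)
qed (auto simp: taylor.hom_one)

text \<open>
  The chain rule: the part linear in \<open>\<xi>\<close> is the derivative along the vector field \<open>y\<close>.
\<close>

lemma coeff_taylor_1:
  assumes B: "finite B" and p: "p \<in> mpolys_on B"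
  shows "coeff (taylor y p) 1 = (\<Sum>b\<in>B. y b * partial_deriv b p)"
proof -
  have m: "coeff (taylor y (monomial_value mvar m)) (Suc 0) = (\<Sum>b\<in>B. y b * partial_deriv b (monomial_value mvar m))"
    if "m \<in> Poly_Mapping.keys p" for m
  proof -
    have "Poly_Mapping.keys m \<subseteq> B" using that p by (auto simp: mpolys_on_def)
    then show ?thesis using B by (simp add: monomial_value_superset coeff_taylor_1_monomial_value)
  qed
  have s: "coeff (taylor z p) (Suc 0) =
      (\<Sum>m\<in>Poly_Mapping.keys p. mconst (Poly_Mapping.lookup p m) * coeff (taylor z (monomial_value mvar m)) (Suc 0))" for z
    by (subst mpoly_decompose) (simp add: taylor.hom_sum coeff_sum coeff_taylor_1_mult)
  have "coeff (taylor y p) 1 = (\<Sum>m\<in>Poly_Mapping.keys p. \<Sum>b\<in>B.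
      y b * (mconst (Poly_Mapping.lookup p m) * partial_deriv b (monomial_value mvar m)))"
    by (simp add: s m sum_distrib_left mult.left_commute)
  also have "\<dots> = (\<Sum>b\<in>B. y b * partial_deriv b p)"
    by (subst sum.swap) (simp add: partial_deriv_def s sum_distrib_left)
  finally show ?thesis .
qed

lemma partial_deriv_single:
  "partial_deriv b (Poly_Mapping.single m c) =
     Poly_Mapping.single (m - Poly_Mapping.single b 1) (of_nat (Poly_Mapping.lookup m b) * c)"
proof -
  define n where "n = Poly_Mapping.lookup m b"
  define m' where "m' = m - Poly_Mapping.single b n"
  have m: "m = m' + Poly_Mapping.single b n"
    by (rule poly_mapping_eqI) (auto simp: m'_def n_def lookup_add lookup_minus lookup_single when_def)
  have b: "b \<notin> Poly_Mapping.keys m'"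
    by (simp add: in_keys_iff m'_def n_def lookup_minus)
  have 0: "coeff (taylor (\<lambda>i. if i = b then 1 else 0) (monomial_value mvar m' :: 'a mpoly)) (Suc 0) = 0"
  proof -
    have "partial_deriv b (monomial_value mvar m' :: 'a mpoly) = 0"
      using b unfolding monomial_value_def by (rule partial_deriv_other)
    then show ?thesis by (simp add: partial_deriv_def)
  qed
  have "partial_deriv b (Poly_Mapping.single m c) = mconst c * (monomial_value mvar m' * (of_nat n * mvar b ^ (n - 1)))"
    using 0 by (simp add: single_eq m monomial_value_add partial_deriv_def coeff_taylor_1_mult coeff_taylor_1_mvar_power)
  also have "\<dots> = mconst (of_nat n * c) * monomial_value mvar (m' + Poly_Mapping.single b (n - 1))"
    by (simp add: monomial_value_add mconst.hom_mult mconst.hom_of_nat mult_ac)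
  also have "\<dots> = Poly_Mapping.single (m - Poly_Mapping.single b 1) (of_nat n * c)"
  proof (cases n)
    case (Suc k)
    have "m' + Poly_Mapping.single b (n - 1) = m - Poly_Mapping.single b 1"
      using Suc by (intro poly_mapping_eqI) (auto simp: m lookup_add lookup_minus lookup_single when_def)
    then show ?thesis by (simp add: single_eq)
  qed (simp add: mconst.hom_zero)
  finally show ?thesis by (simp add: n_def)
qed

lemma lookup_partial_deriv:
  "Poly_Mapping.lookup (partial_deriv b p) m =
     of_nat (Suc (Poly_Mapping.lookup m b)) * Poly_Mapping.lookup p (m + Poly_Mapping.single b 1)"
proof (induction p rule: mpoly_induct)
  case (single m' c)
  let ?e = "Poly_Mapping.single b (1 :: nat)"
  show ?case
  proof (cases "Poly_Mapping.lookup m' b")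
    case 0
    then have "m' \<noteq> m + ?e" by (auto simp: lookup_add)
    then show ?thesis using 0 by (simp add: partial_deriv_single lookup_single)
  next
    case (Suc k)
    have "m' - ?e + ?e = m'"
      using Suc by (intro poly_mapping_eqI) (auto simp: lookup_add lookup_minus lookup_single when_def)
    then have "m' - ?e = m \<longleftrightarrow> m' = m + ?e"
      by (metis add_diff_cancel_right')
    then show ?thesis by (auto simp: partial_deriv_single lookup_single when_def lookup_add)
  qed
next
  case (add p q)
  then show ?case
    by (simp add: partial_deriv_def taylor.hom_add lookup_add distrib_left)
qed

section \<open>Prime ideals of the polynomial ring stable under the Steenrod operations\<close>

text \<open>
  The coefficients of \<open>taylor (power_field j)\<close> are the Steenrod-type operations \<open>P\<^sup>n\<close> attached to
  \<open>x \<mapsto> x + x\<^bsup>q^j\<^esup> \<xi>\<close>; those with \<open>j = 1\<close> are the reduced powers.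
\<close>

definition power_field :: "nat \<Rightarrow> nat \<Rightarrow> 'k::{finite,field} mpoly" where
  "power_field j i = mvar i ^ (CARD('k) ^ j)"

text \<open>
  A prime ideal of \<open>Sym V*\<close> that is stable under the derivations \<open>\<Sum>i. x\<^sub>i\<^bsup>q^j\<^esup> \<partial>\<^sub>i\<close>, which are the
  linear parts of the Steenrod operations.
\<close>

locale stable_prime =
  fixes d :: nat and Q :: "'k::{finite,field} mpoly set"
  assumes sub: "Q \<subseteq> mpolys d"
    and zero: "0 \<in> Q" and add: "a \<in> Q \<Longrightarrow> b \<in> Q \<Longrightarrow> a + b \<in> Q"
    and mult: "r \<in> mpolys d \<Longrightarrow> a \<in> Q \<Longrightarrow> r * a \<in> Q"
    and one: "1 \<notin> Q"
    and prime: "a \<in> mpolys d \<Longrightarrow> b \<in> mpolys d \<Longrightarrow> a * b \<in> Q \<Longrightarrow> a \<in> Q \<or> b \<in> Q"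
    and stable: "f \<in> Q \<Longrightarrow> coeff (taylor (power_field j) f) 1 \<in> Q"
begin

lemmas ring_closed =
  mpolys_on_ops(4,5,3,7)[of _ "{..<d}", folded mpolys_eq]
  mconst_in[of _ "{..<d}", folded mpolys_eq]
  mvar_in[of _ "{..<d}", unfolded lessThan_iff, folded mpolys_eq]
  mpolys_on_ops(8)[of _ _ "{..<d}", folded mpolys_eq]

lemma minus: "a \<in> Q \<Longrightarrow> - a \<in> Q"
  using mult[OF ring_closed(5), of a "- 1"] by (simp add: mconst.hom_uminus)

lemma diff: "a \<in> Q \<Longrightarrow> b \<in> Q \<Longrightarrow> a - b \<in> Q"
  using add[of a "- b"] minus by simp

lemma sum: "(\<And>i. i \<in> A \<Longrightarrow> f i \<in> Q) \<Longrightarrow> sum f A \<in> Q"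
  by (induction A rule: infinite_finite_induct) (auto intro: zero add)

lemma power: "a \<in> mpolys d \<Longrightarrow> a ^ n \<in> Q \<Longrightarrow> a \<in> Q"
  by (induction n) (use one prime ring_closed(4) in auto)

lemma prod_in: "finite A \<Longrightarrow> (\<And>i. i \<in> A \<Longrightarrow> f i \<in> mpolys d) \<Longrightarrow> prod f A \<in> Q \<Longrightarrow> \<exists>i\<in>A. f i \<in> Q"
proof (induction A rule: finite_induct)
  case (insert x F)
  have "prod f F \<in> mpolys d"
    unfolding mpolys_eq using insert.prems by (intro mpolys_on_ops) (auto simp: mpolys_eq)
  then show ?case using insert prime[of "f x" "prod f F"] by auto
qed (use one in auto)

lemma const: "mconst c \<in> Q \<Longrightarrow> c = 0"
proof (rule ccontr)
  assume "mconst c \<in> Q" "c \<noteq> 0"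
  then have "mconst (inverse c) * mconst c \<in> Q" using mult[OF ring_closed(5)] by blast
  then show False using \<open>c \<noteq> 0\<close> one by (simp add: mconst.hom_mult[symmetric] mconst.hom_one)
qed

definition indep :: "nat set \<Rightarrow> (nat \<Rightarrow> 'k mpoly) \<Rightarrow> bool" where
  "indep B y \<longleftrightarrow> (\<forall>c. (\<Sum>b\<in>B. mconst (c b) * y b) \<in> Q \<longrightarrow> (\<forall>b\<in>B. c b = 0))"

text \<open>
  The Moore matrix of elements that are linearly independent over the field with \<open>q\<close> elements
  modulo \<open>Q\<close> is invertible over the residue field. One step of Gaussian elimination replaces
  \<open>y b\<close> by \<open>\<Lambda>(y b)\<close>, where \<open>\<Lambda>(z) = z\<^sup>q - y\<^sub>0\<^bsup>q-1\<^esup> z\<close> is the additive polynomial whose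
  kernel is the line spanned by the pivot \<open>y\<^sub>0\<close>.
\<close>

lemma moore:
  assumes "finite B" and "\<And>b. b \<in> B \<Longrightarrow> y b \<in> mpolys d" and "\<And>b. b \<in> B \<Longrightarrow> g b \<in> mpolys d"
    and "indep B y" and "\<And>j. (\<Sum>b\<in>B. y b ^ (CARD('k) ^ j) * g b) \<in> Q"
  shows "\<forall>b\<in>B. g b \<in> Q"
  using assms
proof (induction B arbitrary: y rule: finite_induct)
  case (insert a B)
  let ?q = "CARD('k)"
  have q: "?q = Suc (?q - 1)" using card_field_gt_1[where 'k = 'k] by simp
  define y' where "y' b = y b ^ ?q - y a ^ (?q - 1) * y b" for b
  have y: "y b \<in> mpolys d" "g b \<in> mpolys d" if "b \<in> insert a B" for b
    using insert.prems that by auto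
  have y': "y' b \<in> mpolys d" if "b \<in> B" for b
    unfolding y'_def using y that by (intro ring_closed) auto
  have "\<forall>b\<in>B. g b \<in> Q"
  proof (rule insert.IH[where y = y'])
    show "indep B y'"
      unfolding indep_def
    proof (intro allI impI)
      fix c :: "nat \<Rightarrow> 'k"
      assume c: "(\<Sum>b\<in>B. mconst (c b) * y' b) \<in> Q"
      define z where "z = (\<Sum>b\<in>B. mconst (c b) * y b)"
      have z: "z \<in> mpolys d"
        unfolding z_def using y by (intro ring_closed) auto
      have "(\<Sum>b\<in>B. mconst (c b) * y' b) = z ^ ?q - y a ^ (?q - 1) * z"
        using mpoly_frobenius_sum[of "\<lambda>b. mconst (c b) * y b" B 1] mconst_frobenius[of _ 1, where 'k = 'k]
        by (simp add: z_def y'_def algebra_simps sum_subtractf sum_distrib_left power_mult_distrib)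
      then have "(\<Prod>e\<in>UNIV. z - mconst e * y a) \<in> Q"
        using c by (simp only: mpoly_frobenius_factor)
      then obtain e where e: "z - mconst e * y a \<in> Q"
        using prod_in[of UNIV "\<lambda>e. z - mconst e * y a"] z y by (auto intro: ring_closed)
      have "(\<Sum>b\<in>insert a B. mconst ((c(a := - e)) b) * y b) = z - mconst e * y a"
        using insert.hyps by (auto simp: z_def mconst.hom_uminus intro!: sum.cong)
      then have "\<forall>b\<in>insert a B. (c(a := - e)) b = 0"
        using insert.prems(3) e unfolding indep_def by metis
      then show "\<forall>b\<in>B. c b = 0" using insert.hyps by (metis fun_upd_other insertI2)
    qed
    show "(\<Sum>b\<in>B. y' b ^ (?q ^ j) * g b) \<in> Q" for j
    proof -
      let ?s = "\<lambda>j. \<Sum>b\<in>insert a B. y b ^ (?q ^ j) * g b"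
      let ?t = "(y a ^ (?q - 1)) ^ (?q ^ j)"
      have p: "(y b ^ ?q) ^ (?q ^ j) = y b ^ (?q ^ Suc j)" for b
        by (simp add: power_mult)
      have "?t * y a ^ (?q ^ j) = (y a ^ Suc (?q - 1)) ^ (?q ^ j)"
        by (simp only: power_Suc power_mult_distrib mult.commute)
      then have ya: "?t * y a ^ (?q ^ j) = y a ^ (?q ^ Suc j)"
        by (simp only: q[symmetric] p)
      have "?s (Suc j) - ?t * ?s j = (\<Sum>b\<in>insert a B. y b ^ (?q ^ Suc j) * g b - ?t * (y b ^ (?q ^ j) * g b))"
        by (simp only: sum_subtractf sum_distrib_left)
      also have "\<dots> = (\<Sum>b\<in>B. y b ^ (?q ^ Suc j) * g b - ?t * (y b ^ (?q ^ j) * g b))"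
        by (simp only: sum.insert[OF insert.hyps] ya[symmetric] mult.assoc diff_self add_0_left)
      also have "\<dots> = (\<Sum>b\<in>B. y' b ^ (?q ^ j) * g b)"
        by (rule sum.cong) (simp_all only: y'_def mpoly_frobenius_diff p power_mult_distrib left_diff_distrib mult.assoc)
      finally have "(\<Sum>b\<in>B. y' b ^ (?q ^ j) * g b) = ?s (Suc j) - ?t * ?s j" by simp
      moreover have "?t \<in> mpolys d" using y by (intro ring_closed) auto
      ultimately show ?thesis using insert.prems(4) diff mult by presburger
    qed
  qed (use y y' in auto)
  moreover have "g a \<in> Q"
  proof -
    have "(\<Sum>b\<in>B. y b * g b) \<in> Q" using calculation y by (intro sum mult) auto
    moreover have "(\<Sum>b\<in>insert a B. y b * g b) \<in> Q" using insert.prems(4)[of 0] by simp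
    ultimately have "(\<Sum>b\<in>insert a B. y b * g b) - (\<Sum>b\<in>B. y b * g b) \<in> Q" by (intro diff)
    then have "y a * g a \<in> Q" using insert.hyps by simp
    moreover have "y a \<notin> Q"
    proof
      assume "y a \<in> Q"
      moreover have "(\<Sum>b\<in>insert a B. mconst ((\<lambda>b. if b = a then 1 else 0) b) * y b)
          = y a + (\<Sum>b\<in>B. mconst (if b = a then 1 else 0) * y b)"
        using insert.hyps by (simp add: mconst.hom_one)
      moreover have "(\<Sum>b\<in>B. mconst (if b = a then 1 else 0) * y b) = 0"
        using insert.hyps by (intro sum.neutral) (auto simp: mconst.hom_zero)
      ultimately have "(\<Sum>b\<in>insert a B. mconst ((\<lambda>b. if b = a then 1 else 0) b) * y b) \<in> Q" by simp
      then have "(if a = a then 1 else 0) = (0 :: 'k)"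
        by (rule insert.prems(3)[unfolded indep_def, rule_format]) simp
      then show False by simp
    qed
    ultimately show ?thesis using prime y by auto
  qed
  ultimately show ?case by blast
qed simp

end

section \<open>Roots of polynomials with vanishing partial derivatives\<close>

lemma CHAR_mpoly: "CHAR('k::comm_ring_1 mpoly) = CHAR('k)"
proof (rule CHAR_eqI)
  have of_nat: "of_nat n = (mconst (of_nat n) :: 'k mpoly)" for n
    by (simp add: mconst.hom_of_nat)
  show "of_nat (CHAR('k)) = (0 :: 'k mpoly)" by (simp add: of_nat mconst.hom_zero)
  fix n assume "of_nat n = (0 :: 'k mpoly)"
  then have "Poly_Mapping.lookup (mconst (of_nat n :: 'k)) 0 = 0" by (simp only: of_nat lookup_zero)
  then have "of_nat n = (0 :: 'k)" by (simp only: mconst_def lookup_single_eq)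
  then show "CHAR('k) dvd n" by (simp add: of_nat_eq_0_iff_char_dvd)
qed

lemma prime_CHAR_finite: "Factorial_Ring.prime CHAR('k::{finite,field})"
  by (intro prime_CHAR_semidom finite_imp_CHAR_pos) auto

lemma finite_field_CHAR_root: "\<exists>c :: 'k::{finite,field}. c ^ CHAR('k) = a"
proof -
  note p = prime_CHAR_finite[where 'k = 'k]
  have "inj (\<lambda>x :: 'k. x ^ CHAR('k))"
  proof (rule injI)
    fix x y :: 'k assume "x ^ CHAR('k) = y ^ CHAR('k)"
    then have "(x - y) ^ CHAR('k) = 0"
      using freshmans_dream[OF p refl, of "x - y" y] by simp
    then show "x = y" by simp
  qed
  then have "surj (\<lambda>x :: 'k. x ^ CHAR('k))" by (intro finite_UNIV_inj_surj) simp_all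
  then show ?thesis by (metis surjD)
qed

lemma mdeg_superset:
  "finite A \<Longrightarrow> Poly_Mapping.keys m \<subseteq> A \<Longrightarrow> mdeg m = (\<Sum>i\<in>A. Poly_Mapping.lookup m i)"
  unfolding mdeg_def by (intro sum.mono_neutral_left) (auto simp: in_keys_iff)

lemma mdeg_add: "mdeg (m + n) = mdeg m + mdeg n"
proof -
  let ?A = "Poly_Mapping.keys m \<union> Poly_Mapping.keys n"
  have "mdeg (m + n) = (\<Sum>i\<in>?A. Poly_Mapping.lookup (m + n) i)"
    by (rule mdeg_superset) (auto dest: subsetD[OF Poly_Mapping.keys_add])
  also have "\<dots> = mdeg m + mdeg n"
    using mdeg_superset[of ?A m] mdeg_superset[of ?A n] by (simp add: lookup_add sum.distrib)
  finally show ?thesis .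
qed

lemma mdeg_single [simp]: "mdeg (Poly_Mapping.single i n) = n"
  by (cases "n = 0") (auto simp: mdeg_def)

lemma mdeg_eq_0_iff: "mdeg m = 0 \<longleftrightarrow> m = 0"
proof
  assume "mdeg m = 0"
  then show "m = 0" by (intro poly_mapping_eqI) (simp add: mdeg_def in_keys_iff)
qed (simp add: mdeg_def)

text \<open>
  Over a finite field the coefficients are \<open>p\<close>-th powers as well, and raising to the power \<open>p\<close> is
  additive.
\<close>

lemma mpoly_CHAR_root:
  fixes f :: "'k::{finite,field} mpoly"
  assumes dvd: "\<And>m b. m \<in> Poly_Mapping.keys f \<Longrightarrow> CHAR('k) dvd Poly_Mapping.lookup m b"
  obtains h where "f = h ^ CHAR('k)"
    and "\<And>m. m \<in> Poly_Mapping.keys h \<Longrightarrow>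
      \<exists>m'\<in>Poly_Mapping.keys f. Poly_Mapping.keys m = Poly_Mapping.keys m' \<and> mdeg m' = CHAR('k) * mdeg m"
proof -
  let ?p = "CHAR('k)"
  note p = prime_CHAR_finite[where 'k = 'k]
  have p0: "?p > 0" using p by (rule prime_gt_0_nat)
  define r where "r m = Poly_Mapping.map (\<lambda>n. n div ?p) m" for m :: "nat \<Rightarrow>\<^sub>0 nat"
  have lr: "Poly_Mapping.lookup (r m) i = Poly_Mapping.lookup m i div ?p" for m i
    by (simp add: r_def map.rep_eq when_def)
  have lm: "Poly_Mapping.lookup m i = ?p * Poly_Mapping.lookup (r m) i" if "m \<in> Poly_Mapping.keys f" for m i
    using dvd[OF that, of i] by (simp add: lr)
  have kr: "Poly_Mapping.keys (r m) = Poly_Mapping.keys m" if "m \<in> Poly_Mapping.keys f" for m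
    using lm[OF that] p0 by (auto simp: in_keys_iff)
  have "\<forall>m. \<exists>c :: 'k. c ^ ?p = Poly_Mapping.lookup f m"
    using finite_field_CHAR_root by blast
  then obtain c where c: "\<And>m. c m ^ ?p = Poly_Mapping.lookup f m" by metis
  define h where "h = (\<Sum>m\<in>Poly_Mapping.keys f. Poly_Mapping.single (r m) (c m))"
  have pw: "Poly_Mapping.single (r m) (c m) ^ ?p = Poly_Mapping.single m (Poly_Mapping.lookup f m)"
    if m: "m \<in> Poly_Mapping.keys f" for m
  proof -
    have "monomial_value mvar (r m) ^ ?p = (monomial_value mvar m :: 'k mpoly)"
      by (simp add: monomial_value_def kr[OF m] lm[OF m] prod_power_distrib power_mult[symmetric] mult.commute)
    then show ?thesis
      by (simp add: single_eq power_mult_distrib mconst.hom_power[symmetric] c)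
  qed
  have "h ^ ?p = (\<Sum>m\<in>Poly_Mapping.keys f. Poly_Mapping.single (r m) (c m) ^ ?p)"
    unfolding h_def by (rule freshmans_dream_sum) (use p in \<open>simp_all add: CHAR_mpoly\<close>)
  also have "\<dots> = f"
    by (subst mpoly_sum_singles[of f]) (simp add: pw)
  finally have "f = h ^ ?p" by simp
  moreover have "\<exists>m'\<in>Poly_Mapping.keys f. Poly_Mapping.keys m = Poly_Mapping.keys m' \<and> mdeg m' = ?p * mdeg m"
    if "m \<in> Poly_Mapping.keys h" for m
  proof -
    have "m \<in> (\<Union>m'\<in>Poly_Mapping.keys f. Poly_Mapping.keys (Poly_Mapping.single (r m') (c m')))"
      by (rule subsetD[OF Poly_Mapping.keys_sum that[unfolded h_def]])
    then obtain m' where m': "m' \<in> Poly_Mapping.keys f" "m = r m'"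
      by (auto split: if_splits)
    then have "mdeg m' = ?p * mdeg m"
      by (simp add: mdeg_def kr lm sum_distrib_left)
    then show ?thesis using m' kr by blast
  qed
  ultimately show ?thesis by (rule that)
qed

section \<open>Stable primes are generated by linear forms\<close>

text \<open>
  When \<open>a\<close> is the identity matrix on \<open>C\<close>, this is induced by a projection of \<open>V*\<close> onto the span of
  the coordinates \<open>C\<close>.
\<close>

definition projection :: "nat set \<Rightarrow> (nat \<Rightarrow> nat \<Rightarrow> 'k::comm_ring_1) \<Rightarrow> 'k mpoly \<Rightarrow> 'k mpoly" where
  "projection C a = mpoly_eval mconst (\<lambda>i. \<Sum>b\<in>C. mconst (a i b) * mvar b)"

lemma projection_hom: "comm_ring_hom (projection C a)"
  unfolding projection_def by (rule mpoly_eval_hom[OF mconst_hom])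

lemma projection_mconst [simp]: "projection C a (mconst c) = mconst c"
  and projection_mvar: "projection C a (mvar i) = (\<Sum>b\<in>C. mconst (a i b) * mvar b)"
  unfolding projection_def using mpoly_eval_mconst[OF mconst_hom] mpoly_eval_mvar[OF mconst_hom] by blast+

context stable_prime
begin

text \<open>
  A polynomial in \<open>Q\<close> of minimal degree has vanishing partial derivatives, as these lie in \<open>Q\<close>
  as well. So it is a \<open>p\<close>-th power, and the \<open>p\<close>-th root in \<open>Q\<close> has smaller degree.
\<close>

lemma mpolys_on_indep_trivial:
  assumes B: "B \<subseteq> {..<d}" and ind: "indep B mvar" and f: "f \<in> Q" "f \<in> mpolys_on B"
  shows "f = 0"
proof -
  have "f = 0" if "f \<in> Q" "f \<in> mpolys_on B" "\<forall>m\<in>Poly_Mapping.keys f. mdeg m \<le> n" for n f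
    using that
  proof (induction n arbitrary: f rule: less_induct)
    case (less n)
    let ?p = "CHAR('k)"
    note p = prime_CHAR_finite[where 'k = 'k]
    have finB: "finite B" using B finite_subset by blast
    have sub: "mpolys_on B \<subseteq> mpolys d" using B by (auto simp: mpolys_eq mpolys_on_def)
    have fd: "f \<in> mpolys d" using less.prems(1) sub less.prems(2) by blast
    have pdB: "partial_deriv b f \<in> mpolys_on B" for b
      unfolding partial_deriv_def using less.prems(2) by (intro coeff_taylor_in) (auto simp: mpolys_on_ops)
    have pdQ: "\<forall>b\<in>B. partial_deriv b f \<in> Q"
    proof (rule moore[OF finB _ _ ind])
      show "(\<Sum>b\<in>B. mvar b ^ (CARD('k) ^ j) * partial_deriv b f) \<in> Q" for j
        using stable[OF less.prems(1), of j] coeff_taylor_1[OF finB less.prems(2)]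
        by (simp add: power_field_def)
    qed (use pdB sub B in \<open>auto intro: ring_closed\<close>)
    show "f = 0"
    proof (cases "n = 0")
      case True
      then have "m = 0" if "m \<in> Poly_Mapping.keys f" for m
        using less.prems(3) that by (simp add: mdeg_eq_0_iff)
      then have "f = mconst (Poly_Mapping.lookup f 0)"
        by (intro poly_mapping_eqI) (metis in_keys_iff lookup_single_eq lookup_single_not_eq mconst_def)
      then show ?thesis using const less.prems(1) by (metis mconst.hom_zero)
    next
      case False
      have pd0: "partial_deriv b f = 0" if b: "b \<in> B" for b
      proof (rule less.IH[of "n - 1"])
        show "\<forall>m\<in>Poly_Mapping.keys (partial_deriv b f). mdeg m \<le> n - 1"
        proof
          fix m assume "m \<in> Poly_Mapping.keys (partial_deriv b f)"
          then have "m + Poly_Mapping.single b 1 \<in> Poly_Mapping.keys f"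
            by (auto simp: in_keys_iff lookup_partial_deriv)
          then show "mdeg m \<le> n - 1" using less.prems(3) by (force simp: mdeg_add)
        qed
      qed (use False pdQ pdB b in auto)
      have "?p dvd Poly_Mapping.lookup m b" if m: "m \<in> Poly_Mapping.keys f" for m b
      proof (cases "Poly_Mapping.lookup m b")
        case (Suc k)
        then have "b \<in> Poly_Mapping.keys m" by (simp add: in_keys_iff)
        then have b: "b \<in> B" using m less.prems(2) by (auto simp: mpolys_on_def)
        let ?m = "m - Poly_Mapping.single b 1"
        have e: "?m + Poly_Mapping.single b 1 = m"
          using Suc by (intro poly_mapping_eqI) (auto simp: lookup_add lookup_minus lookup_single when_def)
        have "Suc (Poly_Mapping.lookup ?m b) = Poly_Mapping.lookup m b"
          using Suc by (simp add: lookup_minus)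
        then have "of_nat (Poly_Mapping.lookup m b) * Poly_Mapping.lookup f m = (0 :: 'k)"
          using lookup_partial_deriv[of b f ?m] by (simp only: e pd0[OF b] lookup_zero)
        then have "of_nat (Poly_Mapping.lookup m b) = (0 :: 'k)"
          using m by (simp add: in_keys_iff)
        then show ?thesis by (simp add: of_nat_eq_0_iff_char_dvd)
      qed simp
      then obtain h where h: "f = h ^ ?p"
        and hk: "\<And>m. m \<in> Poly_Mapping.keys h \<Longrightarrow>
          \<exists>m'\<in>Poly_Mapping.keys f. Poly_Mapping.keys m = Poly_Mapping.keys m' \<and> mdeg m' = ?p * mdeg m"
        using mpoly_CHAR_root[of f] by metis
      have hB: "h \<in> mpolys_on B"
        using hk less.prems(2) unfolding mpolys_on_def by fastforce
      have "h \<in> Q" using power[of h ?p] hB sub less.prems(1) h by blast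
      moreover have "\<forall>m\<in>Poly_Mapping.keys h. mdeg m \<le> n - 1"
      proof
        fix m assume "m \<in> Poly_Mapping.keys h"
        then obtain m' where "m' \<in> Poly_Mapping.keys f" "mdeg m' = ?p * mdeg m" using hk by blast
        then have "?p * mdeg m \<le> n" using less.prems(3) by metis
        moreover have "2 * mdeg m \<le> ?p * mdeg m" using prime_ge_2_nat[OF p] by (rule mult_right_mono) simp
        ultimately show "mdeg m \<le> n - 1" using False by linarith
      qed
      ultimately have "h = 0" using less.IH[of "n - 1" h] hB False by auto
      then show "f = 0" using h prime_gt_0_nat[OF p] by (simp add: power_0_left)
    qed
  qed
  moreover have "\<forall>m\<in>Poly_Mapping.keys f. mdeg m \<le> Max (mdeg ` Poly_Mapping.keys f)" by simp
  ultimately show ?thesis using f by blast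
qed

text \<open>
  The coordinates in \<open>B\<close> are chosen as a basis of the linear forms modulo those in \<open>Q\<close>. Rewriting the
  other coordinates in terms of them changes a polynomial only by an element of \<open>Q\<close>, and
  \<open>mpolys_on_indep_trivial\<close> says that no nonzero polynomial in the coordinates \<open>B\<close> lies in \<open>Q\<close>.
\<close>

lemma kernel_of_projection:
  obtains B a where "B \<subseteq> {..<d}"
    and "\<And>i b. i \<in> B \<Longrightarrow> b \<in> B \<Longrightarrow> a i b = (if i = b then 1 else 0 :: 'k)"
    and "\<And>r. r \<in> mpolys d \<Longrightarrow> r \<in> Q \<longleftrightarrow> projection B a r = 0"
proof -
  have "\<exists>B. (B \<subseteq> {..<d} \<and> indep B mvar) \<and> (\<forall>B'. B' \<subseteq> {..<d} \<and> indep B' mvar \<longrightarrow> card B' \<le> card B)"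
  proof (rule ex_has_greatest_nat[where P = "\<lambda>B. B \<subseteq> {..<d} \<and> indep B mvar" and k = "{}" and b = "Suc d"])
    show "{} \<subseteq> {..<d} \<and> indep {} mvar" by (simp add: indep_def)
    show "\<forall>B. B \<subseteq> {..<d} \<and> indep B mvar \<longrightarrow> card B < Suc d"
      using card_mono[of "{..<d}"] by (auto simp: less_Suc_eq_le)
  qed
  then obtain B where B: "B \<subseteq> {..<d}" "indep B mvar"
    and max: "\<And>B'. B' \<subseteq> {..<d} \<Longrightarrow> indep B' mvar \<Longrightarrow> card B' \<le> card B" by blast
  have finB: "finite B" using B finite_subset by blast
  have sub: "mpolys_on B \<subseteq> mpolys d" using B by (auto simp: mpolys_eq mpolys_on_def)
  have "\<exists>a. mvar i - (\<Sum>b\<in>B. mconst (a b) * mvar b) \<in> Q" if i: "i < d" "i \<notin> B" for i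
  proof -
    have "\<not> indep (insert i B) mvar" using max[of "insert i B"] i B finB by auto
    then obtain c where c: "(\<Sum>b\<in>insert i B. mconst (c b) * mvar b) \<in> Q" "\<exists>b\<in>insert i B. c b \<noteq> 0"
      unfolding indep_def by blast
    have ci: "c i \<noteq> 0"
    proof
      assume 0: "c i = 0"
      then have "(\<Sum>b\<in>B. mconst (c b) * mvar b) \<in> Q"
        using c(1) i finB by (simp add: mconst.hom_zero)
      then have "\<forall>b\<in>B. c b = 0" using B(2) unfolding indep_def by blast
      then show False using c(2) 0 by auto
    qed
    have "mconst (inverse (c i)) * (\<Sum>b\<in>insert i B. mconst (c b) * mvar b) \<in> Q"
      by (rule mult[OF ring_closed(5) c(1)])
    also have "mconst (inverse (c i)) * (\<Sum>b\<in>insert i B. mconst (c b) * mvar b)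
        = mvar i - (\<Sum>b\<in>B. mconst (- c b / c i) * mvar b)"
    proof -
      have "mconst (inverse (c i)) * (mconst (c i) * mvar i) = mvar i"
        using ci by (simp add: mult.assoc[symmetric] mconst.hom_mult[symmetric] mconst.hom_one)
      moreover have "mconst (inverse (c i)) * (mconst (c b) * mvar b) = - (mconst (- c b / c i) * mvar b)" for b
      proof -
        have "mconst (- c b / c i) = - (mconst (inverse (c i)) * mconst (c b))"
          unfolding mconst.hom_mult[symmetric] mconst.hom_uminus[symmetric] by (simp add: field_simps)
        then show ?thesis by (simp add: mult.assoc)
      qed
      ultimately show ?thesis
        using i finB by (simp add: distrib_left sum_distrib_left sum_negf)
    qed
    finally show ?thesis by (rule exI[of _ "\<lambda>b. - c b / c i"])
  qed
  then obtain a0 where a0: "\<And>i. i < d \<Longrightarrow> i \<notin> B \<Longrightarrow> mvar i - (\<Sum>b\<in>B. mconst (a0 i b) * mvar b) \<in> Q"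
    by metis
  define a where "a i b = (if i \<in> B then (if i = b then 1 else 0) else a0 i b)" for i b
  let ?\<sigma> = "projection B a"
  have aB: "(\<Sum>b\<in>B. mconst (a i b) * mvar b) = mvar i" if "i \<in> B" for i
  proof -
    have "(\<Sum>b\<in>B. mconst (a i b) * mvar b) = (\<Sum>b\<in>B. if i = b then mvar b else 0)"
      using that by (intro sum.cong) (auto simp: a_def mconst.hom_one mconst.hom_zero)
    then show ?thesis using that finB by simp
  qed
  interpret \<sigma>: comm_ring_hom ?\<sigma> by (rule projection_hom)
  note \<sigma>v = projection_mvar[of B a] and \<sigma>c = projection_mconst[of B a]
  have \<sigma>B: "?\<sigma> r \<in> mpolys_on B" if "r \<in> mpolys d" for r
    using that unfolding mpolys_eq
    by (rule hom_mpolys_on[OF \<sigma>.comm_ring_hom_axioms mpolys_on_closed, rotated 2])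
      (auto simp: \<sigma>v \<sigma>c intro!: mpolys_on_ops)
  have \<sigma>d: "?\<sigma> r \<in> mpolys d" if "r \<in> mpolys d" for r using \<sigma>B[OF that] sub by blast
  have cong: "r - ?\<sigma> r \<in> Q" if r: "r \<in> mpolys d" for r
  proof -
    have "r \<in> {r \<in> mpolys d. r - ?\<sigma> r \<in> Q}"
    proof (rule hom_mpolys_on[where f = "\<lambda>r. r", OF _ _ _ _ r[unfolded mpolys_eq]])
      show "comm_ring_hom (\<lambda>r :: 'k mpoly. r)" by (rule comm_ring_hom_id)
      show "closed_under_ring_ops {r \<in> mpolys d. r - ?\<sigma> r \<in> Q}"
        unfolding closed_under_ring_ops_def
      proof (intro conjI ballI)
        fix u v assume uv: "u \<in> {r \<in> mpolys d. r - ?\<sigma> r \<in> Q}" "v \<in> {r \<in> mpolys d. r - ?\<sigma> r \<in> Q}"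
        then have uvd: "u + v \<in> mpolys d" "u * v \<in> mpolys d" by (auto intro: ring_closed)
        have "(u + v) - ?\<sigma> (u + v) = (u - ?\<sigma> u) + (v - ?\<sigma> v)" by (simp add: \<sigma>.hom_add)
        moreover have "(u - ?\<sigma> u) + (v - ?\<sigma> v) \<in> Q" using uv by (intro add) simp_all
        ultimately show "u + v \<in> {r \<in> mpolys d. r - ?\<sigma> r \<in> Q}"
          using uvd by (simp only: mem_Collect_eq simp_thms)
        have "u * v - ?\<sigma> (u * v) = v * (u - ?\<sigma> u) + ?\<sigma> u * (v - ?\<sigma> v)"
          unfolding \<sigma>.hom_mult by (simp only: right_diff_distrib) (simp only: mult.commute add_diff_eq diff_add_cancel)
        moreover have "v * (u - ?\<sigma> u) + ?\<sigma> u * (v - ?\<sigma> v) \<in> Q"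
          using uv by (intro add mult \<sigma>d) simp_all
        ultimately show "u * v \<in> {r \<in> mpolys d. r - ?\<sigma> r \<in> Q}"
          using uvd by (simp only: mem_Collect_eq simp_thms)
      qed (use zero in \<open>auto simp: mpolys_eq mpolys_on_ops \<sigma>.hom_one\<close>)
      show "mvar i \<in> {r \<in> mpolys d. r - ?\<sigma> r \<in> Q}" if "i \<in> {..<d}" for i
      proof -
        have "mvar i - (\<Sum>b\<in>B. mconst (a i b) * mvar b) \<in> Q"
        proof (cases "i \<in> B")
          case True
          then show ?thesis using zero by (simp add: aB)
        next
          case False
          then show ?thesis using a0[of i] that by (simp add: a_def)
        qed
        then show ?thesis using that ring_closed(6)[of i] by (simp add: \<sigma>v)
      qed
    qed (auto simp: \<sigma>c zero ring_closed)
    then show ?thesis by simp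
  qed
  show ?thesis
  proof (rule that[of B a])
    show "r \<in> Q \<longleftrightarrow> ?\<sigma> r = 0" if r: "r \<in> mpolys d" for r
    proof
      assume "r \<in> Q"
      then have "r - (r - ?\<sigma> r) \<in> Q" using cong[OF r] by (rule diff)
      then show "?\<sigma> r = 0" using \<sigma>B[OF r] mpolys_on_indep_trivial[OF B] by simp
    next
      assume "?\<sigma> r = 0"
      then show "r \<in> Q" using cong[OF r] by simp
    qed
  qed (use B in \<open>auto simp: a_def\<close>)
qed

end

section \<open>Linear substitutions and rings of invariants\<close>

text \<open>
  The homomorphism that agrees with \<open>lin_subst\<close> on the polynomials in \<open>x\<^sub>0, \<dots>, x\<^bsub>d-1\<^esub>\<close>.
\<close>

definition mat_subst :: "nat \<Rightarrow> 'k::comm_ring_1 mat \<Rightarrow> 'k mpoly \<Rightarrow> 'k mpoly" where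
  "mat_subst d A = mpoly_eval mconst (\<lambda>i. \<Sum>j<d. mconst (A $$ (i, j)) * mvar j)"

lemma mat_subst_hom: "comm_ring_hom (mat_subst d A)"
  unfolding mat_subst_def by (rule mpoly_eval_hom[OF mconst_hom])

interpretation mat_subst: comm_ring_hom "mat_subst d A" for d A by (rule mat_subst_hom)

lemma mat_subst_mconst [simp]: "mat_subst d A (mconst c) = mconst c"
  and mat_subst_mvar: "mat_subst d A (mvar i) = (\<Sum>j<d. mconst (A $$ (i, j)) * mvar j)"
  unfolding mat_subst_def using mpoly_eval_mconst[OF mconst_hom] mpoly_eval_mvar[OF mconst_hom] by blast+

lemma lin_subst_eq: "p \<in> mpolys d \<Longrightarrow> lin_subst d A p = mat_subst d A p"
  unfolding lin_subst_def mat_subst_def mpoly_eval_def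
  by (intro sum.cong refl) (auto simp: mpolys_def monomial_value_superset[of "{..<d}"])

lemma mat_subst_closed: "p \<in> mpolys d \<Longrightarrow> mat_subst d A p \<in> mpolys d"
  unfolding mpolys_eq
  by (rule hom_mpolys_on[OF mat_subst_hom mpolys_on_closed])
    (auto simp: mat_subst_mvar intro!: mpolys_on_ops)

lemma mat_subst_comp:
  assumes "A \<in> carrier_mat d d" "B \<in> carrier_mat d d" and p: "p \<in> mpolys d"
  shows "mat_subst d B (mat_subst d A p) = mat_subst d (A * B) p"
proof (rule hom_eqI[where f = "\<lambda>p. mat_subst d B (mat_subst d A p)", OF _ mat_subst_hom _ _ p[unfolded mpolys_eq]])
  show "comm_ring_hom (\<lambda>p. mat_subst d B (mat_subst d A p))"
    by (rule comm_ring_hom_comp[OF mat_subst_hom mat_subst_hom])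
  fix i assume "i \<in> {..<d}"
  then have "(A * B) $$ (i, l) = (\<Sum>j<d. A $$ (i, j) * B $$ (j, l))" if "l < d" for l
    using assms that by (auto simp: scalar_prod_def lessThan_atLeast0 intro!: sum.cong)
  then have "mat_subst d (A * B) (mvar i) = (\<Sum>l<d. \<Sum>j<d. mconst (A $$ (i, j)) * (mconst (B $$ (j, l)) * mvar l))"
    by (simp add: mat_subst_mvar mconst.hom_sum mconst.hom_mult sum_distrib_right mult.assoc)
  also have "\<dots> = (\<Sum>j<d. \<Sum>l<d. mconst (A $$ (i, j)) * (mconst (B $$ (j, l)) * mvar l))"
    by (rule sum.swap)
  finally show "mat_subst d B (mat_subst d A (mvar i)) = mat_subst d (A * B) (mvar i)"
    by (simp add: mat_subst_mvar mat_subst.hom_sum mat_subst.hom_mult sum_distrib_left)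
qed simp

lemma mat_subst_one:
  assumes p: "p \<in> mpolys d"
  shows "mat_subst d (1\<^sub>m d) p = p"
proof (rule hom_eqI[where g = "\<lambda>p. p", OF mat_subst_hom _ _ _ p[unfolded mpolys_eq]])
  show "comm_ring_hom (\<lambda>p :: 'a mpoly. p)" by (rule comm_ring_hom_id)
  fix i assume i: "i \<in> {..<d}"
  have "mat_subst d (1\<^sub>m d) (mvar i) = (\<Sum>j<d. if i = j then mvar j else (0 :: 'a mpoly))"
    unfolding mat_subst_mvar using i
    by (intro sum.cong) (auto simp: mconst.hom_one mconst.hom_zero)
  then show "mat_subst d (1\<^sub>m d) (mvar i) = (mvar i :: 'a mpoly)" using i by simp
qed simp

lemma map_poly_hom:
  assumes "comm_ring_hom h"
  shows "comm_ring_hom (map_poly h)"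
proof -
  interpret h: comm_ring_hom h by fact
  show ?thesis
    by unfold_locales
      (auto intro!: poly_eqI simp: coeff_map_poly coeff_mult h.hom_add h.hom_sum h.hom_mult one_pCons
        coeff_pCons split: nat.split)
qed

text \<open>
  The Steenrod operations commute with linear substitutions, as raising to the power \<open>q^j\<close> is
  linear over the field with \<open>q\<close> elements.
\<close>

lemma mat_subst_taylor:
  "mat_subst d A (coeff (taylor (power_field j) p) n) = coeff (taylor (power_field j) (mat_subst d A p)) n"
proof -
  have "map_poly (mat_subst d A) (taylor (power_field j) p) = taylor (power_field j) (mat_subst d A p)"
  proof (rule hom_eqI[where B = UNIV and f = "\<lambda>p. map_poly (mat_subst d A) (taylor (power_field j) p)"
        and g = "\<lambda>p. taylor (power_field j) (mat_subst d A p)"])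
    show "comm_ring_hom (\<lambda>p. map_poly (mat_subst d A) (taylor (power_field j) p))"
      by (rule comm_ring_hom_comp[OF taylor_hom map_poly_hom[OF mat_subst_hom]])
    show "comm_ring_hom (\<lambda>p. taylor (power_field j) (mat_subst d A p))"
      by (rule comm_ring_hom_comp[OF mat_subst_hom taylor_hom])
    show "map_poly (mat_subst d A) (taylor (power_field j) (mconst c))
        = taylor (power_field j) (mat_subst d A (mconst c))" for c
      by (simp add: map_poly_pCons)
    fix i
    have lin: "(\<Sum>l\<in>L. [:a l:] * [:u l, v l:]) = [:\<Sum>l\<in>L. a l * u l, \<Sum>l\<in>L. a l * v l:]"
      if "finite L" for L and a u v :: "nat \<Rightarrow> 'a mpoly"
      using that by (induction L rule: finite_induct) auto
    have "mat_subst d A (mvar i) ^ (CARD('a) ^ j)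
        = (\<Sum>l<d. mconst (A $$ (i, l)) * mvar l ^ (CARD('a) ^ j))"
      by (simp add: mat_subst_mvar mpoly_frobenius_sum power_mult_distrib mconst_frobenius)
    then show "map_poly (mat_subst d A) (taylor (power_field j) (mvar i))
        = taylor (power_field j) (mat_subst d A (mvar i))"
      using lin[of "{..<d}" "\<lambda>l. mconst (A $$ (i, l))" mvar "\<lambda>l. mvar l ^ (CARD('a) ^ j)"]
      by (simp add: map_poly_pCons power_field_def mat_subst.hom_power mat_subst_mvar
          taylor.hom_sum taylor.hom_mult)
  qed simp
  then show ?thesis by (metis coeff_map_poly mat_subst.hom_zero)
qed

text \<open>
  \<open>N\<close> holds the matrices whose substitutions test invariance under \<open>G\<close>: the inverses of the elements
  of \<open>G\<close>. This treats the invariants of a subgroup, where \<open>N = G\<close>, together with the full polynomial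
  ring, where both sets are empty.
\<close>

locale invariants =
  fixes d :: nat and G :: "'k::{finite,field} mat set" and N :: "'k mat set"
  assumes carrier_eq: "carrier (invariant_ring d G) = {p \<in> mpolys d. \<forall>A\<in>N. mat_subst d A p = p}"
begin

abbreviation S :: "'k mpoly ring" where "S \<equiv> invariant_ring d G"

lemma ops [simp]:
  "\<one>\<^bsub>S\<^esub> = 1" "\<zero>\<^bsub>S\<^esub> = 0" "p \<otimes>\<^bsub>S\<^esub> r = p * r" "p \<oplus>\<^bsub>S\<^esub> r = p + r"
  by (simp_all add: invariant_ring_def)

lemma closed:
  shows "a \<in> carrier S \<Longrightarrow> b \<in> carrier S \<Longrightarrow> a + b \<in> carrier S"
    and "a \<in> carrier S \<Longrightarrow> b \<in> carrier S \<Longrightarrow> a * b \<in> carrier S"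
    and "a \<in> carrier S \<Longrightarrow> b \<in> carrier S \<Longrightarrow> a - b \<in> carrier S"
    and "a \<in> carrier S \<Longrightarrow> - a \<in> carrier S"
    and "a \<in> carrier S \<Longrightarrow> a ^ n \<in> carrier S"
    and "1 \<in> carrier S" "0 \<in> carrier S"
  by (auto simp: carrier_eq mat_subst.hom_add mat_subst.hom_mult mat_subst.hom_minus mat_subst.hom_uminus
      mat_subst.hom_power mat_subst.hom_one mpolys_eq intro: mpolys_on_ops)

lemma cring: "cring S"
proof (rule cringI)
  show "abelian_group S"
    by (rule abelian_groupI)
      (auto simp: closed add_ac intro!: bexI[of _ "- x" for x] closed)
  show "comm_monoid S"
    by (rule comm_monoidI) (auto simp: closed mult_ac)
qed (auto simp: distrib_right)

lemma finsum: "f \<in> A \<rightarrow> carrier S \<Longrightarrow> finsum S f A = sum f A"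
proof (induction A rule: infinite_finite_induct)
  interpret cring S by (rule cring)
  case (insert a A)
  then show ?case by (simp add: Pi_iff)
next
  interpret cring S by (rule cring)
  case (infinite A)
  then show ?case by (simp add: finsum_infinite)
next
  interpret cring S by (rule cring)
  case empty
  then show ?case by simp
qed

lemma nat_pow: "a [^]\<^bsub>S\<^esub> (n::nat) = a ^ n"
proof -
  interpret cring S by (rule cring)
  show ?thesis by (induction n) (auto simp: mult.commute)
qed

lemma higher_derivation_taylor:
  "higher_derivation S (\<lambda>n p. coeff (taylor (power_field j) p) n)"
proof -
  have "power_field j i \<in> mpolys_on {..<d}" if "i \<in> {..<d}" for i
    unfolding power_field_def using that by (intro mpolys_on_ops mvar_in)
  then have c: "coeff (taylor (power_field j) p) n \<in> carrier S" if "p \<in> carrier S" for p n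
    using that coeff_taylor_in[of "{..<d}" "power_field j" p n]
    by (auto simp: carrier_eq mat_subst_taylor mpolys_eq)
  show ?thesis
    unfolding higher_derivation_def
    by (auto simp: c taylor.hom_one taylor.hom_add taylor.hom_mult coeff_mult finsum closed)
qed

end

lemma polynomial_ring_invariants: "invariants d {} {}"
  by unfold_locales (simp add: invariant_ring_def)

lemma group_GL: "group (GL d :: 'k::field mat monoid)"
  unfolding GL_def using ring_mat[of d "()", where 'a = 'k]
  by (intro monoid.units_group) (simp add: ring_def)

lemma GL_carrier:
  assumes "A \<in> carrier (GL d)"
  shows "A \<in> carrier_mat d d"
    and "\<exists>B\<in>carrier_mat d d. A * B = 1\<^sub>m d"
  using assms by (auto simp: GL_def units_of_def Units_def ring_mat_def)

lemma finite_GL: "finite (carrier (GL d :: 'k::{finite,field} mat monoid))"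
proof -
  let ?F = "({..<d} \<times> {..<d}) \<rightarrow>\<^sub>E (UNIV :: 'k set)"
  have "A \<in> mat d d ` ?F" if "A \<in> carrier_mat d d" for A :: "'k mat"
    by (rule image_eqI[of _ _ "restrict (\<lambda>ij. A $$ ij) ({..<d} \<times> {..<d})"])
      (use that in \<open>auto intro!: eq_matI\<close>)
  then have "carrier (GL d :: 'k mat monoid) \<subseteq> mat d d ` ?F"
    using GL_carrier(1) by blast
  moreover have "finite (mat d d ` ?F)" by (intro finite_imageI finite_PiE) auto
  ultimately show ?thesis by (rule finite_subset)
qed

lemma invariants_subgroup:
  fixes G :: "'k::{finite,field} mat set"
  assumes G: "subgroup G (GL d)"
  shows "invariants d G G"
proof
  interpret GL: group "GL d :: 'k mat monoid" by (rule group_GL)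
  interpret G: subgroup G "GL d" by fact
  have "(\<forall>g\<in>G. gl_act d g p = p) \<longleftrightarrow> (\<forall>A\<in>G. mat_subst d A p = p)" if p: "p \<in> mpolys d" for p
  proof -
    have "(\<forall>g\<in>G. mat_subst d (inv\<^bsub>GL d\<^esub> g) p = p) \<longleftrightarrow> (\<forall>A\<in>G. mat_subst d A p = p)"
      using G.m_inv_closed GL.inv_inv G.mem_carrier by metis
    then show ?thesis by (simp add: gl_act_def lin_subst_eq p)
  qed
  then show "carrier (invariant_ring d G) = {p \<in> mpolys d. \<forall>A\<in>G. mat_subst d A p = p}"
    by (auto simp: invariant_ring_def)
qed

lemma mat_subst_permutes:
  assumes A: "A \<in> carrier (GL d)" and X: "finite X" "X \<subseteq> mpolys d" "mat_subst d A ` X \<subseteq> X"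
  shows "inj_on (mat_subst d A) X" and "mat_subst d A ` X = X"
proof -
  obtain B where "B \<in> carrier_mat d d" "A * B = 1\<^sub>m d" using GL_carrier(2)[OF A] by blast
  then have "mat_subst d B (mat_subst d A s) = s" if "s \<in> X" for s
    using mat_subst_comp[OF GL_carrier(1)[OF A], of B s] mat_subst_one[of s d] X(2) that by auto
  then show inj: "inj_on (mat_subst d A) X" by (rule inj_on_inverseI)
  show "mat_subst d A ` X = X" by (rule endo_inj_surj[OF X(1,3) inj])
qed

section \<open>Lying over\<close>

text \<open>
  For \<open>a \<in> P\<close> and \<open>u = t + a r\<close> with \<open>t\<close> in the maximal ideal avoiding \<open>S - P\<close>, the norm
  \<open>\<Prod>o. (u - a o)\<close> over the orbit of \<open>r\<close> lies in that ideal, and differs from a power of \<open>u\<close>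
  by an invariant multiple of \<open>a\<close>.
\<close>

lemma lying_over:
  fixes G :: "'k::{finite,field} mat set"
  assumes G: "subgroup G (GL d)" and P: "primeideal P (invariant_ring d G)"
  obtains Q where "primeideal Q (invariant_ring d {})" and "Q \<inter> carrier (invariant_ring d G) = P"
proof -
  interpret GL: group "GL d :: 'k mat monoid" by (rule group_GL)
  interpret G: subgroup G "GL d" by fact
  interpret S: invariants d G G by (rule invariants_subgroup[OF G])
  interpret R: invariants d "{} :: 'k mat set" "{} :: 'k mat set" by (rule polynomial_ring_invariants)
  interpret SR: cring S.S by (rule S.cring)
  interpret RR: cring R.S by (rule R.cring)
  interpret P: primeideal P S.S by fact
  have RC: "carrier R.S = mpolys d" using R.carrier_eq by simp
  have SC: "p \<in> carrier S.S \<longleftrightarrow> p \<in> mpolys d \<and> (\<forall>A\<in>G. mat_subst d A p = p)" for p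
    by (simp add: S.carrier_eq)
  let ?M = "carrier S.S - P"
  have M1: "?M \<subseteq> carrier R.S" using SC RC by auto
  have M2: "\<one>\<^bsub>R.S\<^esub> \<in> ?M" using S.closed P.one_imp_carrier P.I_notcarr by auto
  have M3: "a \<otimes>\<^bsub>R.S\<^esub> b \<in> ?M" if "a \<in> ?M" "b \<in> ?M" for a b
    using that S.closed P.I_prime[of a b] by auto
  have M4: "{\<zero>\<^bsub>R.S\<^esub>} \<inter> ?M = {}" using P.zero_closed by auto
  obtain Q where Q: "primeideal Q R.S" "Q \<inter> ?M = {}"
    and meet: "\<And>a. a \<in> carrier R.S \<Longrightarrow> a \<notin> Q \<Longrightarrow> \<exists>p\<in>Q. \<exists>r\<in>carrier R.S. p \<oplus>\<^bsub>R.S\<^esub> r \<otimes>\<^bsub>R.S\<^esub> a \<in> ?M"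
    using RR.prime_ideal_avoiding[OF M1 M2 M3 RR.zeroideal M4] by metis
  interpret Q: primeideal Q R.S by (rule Q)
  have "P \<subseteq> Q"
  proof (rule subsetI, rule ccontr)
    fix a assume a: "a \<in> P" "a \<notin> Q"
    have aS: "a \<in> carrier S.S" by (rule P.Icarr[OF a(1)])
    have aR: "a \<in> mpolys d" using aS SC by blast
    have a0: "a \<noteq> 0" using Q.zero_closed a(2) by auto
    obtain t r where t: "t \<in> Q" and r: "r \<in> mpolys d" and u: "t + r * a \<in> ?M"
      using meet[of a] a aR RC by auto
    define u where "u = t + r * a"
    have uS: "u \<in> carrier S.S" "u \<notin> P" using u by (auto simp: u_def)
    have uR: "u \<in> mpolys d" using uS SC by blast
    define Orb where "Orb = (\<lambda>A. mat_subst d A r) ` G"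
    have fin: "finite Orb"
      unfolding Orb_def using finite_subset[OF G.subset finite_GL] by blast
    have oR: "s \<in> mpolys d" if "s \<in> Orb" for s
      using that r mat_subst_closed by (auto simp: Orb_def)
    have rO: "r \<in> Orb"
      unfolding Orb_def using G.one_closed mat_subst_one[OF r]
      by (intro image_eqI[of _ _ "1\<^sub>m d"]) (auto simp: GL_def units_of_def ring_mat_def)
    have perm: "mat_subst d A ` Orb = Orb" "inj_on (mat_subst d A) Orb" if A: "A \<in> G" for A
    proof -
      have GA: "A \<in> carrier (GL d)" using A by (rule G.mem_carrier)
      have "mat_subst d A (mat_subst d B r) \<in> Orb" if B: "B \<in> G" for B
      proof -
        have "B * A \<in> G" using G.m_closed[OF B A] by (simp add: GL_def units_of_def ring_mat_def)
        then show ?thesis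
          using mat_subst_comp[OF GL_carrier(1)[OF G.mem_carrier[OF B]] GL_carrier(1)[OF GA] r]
          by (auto simp: Orb_def)
      qed
      then have sub: "mat_subst d A ` Orb \<subseteq> Orb" by (auto simp: Orb_def)
      with oR show "inj_on (mat_subst d A) Orb" "mat_subst d A ` Orb = Orb"
        using mat_subst_permutes[OF GA fin] by blast+
    qed
    define y where "y = (\<Prod>s\<in>Orb. u - a * s)"
    have yR: "y \<in> mpolys d"
      unfolding y_def mpolys_eq using oR uR aR by (intro mpolys_on_ops) (auto simp: mpolys_eq)
    have "mat_subst d A y = y" if A: "A \<in> G" for A
    proof -
      have "mat_subst d A y = (\<Prod>s\<in>Orb. u - a * mat_subst d A s)"
        using uS aS A unfolding SC y_def
        by (simp add: mat_subst.hom_prod mat_subst.hom_minus mat_subst.hom_mult)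
      also have "\<dots> = (\<Prod>s\<in>mat_subst d A ` Orb. u - a * s)"
        using perm(2)[OF A] by (simp add: prod.reindex)
      finally show ?thesis using perm(1)[OF A] by (simp add: y_def)
    qed
    then have yS: "y \<in> carrier S.S" using yR SC by blast
    have "y = t * (\<Prod>s\<in>Orb - {r}. u - a * s)"
      unfolding y_def using prod.remove[OF fin rO, of "\<lambda>s. u - a * s"] by (simp add: u_def mult.commute)
    moreover have "(\<Prod>s\<in>Orb - {r}. u - a * s) \<in> mpolys d"
      unfolding mpolys_eq using oR uR aR by (intro mpolys_on_ops) (auto simp: mpolys_eq)
    ultimately have "y \<in> Q" using Q.I_r_closed[OF t] RC by simp
    then have yP: "y \<in> P" using yS Q(2) by blast
    have "\<exists>w\<in>mpolys d. (\<Prod>s\<in>X. u - a * s) - u ^ card X = a * w" if "finite X" "X \<subseteq> Orb" for X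
      using that
    proof (induction X rule: finite_induct)
      case empty
      show ?case by (rule bexI[of _ 0]) (auto simp: mpolys_eq mpolys_on_ops)
    next
      case (insert s X)
      then obtain w where w: "w \<in> mpolys d" "(\<Prod>s\<in>X. u - a * s) = u ^ card X + a * w"
        by (auto simp: algebra_simps)
      have "(u - a * s) * (u ^ card X + a * w) - u ^ card (insert s X) = a * (u * w - s * (u ^ card X + a * w))"
        using insert.hyps by (simp add: algebra_simps)
      moreover have "u * w - s * (u ^ card X + a * w) \<in> mpolys d"
        using w uR aR oR[of s] insert.prems by (auto simp: mpolys_eq intro!: mpolys_on_ops)
      ultimately show ?case using insert.hyps w by auto
    qed
    from this[OF fin subset_refl] obtain w where w: "w \<in> mpolys d" "y - u ^ card Orb = a * w"
      by (auto simp: y_def)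
    have "mat_subst d A w = w" if A: "A \<in> G" for A
    proof -
      have "y - u ^ card Orb \<in> carrier S.S" by (rule S.closed(3)[OF yS S.closed(5)[OF uS(1)]])
      then have "a * w \<in> carrier S.S" using w(2) by simp
      then have "mat_subst d A (a * w) = a * w" using A unfolding SC by blast
      then have "a * mat_subst d A w = a * w"
        using aS A unfolding SC by (simp add: mat_subst.hom_mult)
      then show ?thesis using a0 by simp
    qed
    then have "w \<in> carrier S.S" using w(1) SC by blast
    then have "a * w \<in> P" using P.I_r_closed[OF a(1)] by simp
    then have "y - a * w \<in> P"
      using yP P.a_closed[of y "- (a * w)"] P.I_l_closed[of "a * w" "- 1"] S.closed by simp
    then have pw: "u ^ card Orb \<in> P" using w(2) by (simp add: algebra_simps)
    have "u ^ n \<notin> P" for n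
    proof (induction n)
      case 0
      show ?case using M2 by simp
    next
      case (Suc n)
      then show ?case using P.I_prime[of u "u ^ n"] uS S.closed by auto
    qed
    then show False using pw by blast
  qed
  moreover have "P \<subseteq> carrier S.S" by (rule primeideal_subset[OF P])
  ultimately have "Q \<inter> carrier S.S = P" using Q(2) by blast
  with Q(1) show ?thesis by (rule that)
qed

section \<open>Dickson polynomials\<close>

definition lform :: "nat \<Rightarrow> (nat \<Rightarrow> 'k::comm_ring_1) \<Rightarrow> 'k mpoly" where
  "lform d c = (\<Sum>j<d. mconst (c j) * mvar j)"

lemma linear_forms_eq: "linear_forms d = range (lform d)"
  by (auto simp: linear_forms_def lform_def)

lemma linear_combination_0_iff:
  assumes "finite C"
  shows "(\<Sum>b\<in>C. mconst (c b) * mvar b) = (0 :: 'k::comm_ring_1 mpoly) \<longleftrightarrow> (\<forall>b\<in>C. c b = 0)"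
proof
  assume *: "(\<Sum>b\<in>C. mconst (c b) * mvar b) = (0 :: 'k mpoly)"
  have s: "mconst (c b) * mvar b = Poly_Mapping.single (Poly_Mapping.single b 1) (c b)" for b
    by (simp add: mconst_def mvar_def mult_single)
  have inj: "Poly_Mapping.single b (Suc 0) = Poly_Mapping.single a (Suc 0) \<longleftrightarrow> b = a" for a b :: nat
    by (metis lookup_single_eq lookup_single_not_eq nat.distinct(1))
  show "\<forall>b\<in>C. c b = 0"
  proof
    fix a assume "a \<in> C"
    then have "c a = Poly_Mapping.lookup (\<Sum>b\<in>C. mconst (c b) * mvar b) (Poly_Mapping.single a 1)"
      using assms by (simp add: s lookup_sum lookup_single when_def inj)
    then show "c a = 0" using * by simp
  qed
qed (simp add: mconst.hom_zero)

lemma finite_linear_forms: "finite (linear_forms d :: 'k::{finite,field} mpoly set)"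
proof -
  have "lform d c \<in> lform d ` ({..<d} \<rightarrow>\<^sub>E UNIV)" for c :: "nat \<Rightarrow> 'k"
    by (rule image_eqI[of _ _ "restrict c {..<d}"]) (auto simp: lform_def)
  then have "linear_forms d \<subseteq> lform d ` ({..<d} \<rightarrow>\<^sub>E (UNIV :: 'k set))"
    by (auto simp: linear_forms_eq)
  moreover have "finite (lform d ` ({..<d} \<rightarrow>\<^sub>E (UNIV :: 'k set)))" by (intro finite_imageI finite_PiE) auto
  ultimately show ?thesis by (rule finite_subset)
qed

lemma linear_forms_mpolys: "linear_forms d \<subseteq> mpolys d"
  by (auto simp: linear_forms_eq lform_def mpolys_eq intro!: mpolys_on_ops)

lemma hom_dickson:
  fixes \<psi> :: "'k::{finite,field} mpoly \<Rightarrow> 'k mpoly"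
  assumes "comm_ring_hom \<psi>"
  shows "\<psi> (dickson d j) = (- 1) ^ (d - j) * coeff (\<Prod>v\<in>linear_forms d. [:\<psi> v, 1:]) (CARD('k) ^ j)"
proof -
  interpret \<psi>: comm_ring_hom \<psi> by fact
  interpret m: comm_ring_hom "map_poly \<psi>" by (rule map_poly_hom) fact
  have "(\<Prod>v\<in>linear_forms d. [:\<psi> v, 1:]) = map_poly \<psi> (\<Prod>v\<in>linear_forms d. [:v, 1:])"
    by (simp add: m.hom_prod map_poly_pCons)
  then show ?thesis
    by (simp add: dickson_def \<psi>.hom_mult \<psi>.hom_power \<psi>.hom_uminus coeff_map_poly)
qed

text \<open>
  Modulo the kernel \<open>K\<close> of \<open>\<psi>\<close> on \<open>V*\<close> the defining product is \<open>X\<^bsup>|K|\<^esup>\<close> times a polynomial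
  with nonzero constant coefficient.
\<close>

lemma hom_dickson_kernel:
  fixes \<psi> :: "'k::{finite,field} mpoly \<Rightarrow> 'k mpoly"
  assumes \<psi>: "comm_ring_hom \<psi>" and card: "card {v \<in> linear_forms d. \<psi> v = 0} = CARD('k) ^ k"
  shows "j < k \<Longrightarrow> \<psi> (dickson d j) = 0" and "\<psi> (dickson d k) \<noteq> 0"
proof -
  let ?K = "{v \<in> linear_forms d. \<psi> v = 0}" and ?L = "linear_forms d :: 'k mpoly set"
  let ?W = "\<Prod>v\<in>?L - ?K. [:\<psi> v, 1:]"
  have "(\<Prod>v\<in>?L. [:\<psi> v, 1:]) = ?W * (\<Prod>v\<in>?K. [:\<psi> v, 1:])"
    by (rule prod.subset_diff) (auto simp: finite_linear_forms)
  also have "(\<Prod>v\<in>?K. [:\<psi> v, 1:]) = (\<Prod>v\<in>?K. [:0, 1:])"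
    by (rule prod.cong) auto
  also have "\<dots> = monom 1 (CARD('k) ^ k)"
    by (simp add: card monom_altdef)
  finally have e: "coeff (\<Prod>v\<in>?L. [:\<psi> v, 1:]) n =
      (if n < CARD('k) ^ k then 0 else coeff ?W (n - CARD('k) ^ k))" for n
    by (simp add: mult.commute[of ?W] coeff_monom_mult)
  show "j < k \<Longrightarrow> \<psi> (dickson d j) = 0"
    using card_field_gt_1[where 'k = 'k] by (simp add: hom_dickson[OF \<psi>] e)
  have "coeff ?W 0 = (\<Prod>v\<in>?L - ?K. \<psi> v)"
    by (simp add: poly_0_coeff_0[symmetric] poly_prod)
  also have "\<dots> \<noteq> 0" by (simp add: finite_linear_forms)
  finally show "\<psi> (dickson d k) \<noteq> 0" by (simp add: hom_dickson[OF \<psi>] e)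
qed

lemma dickson_invariant:
  fixes G :: "'k::{finite,field} mat set"
  assumes G: "subgroup G (GL d)"
  shows "(dickson d j :: 'k mpoly) \<in> carrier (invariant_ring d G)"
proof -
  interpret S: invariants d G G by (rule invariants_subgroup[OF G])
  let ?L = "linear_forms d :: 'k mpoly set"
  let ?X = "{P :: 'k mpoly poly. \<forall>n. coeff P n \<in> mpolys d}"
  have "(\<Prod>v\<in>?L. [:v, 1:]) \<in> ?X"
  proof (rule closed_under_ring_ops_prod)
    show "closed_under_ring_ops ?X" unfolding mpolys_eq by (rule coeffs_closed)
    show "[:v, 1:] \<in> ?X" if "v \<in> ?L" for v
      using that linear_forms_mpolys by (auto simp: coeff_pCons mpolys_eq mpolys_on_ops split: nat.split)
  qed
  then have "(dickson d j :: 'k mpoly) \<in> mpolys d"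
    unfolding dickson_def mpolys_eq by (auto intro!: mpolys_on_ops)
  moreover have "mat_subst d A (dickson d j) = (dickson d j :: 'k mpoly)" if A: "A \<in> G" for A
  proof -
    have GA: "A \<in> carrier (GL d)" using A G by (simp add: subgroup.mem_carrier)
    have "mat_subst d A (lform d c) = lform d (\<lambda>l. \<Sum>i<d. c i * A $$ (i, l))" for c
    proof -
      have "mat_subst d A (lform d c) = (\<Sum>i<d. \<Sum>l<d. mconst (c i) * (mconst (A $$ (i, l)) * mvar l))"
        by (simp add: lform_def mat_subst.hom_sum mat_subst.hom_mult mat_subst_mvar sum_distrib_left)
      also have "\<dots> = (\<Sum>l<d. \<Sum>i<d. mconst (c i) * (mconst (A $$ (i, l)) * mvar l))"
        by (rule sum.swap)
      finally show ?thesis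
        by (simp add: lform_def mconst.hom_sum mconst.hom_mult sum_distrib_right mult.assoc)
    qed
    then have sub: "mat_subst d A ` ?L \<subseteq> ?L" by (auto simp: linear_forms_eq)
    note perm = mat_subst_permutes[OF GA finite_linear_forms linear_forms_mpolys sub]
    have "mat_subst d A (dickson d j)
        = (- 1) ^ (d - j) * coeff (\<Prod>v\<in>?L. [:mat_subst d A v, 1:]) (CARD('k) ^ j)"
      by (rule hom_dickson[OF mat_subst_hom])
    also have "(\<Prod>v\<in>?L. [:mat_subst d A v, 1:]) = (\<Prod>v\<in>mat_subst d A ` ?L. [:v, 1:])"
      using perm(1) by (simp add: prod.reindex)
    finally show ?thesis by (simp only: perm(2) dickson_def)
  qed
  ultimately show ?thesis by (simp add: S.carrier_eq)
qed

lemma card_kernel_projection: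
  fixes a :: "nat \<Rightarrow> nat \<Rightarrow> 'k::{finite,field}"
  assumes C: "C \<subseteq> {..<d}" and a: "\<And>i b. i \<in> C \<Longrightarrow> b \<in> C \<Longrightarrow> a i b = (if i = b then 1 else 0)"
  shows "card {v \<in> linear_forms d. projection C a v = 0} = CARD('k) ^ (d - card C)"
proof -
  interpret \<pi>: comm_ring_hom "projection C a" by (rule projection_hom)
  have finC: "finite C" using C finite_subset by blast
  let ?D = "{..<d} - C"
  define ext where "ext e j = (if j \<in> C then - (\<Sum>i\<in>?D. e i * a i j) else e j)" for e :: "nat \<Rightarrow> 'k" and j
  have split: "(\<Sum>i<d. c i * a i b) = c b + (\<Sum>i\<in>?D. c i * a i b)" if b: "b \<in> C" for c b
  proof -
    have "(\<Sum>i<d. c i * a i b) = (\<Sum>i\<in>?D. c i * a i b) + (\<Sum>i\<in>C. c i * a i b)"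
      by (rule sum.subset_diff) (use C in auto)
    also have "(\<Sum>i\<in>C. c i * a i b) = (\<Sum>i\<in>C. if i = b then c i else 0)"
      using a b by (intro sum.cong) auto
    also have "\<dots> = c b" using b finC by simp
    finally show ?thesis by simp
  qed
  have ker: "projection C a (lform d c) = 0 \<longleftrightarrow> (\<forall>b\<in>C. c b = - (\<Sum>i\<in>?D. c i * a i b))" for c
  proof -
    have "projection C a (lform d c) = (\<Sum>i<d. \<Sum>b\<in>C. mconst (c i) * (mconst (a i b) * mvar b))"
      by (simp add: lform_def \<pi>.hom_sum \<pi>.hom_mult projection_mvar sum_distrib_left)
    also have "\<dots> = (\<Sum>b\<in>C. \<Sum>i<d. mconst (c i) * (mconst (a i b) * mvar b))"
      by (rule sum.swap)
    also have "\<dots> = (\<Sum>b\<in>C. mconst (\<Sum>i<d. c i * a i b) * mvar b)"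
      by (simp add: mconst.hom_sum mconst.hom_mult sum_distrib_right mult.assoc)
    finally show ?thesis
      by (simp add: linear_combination_0_iff[OF finC] split eq_neg_iff_add_eq_0)
  qed
  have inj: "inj_on (\<lambda>e. lform d (ext e)) (?D \<rightarrow>\<^sub>E UNIV)"
  proof (rule inj_onI)
    fix e e' :: "nat \<Rightarrow> 'k"
    assume e: "e \<in> ?D \<rightarrow>\<^sub>E UNIV" "e' \<in> ?D \<rightarrow>\<^sub>E UNIV" and eq: "lform d (ext e) = lform d (ext e')"
    have "(\<Sum>j<d. mconst (ext e j - ext e' j) * mvar j) = lform d (ext e) - lform d (ext e')"
      by (simp add: lform_def mconst.hom_minus left_diff_distrib sum_subtractf)
    then have "\<forall>j<d. ext e j - ext e' j = 0"
      using eq linear_combination_0_iff[of "{..<d}" "\<lambda>j. ext e j - ext e' j"] by simp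
    then have "e j = e' j" if "j \<in> ?D" for j using that by (auto simp: ext_def)
    then show "e = e'" using e by (intro PiE_ext) auto
  qed
  have "{v \<in> linear_forms d. projection C a v = 0} = (\<lambda>e. lform d (ext e)) ` (?D \<rightarrow>\<^sub>E UNIV)"
  proof (intro equalityI subsetI)
    fix v assume "v \<in> {v \<in> linear_forms d. projection C a v = 0}"
    then obtain c where c: "v = lform d c" "projection C a (lform d c) = 0"
      by (auto simp: linear_forms_eq)
    have "lform d c = lform d (ext (restrict c ?D))"
      unfolding lform_def using c(2) C by (intro sum.cong) (auto simp: ker ext_def)
    then show "v \<in> (\<lambda>e. lform d (ext e)) ` (?D \<rightarrow>\<^sub>E UNIV)"
      using c(1) by (intro image_eqI[of _ _ "restrict c ?D"]) auto
  next
    fix v assume "v \<in> (\<lambda>e. lform d (ext e)) ` (?D \<rightarrow>\<^sub>E (UNIV :: 'k set))"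
    then obtain e where "v = lform d (ext e)" by blast
    moreover have "projection C a (lform d (ext e)) = 0"
      unfolding ker by (auto simp: ext_def)
    ultimately show "v \<in> {v \<in> linear_forms d. projection C a v = 0}" by (auto simp: linear_forms_eq)
  qed
  then have "card {v \<in> linear_forms d. projection C a v = 0} = card (?D \<rightarrow>\<^sub>E (UNIV :: 'k set))"
    using card_image[OF inj] by simp
  also have "\<dots> = CARD('k) ^ (d - card C)"
    using C finC by (simp add: card_funcsetE card_Diff_subset)
  finally show ?thesis .
qed

section \<open>Chains of primes over a stable prime\<close>

lemma (in invariants) kernel_primeideal:
  assumes "comm_ring_hom (\<psi> :: 'k mpoly \<Rightarrow> 'k mpoly)"
  shows "primeideal {r \<in> carrier S. \<psi> r = 0} S"
proof -
  interpret \<psi>: comm_ring_hom \<psi> by fact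
  interpret cring S by (rule cring)
  have minus: "\<ominus>\<^bsub>S\<^esub> r = - r" if "r \<in> carrier S" for r
    using minus_equality[of "- r" r] that closed by simp
  show ?thesis
  proof (rule primeidealI)
    show "ideal {r \<in> carrier S. \<psi> r = 0} S"
    proof (rule idealI[OF ring_axioms])
      show "subgroup {r \<in> carrier S. \<psi> r = 0} (add_monoid S)"
      proof (rule subgroup.intro)
        show "inv\<^bsub>add_monoid S\<^esub> r \<in> {r \<in> carrier S. \<psi> r = 0}" if "r \<in> {r \<in> carrier S. \<psi> r = 0}" for r
          unfolding a_inv_def[symmetric] using that by (simp add: minus closed \<psi>.hom_uminus)
      qed (auto simp: closed \<psi>.hom_add)
    qed (auto simp: closed \<psi>.hom_mult)
    show "carrier S \<noteq> {r \<in> carrier S. \<psi> r = 0}" using closed(6) \<psi>.hom_one by force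
  qed (auto simp: \<psi>.hom_mult is_cring)
qed

text \<open>
  A stable prime ideal \<open>Q\<close> is the kernel of a projection onto the span of some coordinates \<open>B\<close>;
  omitting these coordinates one by one gives a chain of primes, which the Dickson polynomials
  show to be strictly increasing after intersection with the invariants.
\<close>

lemma stable_prime_chain:
  fixes G :: "'k::{finite,field} mat set"
  assumes G: "subgroup G (GL d)" and Q: "stable_prime d Q"
  obtains l P where "prime_chain (invariant_ring d G) l P" and "P 0 = Q \<inter> carrier (invariant_ring d G)"
    and "l \<le> d" and "\<And>j. j < d - l \<Longrightarrow> dickson d j \<in> Q"
proof -
  interpret Q: stable_prime d Q by fact
  interpret S: invariants d G G by (rule invariants_subgroup[OF G])
  have SR: "carrier S.S \<subseteq> mpolys d" using S.carrier_eq by blast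
  obtain B a where B: "B \<subseteq> {..<d}"
    and a: "\<And>i b. i \<in> B \<Longrightarrow> b \<in> B \<Longrightarrow> a i b = (if i = b then 1 else 0 :: 'k)"
    and ker: "\<And>r. r \<in> mpolys d \<Longrightarrow> r \<in> Q \<longleftrightarrow> projection B a r = 0"
    by (rule Q.kernel_of_projection) (rule that)
  have finB: "finite B" using B finite_subset by blast
  define l where "l = card B"
  have l: "l \<le> d" using card_mono[OF _ B] by (simp add: l_def)
  obtain f where f: "bij_betw f {..<l} B" using finB ex_bij_betw_nat_finite[of B] by (auto simp: l_def atLeast0LessThan)
  define C where "C t = f ` {t..<l}" for t
  have C0: "C 0 = B" using f by (auto simp: C_def bij_betw_def atLeast0LessThan)
  have CB: "C t \<subseteq> B" for t using C0 by (auto simp: C_def)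
  have Cm: "C (Suc t) \<subseteq> C t" for t by (auto simp: C_def)
  have cC: "card (C t) = l - t" for t
    unfolding C_def using f by (subst card_image) (auto simp: bij_betw_def intro: inj_on_subset)
  note hom = projection_hom[of "C t" a for t]
  have card: "card {v \<in> linear_forms d. projection (C t) a v = 0} = CARD('k) ^ (d - (l - t))" for t
    using card_kernel_projection[of "C t" d a] CB[of t] B a by (simp add: cC subset_iff)
  have mono: "projection (C (Suc t)) a r = 0" if r: "r \<in> mpolys d" "projection (C t) a r = 0" for r t
  proof -
    let ?\<tau> = "mpoly_eval mconst (\<lambda>i. if i \<in> C (Suc t) then mvar i else (0 :: 'k mpoly))"
    have \<tau>: "comm_ring_hom ?\<tau>" by (rule mpoly_eval_hom[OF mconst_hom])
    interpret \<tau>: comm_ring_hom ?\<tau> by fact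
    have "?\<tau> (projection (C t) a r) = projection (C (Suc t)) a r"
    proof (rule hom_eqI[where f = "\<lambda>r. ?\<tau> (projection (C t) a r)" and B = UNIV, OF _ hom])
      show "comm_ring_hom (\<lambda>r. ?\<tau> (projection (C t) a r))" by (rule comm_ring_hom_comp[OF hom \<tau>])
      show "?\<tau> (projection (C t) a (mconst c)) = projection (C (Suc t)) a (mconst c)" for c
        by (simp add: mpoly_eval_mconst[OF mconst_hom])
      fix i
      have "?\<tau> (projection (C t) a (mvar i))
          = (\<Sum>b\<in>C t. mconst (a i b) * (if b \<in> C (Suc t) then mvar b else 0))"
        by (simp add: projection_mvar \<tau>.hom_sum \<tau>.hom_mult mpoly_eval_mconst[OF mconst_hom] mpoly_eval_mvar[OF mconst_hom])
      also have "\<dots> = (\<Sum>b\<in>C (Suc t). mconst (a i b) * (if b \<in> C (Suc t) then mvar b else 0))"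
        using Cm by (intro sum.mono_neutral_right) (auto simp: C_def)
      finally show "?\<tau> (projection (C t) a (mvar i)) = projection (C (Suc t)) a (mvar i)"
        by (simp add: projection_mvar)
    qed simp
    then show ?thesis using r(2) \<tau>.hom_zero by simp
  qed
  let ?P = "\<lambda>t. {r \<in> carrier S.S. projection (C t) a r = 0}"
  show ?thesis
  proof (rule that[of l ?P])
    show "prime_chain S.S l ?P"
      unfolding prime_chain_def
    proof (intro conjI allI impI)
      show "primeideal (?P t) S.S" for t by (rule S.kernel_primeideal[OF hom])
      fix t assume t: "t < l"
      have "dickson d (d - (l - t)) \<in> ?P (Suc t)"
        using hom_dickson_kernel(1)[OF hom card, of "d - (l - t)" "Suc t"] dickson_invariant[OF G] t l by auto
      moreover have "dickson d (d - (l - t)) \<notin> ?P t"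
        using hom_dickson_kernel(2)[OF hom card] by simp
      ultimately show "?P t \<subset> ?P (Suc t)" using mono SR by blast
    qed
    show "?P 0 = Q \<inter> carrier S.S" using ker SR by (auto simp: C0)
    show "dickson d j \<in> Q" if "j < d - l" for j
    proof -
      have "(dickson d j :: 'k mpoly) \<in> mpolys d" by (rule subsetD[OF SR dickson_invariant[OF G]])
      then show ?thesis
        using hom_dickson_kernel(1)[OF hom card, of j 0] that by (simp add: ker C0)
    qed
  qed (rule l)
qed

theorem theorem1p2:
  fixes d i :: nat and g :: int
    and G :: "'k::{finite,field} mat set"
    and S :: "'k mpoly ring"
    and I J :: "'k mpoly set"
    and E :: "nat \<Rightarrow> ('k mpoly, 'e) module"
    and \<epsilon> :: "'k mpoly \<Rightarrow> 'e"
    and \<delta> :: "nat \<Rightarrow> 'e \<Rightarrow> 'e"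
  assumes "subgroup G (GL d)"
    and "S = invariant_ring d G"
    and "homogeneous_ideal I S"
    and "injective_resolution S (ring_module S) E \<epsilon> \<delta>"
    and "J = radical S (annihilator S (local_cohomology S I E \<delta> i))"
    and "J \<noteq> {\<zero>\<^bsub>S\<^esub>}"
    and "krull_dim (S Quot J) = ereal (of_int (int d - g))"
  shows "\<forall>j. j < d \<and> int j \<le> g - 1 \<longrightarrow> dickson d j \<in> J"
proof (intro allI impI, rule ccontr)
  fix j assume j: "j < d \<and> int j \<le> g - 1" and nJ: "dickson d j \<notin> J"
  note G = assms(1) and S = assms(2)
  interpret inv: invariants d G G by (rule invariants_subgroup[OF G])
  interpret R: invariants d "{} :: 'k mat set" "{} :: 'k mat set" by (rule polynomial_ring_invariants)
  interpret SR: cring S unfolding S by (rule inv.cring)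
  interpret RR: cring R.S by (rule R.cring)
  have RC: "carrier R.S = mpolys d" using R.carrier_eq by simp
  have I: "ideal I S" using assms(3) by (simp add: homogeneous_ideal_def)
  define A where "A = annihilator S (local_cohomology S I E \<delta> i)"
  have A: "ideal A S"
    unfolding A_def by (rule annihilator_local_cohomology_ideal[OF SR.is_cring assms(4) I])
  have stable: "coeff (taylor (power_field e) a) n \<in> A" if "a \<in> A" for a e n
    unfolding A_def
    by (rule higher_derivation_annihilator[OF _ SR.is_cring assms(4) I])
      (use inv.higher_derivation_taylor that in \<open>auto simp: S A_def\<close>)
  have JA: "J = radical S A" using assms(5) by (simp add: A_def)
  have J: "ideal J S" unfolding JA by (rule SR.radical_ideal[OF A])
  let ?s = "dickson d j"
  have s: "?s \<in> carrier S" unfolding S by (rule dickson_invariant[OF G])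
  have sA: "?s ^ n \<notin> A" for n :: nat
    using nJ s unfolding JA radical_def S by (auto simp: inv.nat_pow)
  obtain p where p: "primeideal p S" "A \<subseteq> p" "p \<inter> range (\<lambda>n. ?s ^ n) = {}"
  proof (rule SR.prime_ideal_avoiding[of "range (\<lambda>n. ?s ^ n)" A])
    show "range (\<lambda>n. ?s ^ n) \<subseteq> carrier S" using s inv.closed(5) unfolding S by blast
    show "\<one>\<^bsub>S\<^esub> \<in> range (\<lambda>n. ?s ^ n)" using range_eqI[of 1 "\<lambda>n. ?s ^ n" 0] by (simp add: S)
    show "x \<otimes>\<^bsub>S\<^esub> y \<in> range (\<lambda>n. ?s ^ n)" if "x \<in> range (\<lambda>n. ?s ^ n)" "y \<in> range (\<lambda>n. ?s ^ n)" for x y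
      using that by (auto simp: S power_add[symmetric])
  qed (use A sA in blast)+
  have sp: "?s \<notin> p" using p(3) range_eqI[of ?s "\<lambda>n. ?s ^ n" 1] by auto
  obtain Q0 where Q0: "primeideal Q0 R.S" "Q0 \<inter> carrier S = p"
    using lying_over[OF G] p(1) unfolding S by metis
  have "A \<subseteq> Q0" using p(2) Q0(2) by blast
  \<comment> \<open>\<open>Q0\<close> need not be stable under the Steenrod operations, but a prime minimal over the stable set
    \<open>A\<close> is.\<close>
  then obtain Q where Q: "primeideal Q R.S" "A \<subseteq> Q" "Q \<subseteq> Q0"
    and min: "\<And>Q'. primeideal Q' R.S \<Longrightarrow> A \<subseteq> Q' \<Longrightarrow> Q' \<subseteq> Q \<Longrightarrow> Q' = Q"
    using RR.minimal_prime_ideal[OF Q0(1)] by metis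
  have sQ: "?s \<notin> Q" using sp Q0(2) Q(3) s by blast
  interpret Q: primeideal Q R.S by (rule Q(1))
  have Qs: "stable_prime d Q"
  proof
    show "Q \<subseteq> mpolys d" using primeideal_subset[OF Q(1)] RC by simp
    show "0 \<in> Q" using Q.zero_closed by simp
    show "a + b \<in> Q" if "a \<in> Q" "b \<in> Q" for a b using Q.a_closed[OF that] by simp
    show "r * a \<in> Q" if "r \<in> mpolys d" "a \<in> Q" for r a using Q.I_l_closed[OF that(2)] that(1) RC by simp
    show "1 \<notin> Q" using Q.one_imp_carrier Q.I_notcarr by auto
    show "a \<in> Q \<or> b \<in> Q" if "a \<in> mpolys d" "b \<in> mpolys d" "a * b \<in> Q" for a b
      using Q.I_prime[of a b] that RC by simp
    show "coeff (taylor (power_field e) f) 1 \<in> Q" if "f \<in> Q" for f e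
      by (rule minimal_prime_stable[OF R.higher_derivation_taylor RR.is_cring Q(1,2) min stable that])
  qed
  obtain l P where P: "prime_chain S l P" "P 0 = Q \<inter> carrier S" and l: "l \<le> d"
    and dQ: "\<And>j. j < d - l \<Longrightarrow> dickson d j \<in> Q"
    using stable_prime_chain[OF G Qs] unfolding S by metis
  have "J \<subseteq> P 0"
  proof
    fix x assume "x \<in> J"
    then obtain n :: nat where x: "x \<in> carrier S" "x ^ n \<in> A"
      by (auto simp: JA radical_def S inv.nat_pow)
    have "x \<in> mpolys d" using x(1) inv.carrier_eq S by auto
    then have "x \<in> Q" using stable_prime.power[OF Qs] x(2) Q(2) by blast
    then show "x \<in> P 0" using P(2) x(1) by simp
  qed
  then have "ereal (real l) \<le> krull_dim (S Quot J)"
    by (rule krull_dim_quotient_ge[OF SR.is_cring J P(1)])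
  then have "real l \<le> of_int (int d - g)" by (simp add: assms(7))
  then have "int l \<le> int d - g" by linarith
  moreover have "\<not> j < d - l" using dQ sQ by blast
  ultimately show False using j l by linarith
qed

end
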